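(* Let $(X_\omega)_{\omega\in[0,1)}$ be a scale of complex Banach spaces with $X_{\omega'}\subset X_{\omega''}$ for $\omega'<\omega''$. Let $A$ be a linear operator on this scale which, for every pair $\omega'<\omega''$ in $[0,1)$, is bounded from $X_{\omega'}$ to $X_{\omega''}$ with $$\|A\|_{\omega'\to\omega''}\le \frac{C}{\omega''-\omega'},$$ where the constant $C$ does not depend on $\omega',\omega''$. Fix $0\le\omega'<\omega''<1$ and $u_0\in X_{\omega'}$ with $Au_0\in X_{\omega'}$. Let $$u(t)=\sum_{n=0}^\infty \frac{t^n}{n!}A^nu_0,\qquad |t|<T_{\omega',\omega''},$$ be the $X_{\omega''}$-valued local solution of $\frac{du}{dt}=Au$, $u(0)=u_0$. For $1<\delta<2$ let $$u_\delta(t)=\sum_{n=0}^\infty \frac{t^{\delta n}}{\Gamma(\delta n+1)}A^nu_0,\qquad t\ge 0,$$ be the $X_{\omega''}$-valued solution of $\mathbb D_t^{(\delta)}u_\delta=Au_\delta$, $u_\delta(0)=u_0$, $u_\delta'(0)=0$. Let $t\mapsto u_\delta(t^{1/\delta})$ also denote the entire $X_{\omega''}$-valued function $$u_\delta(t^{1/\delta})=\sum_{n=0}^\infty \frac{t^n}{\Gamma(\delta n+1)}A^nu_0,\qquad t\in\mathbb C.$$ Suppose that $u$ is continued along rays from the origin to a single-valued holomorphic $X_{\omega''}$-valued function, still denoted $u$, on its Mittag-Leffler star $G(u)$. Then, as $\delta\to1+0$, $$u_\delta(t^{1/\delta})\longrightarrow u(t),\qquad t\in G(u),$$ in the norm of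 $X_{\omega''}$, uniformly on any closed bounded domain contained in $G(u)$.
   Context: The inclusions $X_{\omega'}\subset X_{\omega''}$ are inclusions of linear subspaces. The operator $A$ is a single linear operator acting consistently on the scale: for each pair $\omega'<\omega''$ it maps $X_{\omega'}$ into $X_{\omega''}$, so $A^nu_0\in X_{\omega''}$ for all $n$ whenever $u_0\in X_{\omega'}$ and $\omega'<\omega''$. $\|A\|_{\omega'\to\omega''}$ is the operator norm of $A:X_{\omega'}\to X_{\omega''}$. $T_{\omega',\omega''}>0$ is a number such that the power series $\sum_{n\ge 0}\frac{t^n}{n!}A^nu_0$ converges in $X_{\omega''}$ for $|t|<T_{\omega',\omega''}$; such a number exists when $A$ is bounded from $X_{a}$ to $X_{b}$ with $\|A\|_{a\to b}\le \frac{C}{b-a}$ for all $0\le a<b<1$ (with $C$ independent of $a,b$), $0\le\omega'<\omega''<1$, $u_0\in X_{\omega'}$ and $Au_0\in X_{\omega'}$. When $A$ is bounded from $X_{a}$ to $X_{b}$ with $\|A\|_{a\to b}\le \frac{C}{b-a}$ for all $0\le a<b<1$ (with $C$ independent of $a,b$), $0\le\omega'<\omega''<1$, $u_0\in X_{\omega'}$ and $Au_0\in X_{\omega'}$, the series $\sum_{n\ge 0}\frac{t^n}{\Gamma(\delta n+1)}A^nu_0$ converges in $X_{\omega''}$ for all $t\in\mathbb C$ when $\delta>1$. $\mathbb D_t^{(\delta)}$ denotes the Caputo-Djrbashian fractional derivative of order $\delta$ in $t$. For $1<\delta<2$ it is $(\mathbb D_t^{(\delta)}v)(t)=\frac{1}{\Gamma(2-\delta)}\int_0^t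 (t-s)^{1-\delta}v''(s)\,ds$, or its standard regularized form. Mittag-Leffler star: let $f$ be a holomorphic (possibly Banach-space-valued) function on a neighborhood of $z=0$, determined there by a convergent power series. The Mittag-Leffler star $G(f)$ is the domain obtained from $\mathbb C$ by drawing a ray from the origin to each singular point of $f$ and cutting the plane along the part of the ray located after the singular point (the singular point itself is also removed). Equivalently, $G(f)$ is the set of all $z\in\mathbb C$ such that $f$ can be continued analytically from $0$ along the straight segment $[0,z]$. For example, the star of $\sum_{n\ge0} z^n=\frac1{1-z}$ is $\mathbb C\setminus[1,\infty)$. *)

theory Defs
  imports "HOL-Analysis.Analysis"
begin

text \<open>A scale of complex Banach spaces is a family of subspaces, each with its own norm, of one
  ambient complex vector space (for instance of the union of the scale). Each member is thus a
  carrier set \<open>S\<close> with a norm \<open>N\<close> whose values outside \<open>S\<close> are irrelevant.\<close>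

definition norm_dist :: "'e::ab_group_add set \<Rightarrow> ('e \<Rightarrow> real) \<Rightarrow> 'e \<Rightarrow> 'e \<Rightarrow> real" where
  "norm_dist S N x y = (if x \<in> S \<and> y \<in> S then N (x - y) else 0)"

definition norm_topology :: "'e::ab_group_add set \<Rightarrow> ('e \<Rightarrow> real) \<Rightarrow> 'e topology" where
  "norm_topology S N = Metric_space.mtopology S (norm_dist S N)"

locale complex_normed_subspace = vector_space scaleC
  for scaleC :: "complex \<Rightarrow> 'e::ab_group_add \<Rightarrow> 'e" +
  fixes S :: "'e set" and N :: "'e \<Rightarrow> real"
  assumes subspace_carrier: "subspace S"
    and norm_eq_zero: "x \<in> S \<Longrightarrow> N x = 0 \<longleftrightarrow> x = 0"
    and norm_scale: "x \<in> S \<Longrightarrow> N (scaleC c x) = cmod c * N x"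
    and norm_triangle: "x \<in> S \<Longrightarrow> y \<in> S \<Longrightarrow> N (x + y) \<le> N x + N y"
begin

lemma norm_minus: "x \<in> S \<Longrightarrow> N (- x) = N x"
  using norm_scale[of x "-1"] by simp

lemma norm_nonneg: "x \<in> S \<Longrightarrow> 0 \<le> N x"
  using norm_triangle[of x "- x"] norm_minus[of x] norm_eq_zero[of 0]
    subspace_neg[OF subspace_carrier, of x] subspace_0[OF subspace_carrier]
  by simp

sublocale Metric_space S "norm_dist S N"
proof
  fix x y z
  show "0 \<le> norm_dist S N x y"
    by (simp add: norm_dist_def norm_nonneg subspace_diff[OF subspace_carrier])
  show "norm_dist S N x y = norm_dist S N y x"
    using norm_minus[of "x - y"] by (simp add: norm_dist_def subspace_diff[OF subspace_carrier])
  show "x \<in> S \<Longrightarrow> y \<in> S \<Longrightarrow> norm_dist S N x y = 0 \<longleftrightarrow> x = y"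
    by (simp add: norm_dist_def norm_eq_zero subspace_diff[OF subspace_carrier])
  show "x \<in> S \<Longrightarrow> y \<in> S \<Longrightarrow> z \<in> S \<Longrightarrow>
    norm_dist S N x z \<le> norm_dist S N x y + norm_dist S N y z"
    using norm_triangle[of "x - y" "y - z"]
    by (simp add: norm_dist_def subspace_diff[OF subspace_carrier])
qed

lemma limitin_norm_topology:
  "limitin (norm_topology S N) f l F \<longleftrightarrow>
    l \<in> S \<and> (\<forall>\<epsilon>>0. \<forall>\<^sub>F x in F. f x \<in> S \<and> N (f x - l) < \<epsilon>)"
  unfolding norm_topology_def limitin_metric
  by (intro conj_cong refl all_cong eventually_subst always_eventually allI) (auto simp: norm_dist_def)

end

locale complex_banach_subspace = complex_normed_subspace +
  assumes complete: "Metric_space.mcomplete S (norm_dist S N)"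

definition bounded_between :: "'e set \<Rightarrow> ('e \<Rightarrow> real) \<Rightarrow> ('e \<Rightarrow> real) \<Rightarrow> ('e \<Rightarrow> 'e) \<Rightarrow> bool" where
  "bounded_between S N N' A \<longleftrightarrow> (\<exists>K. \<forall>x\<in>S. N' (A x) \<le> K * N x)"

text \<open>As in \<^const>\<open>onorm\<close>, the quotient at \<open>x = 0\<close> is \<open>0\<close>.\<close>

definition opnorm_between :: "'e set \<Rightarrow> ('e \<Rightarrow> real) \<Rightarrow> ('e \<Rightarrow> real) \<Rightarrow> ('e \<Rightarrow> 'e) \<Rightarrow> real" where
  "opnorm_between S N N' A = (SUP x\<in>S. N' (A x) / N x)"

locale banach_scale_operator = vector_space scaleC
  for scaleC :: "complex \<Rightarrow> 'e::ab_group_add \<Rightarrow> 'e" +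
  fixes X :: "real \<Rightarrow> 'e set" and N :: "real \<Rightarrow> 'e \<Rightarrow> real"
    and A :: "'e \<Rightarrow> 'e" and C :: real
  assumes banach: "a \<in> {0..<1} \<Longrightarrow> complex_banach_subspace scaleC (X a) (N a)"
    and inclusion: "0 \<le> a \<Longrightarrow> a < b \<Longrightarrow> b < 1 \<Longrightarrow> X a \<subseteq> X b"
    and A_maps: "0 \<le> a \<Longrightarrow> a < b \<Longrightarrow> b < 1 \<Longrightarrow> A ` X a \<subseteq> X b"
    and A_add: "a \<in> {0..<1} \<Longrightarrow> x \<in> X a \<Longrightarrow> y \<in> X a \<Longrightarrow> A (x + y) = A x + A y"
    and A_scale: "a \<in> {0..<1} \<Longrightarrow> x \<in> X a \<Longrightarrow> A (scaleC c x) = scaleC c (A x)"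
    and A_bounded: "0 \<le> a \<Longrightarrow> a < b \<Longrightarrow> b < 1 \<Longrightarrow> bounded_between (X a) (N a) (N b) A"
    and A_opnorm: "0 \<le> a \<Longrightarrow> a < b \<Longrightarrow> b < 1 \<Longrightarrow>
      opnorm_between (X a) (N a) (N b) A \<le> C / (b - a)"

definition norm_sums :: "'e::ab_group_add set \<Rightarrow> ('e \<Rightarrow> real) \<Rightarrow> (nat \<Rightarrow> 'e) \<Rightarrow> 'e \<Rightarrow> bool" where
  "norm_sums S N a s \<longleftrightarrow> limitin (norm_topology S N) (\<lambda>n. \<Sum>k<n. a k) s sequentially"

definition norm_suminf :: "'e::ab_group_add set \<Rightarrow> ('e \<Rightarrow> real) \<Rightarrow> (nat \<Rightarrow> 'e) \<Rightarrow> 'e" where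
  "norm_suminf S N a = (THE s. norm_sums S N a s)"

definition vholomorphic_on ::
  "(complex \<Rightarrow> 'e::ab_group_add \<Rightarrow> 'e) \<Rightarrow> 'e set \<Rightarrow> ('e \<Rightarrow> real) \<Rightarrow> (complex \<Rightarrow> 'e) \<Rightarrow> complex set \<Rightarrow> bool"
  where
  "vholomorphic_on scaleC S N f G \<longleftrightarrow>
    (\<forall>z\<in>G. f z \<in> S \<and>
      (\<exists>D. limitin (norm_topology S N) (\<lambda>w. scaleC (inverse (w - z)) (f w - f z)) D (at z within G)))"

text \<open>Analytic continuation along a path of the germ of \<open>f\<close> at the starting point: a family of
  function elements \<open>(F s, ball (\<gamma> s) (r s))\<close>, starting from the germ of \<open>f\<close>, such that the germs of
  \<open>F s'\<close> and \<open>F s\<close> at \<open>\<gamma> s'\<close> agree whenever \<open>s'\<close> is close to \<open>s\<close>.\<close>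

definition continuable_along ::
  "(complex \<Rightarrow> 'e::ab_group_add \<Rightarrow> 'e) \<Rightarrow> 'e set \<Rightarrow> ('e \<Rightarrow> real) \<Rightarrow> (complex \<Rightarrow> 'e) \<Rightarrow> (real \<Rightarrow> complex) \<Rightarrow> bool"
  where
  "continuable_along scaleC S N f \<gamma> \<longleftrightarrow>
    (\<exists>F r.
      (\<forall>s\<in>{0..1}. r s > 0 \<and> vholomorphic_on scaleC S N (F s) (ball (\<gamma> s) (r s))) \<and>
      (\<forall>\<^sub>F w in nhds (\<gamma> 0). F 0 w = f w) \<and>
      (\<forall>s\<in>{0..1}. \<exists>e>0. \<forall>s'\<in>{0..1}. \<bar>s' - s\<bar> < e \<longrightarrow>
        \<gamma> s' \<in> ball (\<gamma> s) (r s) \<and> (\<forall>\<^sub>F w in nhds (\<gamma> s'). F s' w = F s w)))"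

text \<open>The Mittag-Leffler star depends only on the germ of \<open>f\<close> at \<open>0\<close>.\<close>

definition mittag_leffler_star ::
  "(complex \<Rightarrow> 'e::ab_group_add \<Rightarrow> 'e) \<Rightarrow> 'e set \<Rightarrow> ('e \<Rightarrow> real) \<Rightarrow> (complex \<Rightarrow> 'e) \<Rightarrow> complex set"
  where
  "mittag_leffler_star scaleC S N f = {z. continuable_along scaleC S N f (linepath 0 z)}"

text \<open>\<open>t\<^sup>\<delta>\<^sup>n\<close> is written \<open>(t powr \<delta>) ^ n\<close> because \<open>0 powr 0 = 0\<close>, while the term for \<open>t = 0\<close> and
  \<open>n = 0\<close> has to be \<open>u0\<close>.\<close>

definition u_frac ::
  "(complex \<Rightarrow> 'e::ab_group_add \<Rightarrow> 'e) \<Rightarrow> 'e set \<Rightarrow> ('e \<Rightarrow> real) \<Rightarrow> ('e \<Rightarrow> 'e) \<Rightarrow> 'e \<Rightarrow> real \<Rightarrow> real \<Rightarrow> 'e"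
  where
  "u_frac scaleC S N A u0 \<delta> t =
    norm_suminf S N (\<lambda>n. scaleC (of_real ((t powr \<delta>) ^ n / Gamma (\<delta> * real n + 1))) ((A ^^ n) u0))"

definition u_frac_entire ::
  "(complex \<Rightarrow> 'e::ab_group_add \<Rightarrow> 'e) \<Rightarrow> 'e set \<Rightarrow> ('e \<Rightarrow> real) \<Rightarrow> ('e \<Rightarrow> 'e) \<Rightarrow> 'e \<Rightarrow> real \<Rightarrow> complex \<Rightarrow> 'e"
  where
  "u_frac_entire scaleC S N A u0 \<delta> t =
    norm_suminf S N (\<lambda>n. scaleC (t ^ n / of_real (Gamma (\<delta> * real n + 1))) ((A ^^ n) u0))"

lemma u_frac_entire_of_real:
  assumes "0 \<le> t" and "0 < \<delta>"
  shows "u_frac_entire scaleC S N A u0 \<delta> (of_real t) = u_frac scaleC S N A u0 \<delta> (t powr (1 / \<delta>))"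
proof -
  have "(t powr (1 / \<delta>)) powr \<delta> = t"
    using assms by (simp add: powr_powr)
  then show ?thesis
    by (simp add: u_frac_entire_def u_frac_def)
qed

end

theory Submission
  imports Defs "HOL-Complex_Analysis.Complex_Analysis" "HOL-Real_Asymp.Real_Asymp"
begin

text \<open>
  Put \<open>a\<^sub>n = A\<^sup>n u0\<close>, all of which lie in \<open>S = X \<omega>''\<close>, because the passage from \<open>\<omega>'\<close> to \<open>\<omega>''\<close> can be
  divided into \<open>n\<close> steps. The theorem is then about a summation method: the local power series
  \<open>\<Sum> t\<^sup>n a\<^sub>n / n!\<close> has its coefficients multiplied by \<open>n! / \<Gamma>(\<delta>n + 1)\<close>, and the resulting entire
  series must tend to the continuation of the sum on the whole star as \<open>\<delta> \<rightarrow> 1+\<close>.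

  Cauchy's formula reduces this to one scalar function. For a closed curve around the segment
  \<open>[0, t]\<close> inside the star, the modified series equals
  \<open>(1 / 2\<pi>i) \<integral> u(\<zeta>) \<phi>\<^sub>\<delta>(t/\<zeta>) d\<zeta>/\<zeta>\<close> with \<open>\<phi>\<^sub>\<delta>(z) = \<Sum> n! z\<^sup>n / \<Gamma>(\<delta>n + 1)\<close>
  (\<open>approx_kernel\<close>), whereas \<open>u(t)\<close> is the same integral with \<open>1/(1 - z)\<close> in place of
  \<open>\<phi>\<^sub>\<delta>(z)\<close>. If the curve is convex, \<open>t/\<zeta>\<close> avoids \<open>[1, \<infinity>)\<close>. So everything follows from
  \<open>kernel_tendsto_geometric\<close>: \<open>\<phi>\<^sub>\<delta> \<rightarrow> 1/(1 - z)\<close> uniformly on compact subsets of the slit plane.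
  Each Taylor coefficient of \<open>\<phi>\<^sub>\<delta>\<close> tends to 1, so by Montel's theorem and the identity theorem it is
  enough that \<open>\<phi>\<^sub>\<delta>\<close> is locally bounded there, uniformly as \<open>\<delta> \<rightarrow> 1+\<close>.

  The local bound comes from two classical devices. With \<open>\<eta> = \<delta> - 1\<close>, the Beta integral
  (\<open>kernel_coeff_integral\<close>) writes \<open>\<phi>\<^sub>\<delta>(z)\<close> as an average of
  \<open>\<Sum> (\<delta>n + 1) w\<^sup>n / \<Gamma>(\<eta>n + 1)\<close> over points \<open>w\<close> of the segment \<open>[0, z]\<close>. Since
  \<open>1/\<Gamma>(\<eta>s + 1)\<close> grows no faster than \<open>exp(\<pi>\<eta>|Im s|/2)\<close> in vertical direction, Lindelof's
  integral (\<open>lindelof_sector_bound\<close>) bounds these sums for \<open>w\<close> in any closed sector that avoids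
  the positive real axis, as soon as \<open>\<eta>\<close> is small compared with the opening that is left out.

  The vector-valued statement is obtained from the scalar one by complex-linear functionals of norm
  at most 1. Every vector is normed by such a functional (\<open>hahn_banach_norming\<close>), and the error
  estimate \<open>kernel_summation_error\<close> depends on the function only through its supremum on the
  curve, so it holds uniformly for all functionals. The same device transfers the identity theorem,
  which shows that the star is open (\<open>open_star\<close>) and thereby leaves room for the curves.
\<close>


section \<open>Norming functionals\<close>

context complex_normed_subspace begin

text \<open>Functionals are functions on the ambient space; the value 0 outside \<open>S\<close> makes their pointwise
  comparison a comparison on \<open>S\<close>.\<close>

definition sublinear :: "('e \<Rightarrow> real) \<Rightarrow> bool" where
  "sublinear p \<longleftrightarrow> (\<forall>x\<in>S. \<forall>y\<in>S. p (x + y) \<le> p x + p y) \<and>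
     (\<forall>x\<in>S. \<forall>t\<ge>0. p (scaleC (of_real t) x) = t * p x) \<and> (\<forall>x. x \<notin> S \<longrightarrow> p x = 0)"

lemma scale_in: "x \<in> S \<Longrightarrow> scaleC c x \<in> S"
  using subspace_carrier subspace_scale by blast

lemmas add_in = subspace_add[OF subspace_carrier]
lemmas diff_in = subspace_diff[OF subspace_carrier]
lemmas zero_in = subspace_0[OF subspace_carrier]
lemmas neg_in = subspace_neg[OF subspace_carrier]

lemma sublinear_add: "sublinear p \<Longrightarrow> x \<in> S \<Longrightarrow> y \<in> S \<Longrightarrow> p (x + y) \<le> p x + p y"
  and sublinear_scale: "sublinear p \<Longrightarrow> x \<in> S \<Longrightarrow> 0 \<le> t \<Longrightarrow> p (scaleC (of_real t) x) = t * p x"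
  and sublinear_outside: "sublinear p \<Longrightarrow> x \<notin> S \<Longrightarrow> p x = 0"
  by (auto simp: sublinear_def)

lemma sublinear_zero: "sublinear p \<Longrightarrow> p 0 = 0"
  using sublinear_scale[of p 0 0] zero_in by simp

lemma sublinear_minus_le: "sublinear p \<Longrightarrow> x \<in> S \<Longrightarrow> - p (- x) \<le> p x"
  using sublinear_add[of p x "- x"] sublinear_zero[of p] neg_in by fastforce

text \<open>For \<open>y \<in> S\<close> and sublinear \<open>p\<close>, this is the greatest sublinear functional \<open>q \<le> p\<close> with
  \<open>q (- y) \<le> - p y\<close>.\<close>

definition lower :: "('e \<Rightarrow> real) \<Rightarrow> 'e \<Rightarrow> 'e \<Rightarrow> real" where
  "lower p y x = (if x \<in> S then INF t\<in>{0..}. p (x + scaleC (of_real t) y) - t * p y else 0)"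

lemma lower_bdd:
  assumes "sublinear p" "x \<in> S" "y \<in> S" "0 \<le> t"
  shows "- p (- x) \<le> p (x + scaleC (of_real t) y) - t * p y"
  using sublinear_add[OF assms(1), of "x + scaleC (of_real t) y" "- x"] sublinear_scale[OF assms(1,3,4)]
    assms scale_in add_in neg_in by simp

lemma lower_le:
  assumes "sublinear p" "x \<in> S" "y \<in> S" "0 \<le> t"
  shows "lower p y x \<le> p (x + scaleC (of_real t) y) - t * p y"
  using assms lower_bdd[OF assms(1-3)] unfolding lower_def
  by (auto intro!: cINF_lower bdd_belowI2)

lemma sublinear_lower:
  assumes p: "sublinear p" and y: "y \<in> S"
  shows "sublinear (lower p y)"
  unfolding sublinear_def
proof (intro conjI ballI allI impI)
  fix x x' assume x: "x \<in> S" "x' \<in> S"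
  have "lower p y (x + x') - (p (x + scaleC (of_real t) y) - t * p y)
     \<le> p (x' + scaleC (of_real t') y) - t' * p y" if "0 \<le> t" "0 \<le> t'" for t t'
  proof -
    have "lower p y (x + x') \<le> p (x + x' + scaleC (of_real (t + t')) y) - (t + t') * p y"
      using that x y by (intro lower_le p add_in) auto
    also have "x + x' + scaleC (of_real (t + t')) y = (x + scaleC (of_real t) y) + (x' + scaleC (of_real t') y)"
      by (simp add: scale_left_distrib)
    also have "p \<dots> \<le> p (x + scaleC (of_real t) y) + p (x' + scaleC (of_real t') y)"
      by (intro sublinear_add p add_in scale_in x y)
    finally show ?thesis by (simp add: algebra_simps)
  qed
  then have "lower p y (x + x') - (p (x + scaleC (of_real t) y) - t * p y) \<le> lower p y x'" if "0 \<le> t" for t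
    unfolding lower_def[of p y x'] using x that by (auto intro!: cINF_greatest)
  then have "lower p y (x + x') - lower p y x' \<le> p (x + scaleC (of_real t) y) - t * p y" if "0 \<le> t" for t
    using that by (simp add: algebra_simps)
  then have "lower p y (x + x') - lower p y x' \<le> lower p y x"
    unfolding lower_def[of p y x] using x by (auto intro!: cINF_greatest)
  then show "lower p y (x + x') \<le> lower p y x + lower p y x'" by simp
next
  fix x t assume x: "x \<in> S" and t: "(0::real) \<le> t"
  have le: "lower p y (scaleC (of_real t) x) \<le> t * lower p y x" if x: "x \<in> S" and t: "0 < t" for x t
  proof -
    have "lower p y (scaleC (of_real t) x) / t \<le> p (x + scaleC (of_real r) y) - r * p y" if r: "0 \<le> r" for r
    proof -
      have "lower p y (scaleC (of_real t) x) \<le> p (scaleC (of_real t) x + scaleC (of_real (t * r)) y) - (t * r) * p y"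
        using r t by (intro lower_le p scale_in x y) auto
      also have "scaleC (of_real t) x + scaleC (of_real (t * r)) y = scaleC (of_real t) (x + scaleC (of_real r) y)"
        by (simp add: scale_right_distrib)
      also have "p \<dots> = t * p (x + scaleC (of_real r) y)"
        using t by (intro sublinear_scale p add_in scale_in x y) auto
      finally show ?thesis using t by (simp add: field_simps)
    qed
    then have "lower p y (scaleC (of_real t) x) / t \<le> lower p y x"
      unfolding lower_def[of p y x] using x by (auto intro!: cINF_greatest)
    then show ?thesis using t by (simp add: field_simps)
  qed
  show "lower p y (scaleC (of_real t) x) = t * lower p y x"
  proof (cases "t = 0")
    case True
    have "lower p y 0 = 0"
    proof -
      have "lower p y 0 = (INF t\<in>{0::real..}. 0)"
        using zero_in sublinear_scale[OF p y] unfolding lower_def by (auto intro!: INF_cong)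
      then show ?thesis by simp
    qed
    then show ?thesis using True by simp
  next
    case False
    have "lower p y (scaleC (of_real (inverse t)) (scaleC (of_real t) x)) \<le> inverse t * lower p y (scaleC (of_real t) x)"
      using False t by (intro le scale_in x) auto
    also have "scaleC (of_real (inverse t)) (scaleC (of_real t) x) = x"
      using False by (simp flip: of_real_mult)
    finally have "t * lower p y x \<le> lower p y (scaleC (of_real t) x)"
      using False t by (simp add: field_simps)
    then show ?thesis using le[OF x, of t] False t by simp
  qed
qed (auto simp: lower_def)

lemma lower_le_self: "sublinear p \<Longrightarrow> y \<in> S \<Longrightarrow> lower p y x \<le> p x"
  using lower_le[of p x y 0] by (cases "x \<in> S") (auto simp: lower_def sublinear_outside)

text \<open>Zorn's lemma yields a minimal sublinear functional: the pointwise infimum of a chain is finite since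
  \<open>- p (- x)\<close> is a lower bound at \<open>x\<close>. A minimal \<open>q\<close> is additive because \<open>lower q y\<close> cannot be strictly below it.\<close>

lemma minimal_sublinear_below:
  assumes p: "sublinear p"
  obtains q where "sublinear q" "\<And>x. q x \<le> p x" "\<And>x y. x \<in> S \<Longrightarrow> y \<in> S \<Longrightarrow> q (x + y) = q x + q y"
proof -
  define \<A> where "\<A> = {q. sublinear q \<and> (\<forall>x. q x \<le> p x)}"
  define r where "r = {(q, q'). q \<in> \<A> \<and> q' \<in> \<A> \<and> (\<forall>x. q' x \<le> q x)}"
  have F: "Field r = \<A>" unfolding r_def Field_def by auto
  have "\<exists>m\<in>Field r. \<forall>a\<in>Field r. (m, a) \<in> r \<longrightarrow> a = m"
  proof (rule Zorns_po_lemma)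
    show "Partial_order r"
      unfolding order_on_defs F
      by (auto simp: r_def refl_on_def trans_def antisym_def fun_eq_iff intro: order_trans order_antisym)
    fix Ch assume Ch: "Ch \<in> Chains r"
    have ChA: "q \<in> \<A>" if "q \<in> Ch" for q
      using Ch that by (auto simp: Chains_def r_def)
    show "\<exists>u\<in>Field r. \<forall>a\<in>Ch. (a, u) \<in> r"
    proof (cases "Ch = {}")
      case True
      then show ?thesis using p F by (auto simp: \<A>_def)
    next
      case False
      define u where "u = (\<lambda>x. if x \<in> S then INF q\<in>Ch. q x else 0)"
      have bdd: "bdd_below ((\<lambda>q. q x) ` Ch)" if "x \<in> S" for x
      proof (rule bdd_belowI2)
        fix q assume "q \<in> Ch"
        then have "sublinear q" "q (- x) \<le> p (- x)" using ChA by (auto simp: \<A>_def)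
        then show "- p (- x) \<le> q x" using sublinear_minus_le[of q x] that by linarith
      qed
      have u_le: "u x \<le> q x" if "q \<in> Ch" for q x
        using that bdd[of x] ChA[OF that] by (auto simp: u_def \<A>_def sublinear_outside intro!: cINF_lower)
      have "sublinear u"
        unfolding sublinear_def
      proof (intro conjI ballI allI impI)
        fix x y assume xy: "x \<in> S" "y \<in> S"
        have one: "u (x + y) \<le> q x + q' y" if q: "q \<in> Ch" "q' \<in> Ch" for q q'
        proof -
          have "(\<forall>x. q x \<le> q' x) \<or> (\<forall>x. q' x \<le> q x)"
            using Ch q unfolding Chains_def r_def by blast
          then obtain s where s: "s \<in> Ch" "\<And>x. s x \<le> q x" "\<And>x. s x \<le> q' x"
            using q by (metis order_refl)
          have "u (x + y) \<le> s (x + y)" by (rule u_le) fact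
          also have "\<dots> \<le> s x + s y" using ChA[OF s(1)] xy by (auto simp: \<A>_def sublinear_add)
          finally show ?thesis using s(2)[of x] s(3)[of y] by linarith
        qed
        have two: "u (x + y) - q x \<le> q' y" if "q \<in> Ch" "q' \<in> Ch" for q q'
          using one[OF that] by linarith
        have INFs: "u x = (INF q\<in>Ch. q x)" "u y = (INF q\<in>Ch. q y)" using xy by (simp_all add: u_def)
        have "u (x + y) - q x \<le> u y" if "q \<in> Ch" for q
          unfolding INFs using False two[OF that] by (rule cINF_greatest)
        then have "u (x + y) - u y \<le> q x" if "q \<in> Ch" for q
          using that by (simp add: algebra_simps)
        then have "u (x + y) - u y \<le> u x"
          unfolding INFs(1) using False by (intro cINF_greatest)
        then show "u (x + y) \<le> u x + u y" by simp
      next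
        fix x t assume x: "x \<in> S" and t: "(0::real) \<le> t"
        have "u (scaleC (of_real t) x) = (INF q\<in>Ch. t * q x)"
          unfolding u_def using x scale_in
          by (auto intro!: INF_cong sublinear_scale t dest!: ChA simp: \<A>_def)
        also have "\<dots> = t * (INF q\<in>Ch. q x)"
        proof (cases "t = 0")
          case False
          then have t: "t > 0" using t by simp
          have "mono ((*) t)" using t by (auto intro!: monoI)
          moreover have "continuous (at_right (INF q\<in>Ch. q x)) ((*) t)" by (intro continuous_intros)
          ultimately have "t * Inf ((\<lambda>q. q x) ` Ch) = Inf ((*) t ` (\<lambda>q. q x) ` Ch)"
            using bdd[OF x] \<open>Ch \<noteq> {}\<close> by (intro continuous_at_Inf_mono) auto
          then show ?thesis by (simp add: image_image)
        qed (use \<open>Ch \<noteq> {}\<close> in auto)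
        finally show "u (scaleC (of_real t) x) = t * u x" using x by (simp add: u_def)
      qed (auto simp: u_def)
      moreover obtain q where "q \<in> Ch" using False by auto
      ultimately have "u \<in> \<A>"
        using u_le[of q] ChA[of q] unfolding \<A>_def by (fastforce intro: order_trans)
      then show ?thesis using u_le ChA F by (auto simp: r_def intro!: bexI[of _ u])
    qed
  qed
  then obtain q where q: "q \<in> \<A>" and min: "\<And>q'. (q, q') \<in> r \<Longrightarrow> q' = q"
    unfolding F using F by (metis (no_types, lifting) FieldI2)
  have sub: "sublinear q" using q by (simp add: \<A>_def)
  have "q (x + y) = q x + q y" if xy: "x \<in> S" "y \<in> S" for x y
  proof -
    have "lower q y \<in> \<A>"
      using q lower_le_self[OF sub xy(2)] sublinear_lower[OF sub xy(2)]
      by (auto simp: \<A>_def intro: order_trans)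
    then have "lower q y = q"
      using q lower_le_self[OF sub xy(2)] by (intro min) (auto simp: r_def)
    then have "q x \<le> q (x + y) - q y" using lower_le[OF sub xy, of 1] by simp
    then show ?thesis using sublinear_add[OF sub xy] by simp
  qed
  then show ?thesis using that sub q by (auto simp: \<A>_def)
qed

definition contraction :: "('e \<Rightarrow> complex) \<Rightarrow> bool" where
  "contraction f \<longleftrightarrow> (\<forall>x\<in>S. \<forall>y\<in>S. f (x + y) = f x + f y) \<and> (\<forall>c. \<forall>x\<in>S. f (scaleC c x) = c * f x) \<and>
     (\<forall>x\<in>S. norm (f x) \<le> N x)"

text \<open>The Hahn-Banach theorem in the form needed here. Below \<open>lower N z\<close>, an additive functional \<open>g\<close>
  satisfies \<open>g (- z) \<le> - N z\<close> and so attains the norm at \<open>z\<close>; its complexification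
  \<open>g x - i g (i x)\<close> is bounded by the norm because a rotation of \<open>x\<close> makes its value real.\<close>

lemma hahn_banach_norming:
  assumes z: "z \<in> S"
  obtains f where "contraction f" "f z = of_real (N z)"
proof -
  define p where "p = (\<lambda>x. if x \<in> S then N x else 0)"
  have p: "sublinear p"
    unfolding sublinear_def p_def using norm_triangle norm_scale add_in scale_in by auto
  obtain g where g: "sublinear g" "\<And>x. g x \<le> lower p z x"
    and add: "\<And>x y. x \<in> S \<Longrightarrow> y \<in> S \<Longrightarrow> g (x + y) = g x + g y"
    using minimal_sublinear_below[OF sublinear_lower[OF p z]] by blast
  have gN: "g x \<le> N x" if "x \<in> S" for x
    using g(2)[of x] lower_le_self[OF p z, of x] that by (simp add: p_def)
  have minus: "g (- x) = - g x" if "x \<in> S" for x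
    using add[of x "- x"] that neg_in sublinear_zero[OF g(1)] by simp
  have "g (- z) \<le> - N z"
    using g(2)[of "- z"] lower_le[OF p, of "- z" z 1] z neg_in zero_in norm_eq_zero[of 0]
    by (simp add: p_def)
  then have gz: "g z = N z" using gN[OF z] minus[OF z] by simp
  have rscale: "g (scaleC (of_real t) x) = t * g x" if x: "x \<in> S" for t x
  proof (cases "0 \<le> t")
    case False
    have "g (scaleC (of_real t) x) = - g (scaleC (of_real (- t)) x)"
      using minus[OF scale_in[OF x], of "of_real (- t)"] by simp
    also have "\<dots> = t * g x" using False sublinear_scale[OF g(1) x, of "- t"] by simp
    finally show ?thesis .
  qed (simp add: sublinear_scale g x)
  define f where "f = (\<lambda>x. Complex (g x) (- g (scaleC \<i> x)))"
  have f_add: "f (x + y) = f x + f y" if "x \<in> S" "y \<in> S" for x y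
    using that scale_in by (simp add: f_def add scale_right_distrib complex_eq_iff)
  have f_scale: "f (scaleC c x) = c * f x" if x: "x \<in> S" for c x
  proof -
    have cx: "g (scaleC c x) = Re c * g x + Im c * g (scaleC \<i> x)" for c
    proof -
      have "scaleC c x = scaleC (of_real (Re c)) x + scaleC (of_real (Im c)) (scaleC \<i> x)"
        using complex_eq[of c] by (metis mult.commute scale_left_distrib scale_scale)
      then have "scaleC c x = scaleC (of_real (Re c)) x + scaleC (of_real (Im c)) (scaleC \<i> x)"
        by simp
      then show ?thesis using x scale_in by (simp add: add rscale del: scale_scale)
    qed
    show ?thesis
      using cx[of c] cx[of "\<i> * c"] by (simp add: f_def complex_eq_iff algebra_simps)
  qed
  have f_le: "norm (f x) \<le> N x" if x: "x \<in> S" for x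
  proof -
    define c where "c = cis (- Arg (f x))"
    have "of_real (norm (f x)) = c * f x"
      unfolding c_def using rcis_cmod_Arg[of "f x"] 
      by (metis (no_types, opaque_lifting) cis_mult cis_zero mult.commute mult.left_commute mult.right_neutral rcis_def add.right_inverse)
    also have "\<dots> = f (scaleC c x)" using f_scale x by simp
    finally have "norm (f x) = Re (f (scaleC c x))" by (metis Re_complex_of_real)
    also have "\<dots> = g (scaleC c x)" by (simp add: f_def)
    also have "\<dots> \<le> N (scaleC c x)" by (intro gN scale_in x)
    also have "\<dots> = N x" using x norm_scale by (simp add: c_def)
    finally show ?thesis .
  qed
  have "norm (f z) = N z"
  proof -
    have "Re (f z) = N z" using gz by (simp add: f_def)
    then show ?thesis using f_le[OF z] abs_Re_le_cmod[of "f z"] by linarith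
  qed
  moreover have "Re (f z) = N z" using gz by (simp add: f_def)
  ultimately have "f z = of_real (N z)"
    by (metis complex_Re_le_cmod complex_eq_iff cmod_eq_Re Re_complex_of_real Im_complex_of_real cmod_power2 add_cancel_right_right power2_eq_iff zero_eq_power2)
  then show ?thesis using that f_add f_scale f_le unfolding contraction_def by blast
qed

end

section \<open>Vector-valued holomorphic functions and the Mittag-Leffler star\<close>

context complex_normed_subspace begin

lemma contraction_add: "contraction f \<Longrightarrow> x \<in> S \<Longrightarrow> y \<in> S \<Longrightarrow> f (x + y) = f x + f y"
  and contraction_scale: "contraction f \<Longrightarrow> x \<in> S \<Longrightarrow> f (scaleC c x) = c * f x"
  and contraction_norm: "contraction f \<Longrightarrow> x \<in> S \<Longrightarrow> norm (f x) \<le> N x"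
  by (auto simp: contraction_def)

lemma contraction_diff: "contraction f \<Longrightarrow> x \<in> S \<Longrightarrow> y \<in> S \<Longrightarrow> f (x - y) = f x - f y"
  using contraction_add[of f "x - y" y] diff_in by simp

lemma contraction_zero: "contraction f \<Longrightarrow> f 0 = 0"
  using contraction_diff[of f 0 0] zero_in by simp

lemma contraction_sum:
  "contraction f \<Longrightarrow> (\<And>i. i \<in> I \<Longrightarrow> a i \<in> S) \<Longrightarrow> f (sum a I) = (\<Sum>i\<in>I. f (a i))"
  by (induction I rule: infinite_finite_induct)
    (auto simp: contraction_zero contraction_add subspace_sum[OF subspace_carrier])

lemma contraction_limitin:
  assumes f: "contraction f" and lim: "limitin (norm_topology S N) g l F"
  shows "((\<lambda>x. f (g x)) \<longlongrightarrow> f l) F"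
proof (rule tendstoI)
  fix e :: real assume "0 < e"
  then have l: "l \<in> S" and "\<forall>\<^sub>F x in F. g x \<in> S \<and> N (g x - l) < e"
    using lim by (auto simp: limitin_norm_topology)
  from this(2) show "\<forall>\<^sub>F x in F. dist (f (g x)) (f l) < e"
  proof eventually_elim
    case (elim x)
    then show ?case
      using contraction_norm[OF f diff_in[of "g x" l]] contraction_diff[OF f, of "g x" l] l
      by (simp add: dist_norm)
  qed
qed

lemma contraction_holomorphic:
  assumes f: "contraction f" and u: "vholomorphic_on scaleC S N u G"
  shows "(\<lambda>z. f (u z)) holomorphic_on G"
  unfolding holomorphic_on_def field_differentiable_def
proof
  fix z assume z: "z \<in> G"
  then obtain D where D: "limitin (norm_topology S N) (\<lambda>w. scaleC (inverse (w - z)) (u w - u z)) D (at z within G)"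
    using u by (auto simp: vholomorphic_on_def)
  have "((\<lambda>w. f (scaleC (inverse (w - z)) (u w - u z))) \<longlongrightarrow> f D) (at z within G)"
    by (rule contraction_limitin[OF f D])
  moreover have "\<forall>\<^sub>F w in at z within G. f (scaleC (inverse (w - z)) (u w - u z)) = (f (u w) - f (u z)) / (w - z)"
    unfolding eventually_at_filter
    using z u f by (auto simp: vholomorphic_on_def contraction_scale contraction_diff diff_in divide_inverse mult.commute)
  ultimately have "((\<lambda>w. (f (u w) - f (u z)) / (w - z)) \<longlongrightarrow> f D) (at z within G)"
    using tendsto_cong by fastforce
  then show "\<exists>f'. ((\<lambda>z. f (u z)) has_field_derivative f') (at z within G)"
    unfolding has_field_derivative_iff by blast
qed

lemma vholomorphic_on_subset:
  assumes "vholomorphic_on scaleC S N u G" "H \<subseteq> G"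
  shows "vholomorphic_on scaleC S N u H"
  using assms unfolding vholomorphic_on_def limitin_norm_topology
  by (meson at_le filter_leD subsetD)

text \<open>A functional that norms \<open>u x - v x\<close> turns this into the identity theorem for scalar functions.\<close>

lemma vholomorphic_identity:
  assumes u: "vholomorphic_on scaleC S N u G" and v: "vholomorphic_on scaleC S N v H"
    and conv: "open G" "convex G" "open H" "convex H" and p: "p \<in> G \<inter> H"
    and eq: "\<forall>\<^sub>F w in nhds p. u w = v w" and x: "x \<in> G \<inter> H"
  shows "u x = v x"
proof -
  have uS: "u x \<in> S" and vS: "v x \<in> S" if "x \<in> G \<inter> H" for x
    using u v that by (auto simp: vholomorphic_on_def)
  obtain f where f: "contraction f" "f (u x - v x) = of_real (N (u x - v x))"
    using hahn_banach_norming[of "u x - v x"] uS vS x diff_in by blast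
  obtain U where U: "open U" "p \<in> U" "\<And>w. w \<in> U \<Longrightarrow> u w = v w"
    using eq by (auto simp: eventually_nhds)
  have "f (u x) = f (v x)"
  proof (rule analytic_continuation_open[where f = "\<lambda>z. f (u z)" and g = "\<lambda>z. f (v z)"
        and s = "U \<inter> (G \<inter> H)" and s' = "G \<inter> H"])
    show "(\<lambda>z. f (u z)) holomorphic_on G \<inter> H" "(\<lambda>z. f (v z)) holomorphic_on G \<inter> H"
      using contraction_holomorphic f(1) u v vholomorphic_on_subset by (metis Int_lower1, metis Int_lower2)
  qed (use U p x conv in \<open>auto intro!: convex_connected convex_Int\<close>)
  then have "N (u x - v x) = 0" using f uS[OF x] vS[OF x] by (simp add: contraction_diff)
  then show ?thesis using norm_eq_zero[OF diff_in[OF uS[OF x] vS[OF x]]] by simp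
qed

lemma star_radial:
  assumes z: "z \<in> mittag_leffler_star scaleC S N u" and t: "0 \<le> t" "t \<le> 1"
  shows "of_real t * z \<in> mittag_leffler_star scaleC S N u"
proof -
  from z have "continuable_along scaleC S N u (linepath 0 z)"
    by (simp add: mittag_leffler_star_def)
  then obtain F r where
    "\<forall>s\<in>{0..1}. r s > 0 \<and> vholomorphic_on scaleC S N (F s) (ball (linepath 0 z s) (r s))"
    and init: "\<forall>\<^sub>F w in nhds (linepath 0 z 0). F 0 w = u w"
    and "\<forall>s\<in>{0..1}. \<exists>e>0. \<forall>s'\<in>{0..1}. \<bar>s' - s\<bar> < e \<longrightarrow>
        linepath 0 z s' \<in> ball (linepath 0 z s) (r s) \<and> (\<forall>\<^sub>F w in nhds (linepath 0 z s'). F s' w = F s w)"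
    unfolding continuable_along_def by (elim exE conjE) (rule that)
  note hol = bspec[OF this(1)] and coh = bspec[OF this(3)]
  have lp: "linepath 0 (of_real t * z) s = linepath 0 z (t * s)" for s
    by (simp add: linepath_def scaleR_conv_of_real)
  have ts: "t * s \<in> {0..1}" if "s \<in> {0..1}" for s using t that by (auto simp: mult_le_one)
  have "continuable_along scaleC S N u (linepath 0 (of_real t * z))"
    unfolding continuable_along_def
  proof (intro exI[of _ "\<lambda>s. F (t * s)"] exI[of _ "\<lambda>s. r (t * s)"] conjI ballI)
    fix s :: real assume s: "s \<in> {0..1}"
    show "0 < r (t * s)" "vholomorphic_on scaleC S N (F (t * s)) (ball (linepath 0 (of_real t * z) s) (r (t * s)))"
      unfolding lp using hol[OF ts[OF s]] by blast+
    obtain e where e: "e > 0" "\<And>s'. s'\<in>{0..1} \<Longrightarrow> \<bar>s' - t * s\<bar> < e \<Longrightarrow>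
        linepath 0 z s' \<in> ball (linepath 0 z (t * s)) (r (t * s)) \<and> (\<forall>\<^sub>F w in nhds (linepath 0 z s'). F s' w = F (t * s) w)"
      using coh[OF ts[OF s]] by blast
    have small: "\<bar>t * s' - t * s\<bar> < e" if "\<bar>s' - s\<bar> < e" for s'
    proof -
      have "\<bar>t * s' - t * s\<bar> = t * \<bar>s' - s\<bar>" using t by (simp add: abs_mult right_diff_distrib[symmetric])
      also have "\<dots> \<le> 1 * \<bar>s' - s\<bar>" using t by (intro mult_right_mono) auto
      finally show ?thesis using that by simp
    qed
    show "\<exists>e>0. \<forall>s'\<in>{0..1}. \<bar>s' - s\<bar> < e \<longrightarrow> linepath 0 (of_real t * z) s' \<in> ball (linepath 0 (of_real t * z) s) (r (t * s)) \<and>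
        (\<forall>\<^sub>F w in nhds (linepath 0 (of_real t * z) s'). F (t * s') w = F (t * s) w)"
      unfolding lp using e ts small by blast
  next
    show "\<forall>\<^sub>F w in nhds (linepath 0 (of_real t * z) 0). F (t * 0) w = u w" using init by (simp add: lp)
  qed
  then show ?thesis by (simp add: mittag_leffler_star_def)
qed

text \<open>By compactness, finitely many of the function elements along \<open>[0, z]\<close> cover a neighbourhood of
  that segment, and they serve as function elements along \<open>[0, z']\<close> for \<open>z'\<close> near \<open>z\<close>. Two of them
  that are used for neighbouring parameters both have the germ of a third element at a common point
  of \<open>[0, z]\<close>, so they agree on the intersection of their discs by the identity theorem.\<close>

lemma open_star: "open (mittag_leffler_star scaleC S N u)"
proof (rule openI)
  fix z assume "z \<in> mittag_leffler_star scaleC S N u"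
  then have "continuable_along scaleC S N u (linepath 0 z)"
    by (simp add: mittag_leffler_star_def)
  then obtain F r where
    "\<forall>s\<in>{0..1}. r s > 0 \<and> vholomorphic_on scaleC S N (F s) (ball (linepath 0 z s) (r s))"
    and init: "\<forall>\<^sub>F w in nhds (linepath 0 z 0). F 0 w = u w"
    and "\<forall>s\<in>{0..1}. \<exists>e>0. \<forall>s'\<in>{0..1}. \<bar>s' - s\<bar> < e \<longrightarrow>
        linepath 0 z s' \<in> ball (linepath 0 z s) (r s) \<and> (\<forall>\<^sub>F w in nhds (linepath 0 z s'). F s' w = F s w)"
    unfolding continuable_along_def by (elim exE conjE) (rule that)
  note hol = bspec[OF this(1)] and coh = bspec[OF this(3)]
  have lp: "linepath 0 w s = of_real s * w" for w :: complex and s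
    by (simp add: linepath_def scaleR_conv_of_real)
  have "\<forall>s\<in>{0..1}. \<exists>e. e > 0 \<and> (\<forall>s'\<in>{0..1}. \<bar>s' - s\<bar> < e \<longrightarrow>
      of_real s' * z \<in> ball (of_real s * z) (r s) \<and> (\<forall>\<^sub>F w in nhds (of_real s' * z). F s' w = F s w))"
    using coh unfolding lp by (intro ballI)
  from bchoice[OF this] obtain e where e0: "\<forall>s\<in>{0..1}. e s > 0 \<and> (\<forall>s'\<in>{0..1}. \<bar>s' - s\<bar> < e s \<longrightarrow>
      of_real s' * z \<in> ball (of_real s * z) (r s) \<and> (\<forall>\<^sub>F w in nhds (of_real s' * z). F s' w = F s w))"
    by (elim exE)
  have e: "\<And>s. s\<in>{0..1} \<Longrightarrow> e s > 0"
    "\<And>s s'. s\<in>{0..1} \<Longrightarrow> s'\<in>{0..1} \<Longrightarrow> \<bar>s' - s\<bar> < e s \<Longrightarrow> of_real s' * z \<in> ball (of_real s * z) (r s)"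
    "\<And>s s'. s\<in>{0..1} \<Longrightarrow> s'\<in>{0..1} \<Longrightarrow> \<bar>s' - s\<bar> < e s \<Longrightarrow> (\<forall>\<^sub>F w in nhds (of_real s' * z). F s' w = F s w)"
    using e0 by blast+
  \<comment> \<open>\<open>d s\<close> keeps the centre \<open>s' z\<close> within half the radius at \<open>s\<close>, so that a perturbation of \<open>z\<close> still fits.\<close>
  define d where "d s = min (e s / 2) (r s / (2 * (norm z + 1)))" for s
  have d: "d s > 0" "d s \<le> e s / 2" "\<bar>s' - s\<bar> < d s \<Longrightarrow> dist (of_real s * z) (of_real s' * z) < r s / 2"
    if s: "s \<in> {0..1}" for s s'
  proof -
    have nz: "norm z + 1 > 0" using norm_ge_zero[of z] by linarith
    show "d s > 0" using e(1) hol s nz by (simp add: d_def)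
    show "d s \<le> e s / 2" unfolding d_def by (rule min.cobounded1)
    assume "\<bar>s' - s\<bar> < d s"
    then have "\<bar>s' - s\<bar> < r s / (2 * (norm z + 1))" by (simp add: d_def)
    then have "\<bar>s' - s\<bar> * (norm z + 1) < r s / 2" using nz by (simp add: field_simps)
    moreover have "dist (of_real s * z) (of_real s' * z) = \<bar>s' - s\<bar> * norm z"
      by (simp add: dist_norm left_diff_distrib[symmetric] norm_mult abs_minus_commute flip: of_real_diff)
    moreover have "\<bar>s' - s\<bar> * norm z \<le> \<bar>s' - s\<bar> * (norm z + 1)" by (intro mult_left_mono) auto
    ultimately show "dist (of_real s * z) (of_real s' * z) < r s / 2" by linarith
  qed
  have "{0..1} \<subseteq> (\<Union>s\<in>{0..1::real}. ball s (d s))"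
    using d(1) by (force intro: bexI)
  then obtain I where I: "I \<subseteq> {0..1}" "finite I" "{0..1::real} \<subseteq> (\<Union>s\<in>I. ball s (d s))"
    using compactE_image[OF compact_Icc[of "0::real" 1], of "{0..1}" "\<lambda>s. ball s (d s)"] by auto
  define \<rho> where "\<rho> = Min (r ` I) / 2"
  define \<epsilon> where "\<epsilon> = Min (d ` I)"
  have Ine: "I \<noteq> {}" using I(3) by force
  have \<rho>: "\<rho> > 0" "\<And>s. s \<in> I \<Longrightarrow> \<rho> \<le> r s / 2"
    using I(1,2) Ine hol unfolding \<rho>_def by (subst zero_less_divide_iff, auto simp: subset_iff)
  have \<epsilon>: "\<epsilon> > 0" "\<And>s. s \<in> I \<Longrightarrow> \<epsilon> \<le> d s"
    using I(1,2) Ine d(1) unfolding \<epsilon>_def by (auto simp: subset_iff)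
  obtain k where k: "\<And>s. s \<in> {0..1} \<Longrightarrow> k s \<in> I \<and> \<bar>s - k s\<bar> < d (k s)"
  proof -
    have "\<forall>s\<in>{0..1}. \<exists>i\<in>I. \<bar>s - i\<bar> < d i"
      using I(3) by (force simp: dist_real_def abs_minus_commute)
    then show ?thesis using that by metis
  qed
  have kI: "k s \<in> {0..1}" if "s \<in> {0..1}" for s using k[OF that] I(1) by auto
  have "z' \<in> mittag_leffler_star scaleC S N u" if z': "z' \<in> ball z (\<rho> / 2)" for z'
  proof -
    have near: "dist (of_real s * z) (of_real s * z') < \<rho> / 2" if "s \<in> {0..1}" for s
    proof -
      have "dist (of_real s * z) (of_real s * z') = s * dist z z'"
        using that by (simp add: dist_norm right_diff_distrib[symmetric] norm_mult)
      also have "\<dots> \<le> 1 * dist z z'" using that by (intro mult_right_mono) auto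
      finally show ?thesis using z' by simp
    qed
    have sub: "ball (of_real s * z') (\<rho> / 2) \<subseteq> ball (of_real (k s) * z) (r (k s))" if s: "s \<in> {0..1}" for s
    proof
      fix w assume "w \<in> ball (of_real s * z') (\<rho> / 2)"
      then have "dist (of_real s * z') w < \<rho> / 2" by simp
      moreover have "dist (of_real (k s) * z) (of_real s * z) < r (k s) / 2"
        using d(3)[OF kI[OF s], of s] k[OF s] by auto
      moreover have "\<rho> \<le> r (k s) / 2" using \<rho>(2) k[OF s] by auto
      moreover have "dist (of_real (k s) * z) w
          \<le> dist (of_real (k s) * z) (of_real s * z) + dist (of_real s * z) (of_real s * z') + dist (of_real s * z') w"
        by metric
      ultimately show "w \<in> ball (of_real (k s) * z) (r (k s))" using near[OF s] by simp
    qed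
    have "continuable_along scaleC S N u (linepath 0 z')"
      unfolding continuable_along_def lp
    proof (intro exI[of _ "\<lambda>s. F (k s)"] exI[of _ "\<lambda>_. \<rho> / 2"] conjI ballI)
      fix s :: real assume s: "s \<in> {0..1}"
      show "0 < \<rho> / 2" using \<rho> by simp
      show "vholomorphic_on scaleC S N (F (k s)) (ball (of_real s * z') (\<rho> / 2))"
        using hol[OF kI[OF s]] sub[OF s] unfolding lp by (blast intro: vholomorphic_on_subset)
      define \<eta> where "\<eta> = min \<epsilon> (\<rho> / (2 * (norm z' + 1)))"
      have nz: "norm z' + 1 > 0" using norm_ge_zero[of z'] by linarith
      have "of_real s' * z' \<in> ball (of_real s * z') (\<rho> / 2) \<and> (\<forall>\<^sub>F w in nhds (of_real s' * z'). F (k s') w = F (k s) w)"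
        if s': "s' \<in> {0..1}" and close: "\<bar>s' - s\<bar> < \<eta>" for s'
      proof
        have "\<bar>s' - s\<bar> < \<rho> / (2 * (norm z' + 1))" using close by (simp add: \<eta>_def)
        then have "\<bar>s' - s\<bar> * (norm z' + 1) < \<rho> / 2" using nz by (simp add: field_simps)
        moreover have "dist (of_real s * z') (of_real s' * z') = \<bar>s' - s\<bar> * norm z'"
          by (simp add: dist_norm left_diff_distrib[symmetric] norm_mult abs_minus_commute flip: of_real_diff)
        moreover have "\<bar>s' - s\<bar> * norm z' \<le> \<bar>s' - s\<bar> * (norm z' + 1)" by (intro mult_left_mono) auto
        ultimately show in_ball: "of_real s' * z' \<in> ball (of_real s * z') (\<rho> / 2)" by simp
        have c1: "\<bar>s' - k s\<bar> < e (k s)"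
          using close k[OF s] \<epsilon>(2)[of "k s"] d(2)[OF kI[OF s]] by (auto simp: \<eta>_def)
        have c2: "\<bar>s' - k s'\<bar> < e (k s')"
          using k[OF s'] d(2)[OF kI[OF s']] e(1)[OF kI[OF s']] by auto
        have "\<forall>\<^sub>F w in nhds (of_real s' * z). F (k s') w = F (k s) w"
          using e(3)[OF kI[OF s] s' c1] e(3)[OF kI[OF s'] s' c2] by eventually_elim simp
        then have eq: "F (k s') w = F (k s) w"
          if "w \<in> ball (of_real (k s') * z) (r (k s')) \<inter> ball (of_real (k s) * z) (r (k s))" for w
          using hol[OF kI[OF s']] hol[OF kI[OF s]] e(2)[OF kI[OF s] s' c1] e(2)[OF kI[OF s'] s' c2] that
          unfolding lp by (intro vholomorphic_identity[where p = "of_real s' * z"]) auto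
        have "of_real s' * z' \<in> ball (of_real (k s') * z) (r (k s')) \<inter> ball (of_real (k s) * z) (r (k s))"
          using subsetD[OF sub[OF s] in_ball] subsetD[OF sub[OF s'], of "of_real s' * z'"] \<rho>(1) by simp
        then show "\<forall>\<^sub>F w in nhds (of_real s' * z'). F (k s') w = F (k s) w"
          using eq unfolding eventually_nhds by (intro exI[of _ "ball (of_real (k s') * z) (r (k s')) \<inter> ball (of_real (k s) * z) (r (k s))"]) auto
      qed
      moreover have "\<eta> > 0" using \<epsilon>(1) \<rho>(1) nz by (simp add: \<eta>_def)
      ultimately show "\<exists>e>0. \<forall>s'\<in>{0..1}. \<bar>s' - s\<bar> < e \<longrightarrow> of_real s' * z' \<in> ball (of_real s * z') (\<rho> / 2) \<and>
          (\<forall>\<^sub>F w in nhds (of_real s' * z'). F (k s') w = F (k s) w)" by blast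
    next
      have "\<bar>0 - k 0\<bar> < e (k 0)"
        using k[of 0] d(2)[OF kI[of 0]] e(1)[OF kI[of 0]] by auto
      then have "\<forall>\<^sub>F w in nhds (of_real 0 * z). F 0 w = F (k 0) w" using e(3)[OF kI[of 0], of 0] by auto
      with init show "\<forall>\<^sub>F w in nhds (of_real 0 * z'). F (k 0) w = u w"
        unfolding lp by simp (auto elim: eventually_elim2)
    qed
    then show ?thesis by (simp add: mittag_leffler_star_def)
  qed
  then show "\<exists>e>0. ball z e \<subseteq> mittag_leffler_star scaleC S N u"
    using \<rho>(1) by (intro exI[of _ "\<rho> / 2"]) auto
qed

end

section \<open>Bounds for the reciprocal Gamma function\<close>

text \<open>Gauss's product for \<open>1/\<Gamma>\<close>, compared factor by factor: enlarging the real part of a factor lowers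
  the relative effect of the imaginary part \<open>y\<close>.\<close>

lemma norm_rGamma_le_real_part:
  fixes x y :: real
  assumes "0 \<le> x"
  shows "norm (rGamma (1 + Complex x y)) \<le> rGamma (1 + x) * norm (rGamma (1 + Complex 0 y))"
proof (rule LIMSEQ_le)
  show "(\<lambda>n. norm (rGamma_series (1 + Complex x y) n)) \<longlonglongrightarrow> norm (rGamma (1 + Complex x y))"
    by (intro tendsto_intros)
  show "(\<lambda>n. rGamma_series (1 + x) n * norm (rGamma_series (1 + Complex 0 y) n))
      \<longlonglongrightarrow> rGamma (1 + x) * norm (rGamma (1 + Complex 0 y))"
    by (intro tendsto_intros)
  have factor: "norm (1 + Complex x y + of_nat k) * real (Suc k)
      \<le> (1 + x + real k) * norm (1 + Complex 0 y + of_nat k)" for k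
  proof -
    have "(norm (1 + Complex x y + of_nat k) * real (Suc k))\<^sup>2
        = ((1 + x + real k)\<^sup>2 + y\<^sup>2) * (real (Suc k))\<^sup>2"
      by (simp add: power_mult_distrib cmod_power2)
    also have "\<dots> \<le> (1 + x + real k)\<^sup>2 * ((real (Suc k))\<^sup>2 + y\<^sup>2)"
    proof -
      have "(real (Suc k))\<^sup>2 \<le> (1 + x + real k)\<^sup>2"
        using assms by (intro power_mono) auto
      then have "y\<^sup>2 * (real (Suc k))\<^sup>2 \<le> y\<^sup>2 * (1 + x + real k)\<^sup>2"
        by (intro mult_left_mono) auto
      then show ?thesis by (simp add: algebra_simps)
    qed
    also have "\<dots> = ((1 + x + real k) * norm (1 + Complex 0 y + of_nat k))\<^sup>2"
      by (simp add: power_mult_distrib cmod_power2)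
    finally show ?thesis
      using assms by (intro power2_le_imp_le[of "norm (1 + Complex x y + of_nat k) * real (Suc k)"]) auto
  qed
  have "norm (rGamma_series (1 + Complex x y) n)
      \<le> rGamma_series (1 + x) n * norm (rGamma_series (1 + Complex 0 y) n)" if n: "n \<ge> 1" for n
  proof -
    have prods: "(\<Prod>k\<le>n. norm (1 + Complex x y + of_nat k)) * (\<Prod>k\<le>n. real (Suc k))
        \<le> (\<Prod>k\<le>n. 1 + x + real k) * (\<Prod>k\<le>n. norm (1 + Complex 0 y + of_nat k))"
      unfolding prod.distrib[symmetric] by (intro prod_mono) (use factor in auto)
    have fct: "(\<Prod>k\<le>n. real (Suc k)) = real (Suc n) * fact n"
      by (induction n) (auto simp: algebra_simps)
    have ex: "norm (exp ((1 + Complex x y) * of_real (ln (real n)))) = real n * exp (x * ln n)"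
       "norm (exp ((1 + Complex 0 y) * of_real (ln (real n)))) = real n"
       "exp ((1 + x) * ln (real n)) = real n * exp (x * ln n)"
      using n by (simp_all add: ring_distribs exp_add norm_mult norm_exp_eq_Re)
    have "norm (rGamma_series (1 + Complex x y) n)
       = (\<Prod>k\<le>n. norm (1 + Complex x y + of_nat k)) / (fact n * (real n * exp (x * ln n)))"
      unfolding rGamma_series_def norm_divide norm_mult ex
      by (simp add: pochhammer_prod atLeast0LessThan lessThan_Suc_atMost prod_norm)
    also have "\<dots> \<le> ((\<Prod>k\<le>n. 1 + x + real k) * (\<Prod>k\<le>n. norm (1 + Complex 0 y + of_nat k)) / (real (Suc n) * fact n))
        / (fact n * (real n * exp (x * ln n)))"
      using prods unfolding fct
      by (intro divide_right_mono) (subst pos_le_divide_eq, auto)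
    also have "\<dots> = rGamma_series (1 + x) n * norm (rGamma_series (1 + Complex 0 y) n) * (real n / real (Suc n))"
    proof -
      have "rGamma_series (1 + x) n = (\<Prod>k\<le>n. 1 + x + real k) / (fact n * (real n * exp (x * ln n)))"
        by (simp add: rGamma_series_def ex(3) pochhammer_prod atLeast0LessThan lessThan_Suc_atMost)
      moreover have "norm (rGamma_series (1 + Complex 0 y) n)
          = (\<Prod>k\<le>n. norm (1 + Complex 0 y + of_nat k)) / (fact n * real n)"
        unfolding rGamma_series_def norm_divide norm_mult using ex(2)
        by (simp add: pochhammer_prod atLeast0LessThan lessThan_Suc_atMost prod_norm norm_mult)
      moreover have "P * Q / (s * F) / (F * (m * E)) = P / (F * (m * E)) * (Q / (F * m)) * (m / s)"
        if "m \<noteq> 0" for P Q s F m E :: real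
        using that by (simp add: mult_ac)
      ultimately show ?thesis using n by simp
    qed
    also have "\<dots> \<le> rGamma_series (1 + x) n * norm (rGamma_series (1 + Complex 0 y) n) * 1"
      using assms by (intro mult_left_mono mult_nonneg_nonneg)
        (auto simp: rGamma_series_def pochhammer_prod intro!: prod_nonneg divide_nonneg_nonneg mult_nonneg_nonneg)
    finally show ?thesis by simp
  qed
  then show "\<exists>N. \<forall>n\<ge>N. norm (rGamma_series (1 + Complex x y) n)
      \<le> rGamma_series (1 + x) n * norm (rGamma_series (1 + Complex 0 y) n)" by blast
qed

text \<open>By the reflection formula the square of the left-hand side is \<open>sinh (\<pi>y) / (\<pi>y)\<close>.\<close>

lemma norm_rGamma_vertical:
  "norm (rGamma (1 + Complex 0 y)) \<le> exp (pi / 2 * \<bar>y\<bar>)"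
proof (cases "y = 0")
  case False
  define w where "w = Complex 0 y"
  have w: "w = \<i> * of_real y" "w \<noteq> 0" "cnj w = - w" using False by (auto simp: w_def complex_eq_iff)
  have "rGamma (1 + w) * rGamma (1 - w) = sin (of_real pi * w) / (of_real pi * w)"
    using rGamma_reflection_complex[of w] rGamma_plus1[of w, symmetric] w(2)
    by (simp add: divide_simps add.commute mult_ac)
  moreover have "norm (rGamma (1 - w)) = norm (rGamma (1 + w))"
    using cnj_rGamma[of "1 + w"] w(3) by (metis complex_cnj_add complex_cnj_one complex_mod_cnj uminus_add_conv_diff add.commute)
  ultimately have "(norm (rGamma (1 + w)))\<^sup>2 = norm (sin (of_real pi * w) / (of_real pi * w))"
    by (metis norm_mult power2_eq_square)
  also have "\<dots> \<le> exp (pi * \<bar>y\<bar>)"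
  proof -
    have "norm (sin (of_real pi * w)) = \<bar>sinh (pi * y)\<bar>"
    proof -
      have iw: "\<i> * (of_real pi * w) = of_real (- (pi * y))" by (simp add: w(1) complex_eq_iff)
      have "sin (of_real pi * w) = (of_real (exp (- (pi * y))) - of_real (exp (pi * y))) / (2 * \<i>)"
        unfolding sin_exp_eq iw exp_of_real[symmetric] by simp
      also have "\<dots> = of_real (sinh (pi * y)) * \<i>"
        by (simp add: sinh_def field_simps)
      finally show ?thesis by (simp add: norm_mult)
    qed
    also have "\<dots> = sinh \<bar>pi * y\<bar>" by (simp add: abs_if)
    also have "\<dots> \<le> \<bar>pi * y\<bar> * exp \<bar>pi * y\<bar>"
    proof -
      have "1 - 2 * \<bar>pi * y\<bar> \<le> exp (- (2 * \<bar>pi * y\<bar>))" using exp_ge_add_one_self[of "- (2 * \<bar>pi * y\<bar>)"] by simp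
      then have "exp \<bar>pi*y\<bar> * (1 - 2 * \<bar>pi * y\<bar>) \<le> exp \<bar>pi*y\<bar> * exp (- (2 * \<bar>pi * y\<bar>))" by (intro mult_left_mono) auto
      also have "\<dots> = exp (- \<bar>pi * y\<bar>)" by (simp add: exp_add[symmetric])
      finally show ?thesis by (simp add: sinh_def algebra_simps)
    qed
    finally show ?thesis using False by (simp add: norm_divide norm_mult w(1) abs_mult field_simps)
  qed
  also have "\<dots> = (exp (pi / 2 * \<bar>y\<bar>))\<^sup>2" by (simp add: power2_eq_square exp_add[symmetric])
  finally show ?thesis unfolding w_def by (rule power2_le_imp_le) simp
qed (simp flip: zero_complex.code)

text \<open>Euler's integral restricted to \<open>[M, M + 1]\<close>. Since \<open>M\<close> is free, \<open>\<Gamma>\<close> beats every exponential.\<close>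

lemma power_le_Gamma:
  fixes x M :: real
  assumes "0 \<le> x" "1 \<le> M"
  shows "M powr x * exp (- (M + 1)) \<le> Gamma (x + 1)"
proof -
  have G: "((\<lambda>t. t powr (x + 1 - 1) / exp t) has_integral Gamma (x + 1)) {0..}"
    using assms by (intro Gamma_integral_real) auto
  have c: "((\<lambda>t. M powr x * exp (- (M + 1))) has_integral (M powr x * exp (- (M + 1)))) {M..M+1}"
    using has_integral_const_real[of "M powr x * exp (- (M + 1))" M "M+1"] by simp
  show ?thesis
  proof (rule has_integral_le)
    show "((\<lambda>t. if t \<in> {M..M+1} then M powr x * exp (- (M + 1)) else 0) has_integral M powr x * exp (- (M + 1))) {0..}"
      using c assms by (subst has_integral_restrict) auto
    show "((\<lambda>t. t powr x / exp t) has_integral Gamma (x + 1)) {0..}" using G by simp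
    fix t :: real assume t: "t \<in> {0..}"
    show "(if t \<in> {M..M+1} then M powr x * exp (- (M + 1)) else 0) \<le> t powr x / exp t"
    proof (cases "t \<in> {M..M+1}")
      case True
      have "M powr x * exp (- (M + 1)) \<le> t powr x * exp (-t)"
        using True assms by (intro mult_mono powr_mono2) auto
      then show ?thesis using True by (simp add: exp_minus field_simps)
    qed auto
  qed
qed

section \<open>Lindelof's integral\<close>

lemma norm_sin_pi_ge:
  assumes "cos (2 * pi * x) = -1 \<or> 1 \<le> \<bar>y\<bar>"
  shows "exp (pi * \<bar>y\<bar>) / 4 \<le> norm (sin (of_real pi * Complex x y))"
proof -
  define E where "E = exp (2 * (pi * \<bar>y\<bar>))"
  have E: "exp (2 * (pi * y)) + inverse (exp (2 * (pi * y))) = E + inverse E"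
    by (auto simp: E_def abs_if exp_minus)
  have n: "(norm (sin (of_real pi * Complex x y)))\<^sup>2 = (E + inverse E - 2 * cos (2 * (pi * x))) / 4"
    by (simp add: norm_sin_squared E)
  have "E / 16 \<le> (E + inverse E - 2 * cos (2 * (pi * x))) / 4"
    using assms
  proof
    assume "1 \<le> \<bar>y\<bar>"
    then have "2 * pi * 1 \<le> 2 * (pi * \<bar>y\<bar>)" by simp
    then have "1 + 6 \<le> E"
      unfolding E_def using exp_ge_add_one_self[of "2 * (pi * \<bar>y\<bar>)"] pi_gt3 by linarith
    moreover have "inverse E > 0" by (simp add: E_def)
    moreover have "E / 16 \<le> (E + i - 2 * c) / 4" if "1 + 6 \<le> E" "0 < i" "c \<le> 1" for i c
      using that by (simp add: field_simps)
    ultimately show ?thesis using cos_le_one by blast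
  next
    assume "cos (2 * pi * x) = -1"
    moreover have "inverse E > 0" "E > 0" by (simp_all add: E_def)
    ultimately show ?thesis by (simp add: mult.assoc)
  qed
  then have "(exp (pi * \<bar>y\<bar>) / 4)\<^sup>2 \<le> (norm (sin (of_real pi * Complex x y)))\<^sup>2"
    unfolding n by (simp add: E_def power2_eq_square flip: exp_add)
  then show ?thesis by (rule power2_le_imp_le) simp
qed

text \<open>The majorant \<open>K / (1 + y\<^sup>2)\<close> has the primitive \<open>K arctan y\<close>, which gives a bound independent of
  the height \<open>R\<close>.\<close>

lemma norm_vertical_integral_le:
  fixes F :: "complex \<Rightarrow> complex"
  assumes cont: "continuous_on (closed_segment (Complex a (- R)) (Complex a R)) F"
    and R: "0 \<le> R"
    and bound: "\<And>y. \<bar>y\<bar> \<le> R \<Longrightarrow> norm (F (Complex a y)) \<le> K / (1 + y\<^sup>2)"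
  shows "norm (contour_integral (linepath (Complex a (- R)) (Complex a R)) F) \<le> K * pi"
proof -
  define y where "y t = R * (2 * t - 1)" for t :: real
  have line: "linepath (Complex a (- R)) (Complex a R) t = Complex a (y t)" for t
    by (simp add: linepath_def y_def complex_eq_iff algebra_simps)
  have diff: "Complex a R - Complex a (- R) = Complex 0 (2 * R)"
    by (simp add: complex_eq_iff)
  have "F contour_integrable_on linepath (Complex a (- R)) (Complex a R)"
    by (intro contour_integrable_continuous_linepath cont)
  then have "(F has_contour_integral contour_integral (linepath (Complex a (- R)) (Complex a R)) F)
      (linepath (Complex a (- R)) (Complex a R))"
    by (rule has_contour_integral_integral)
  then have hi: "((\<lambda>t. F (Complex a (y t)) * Complex 0 (2 * R)) has_integral
      contour_integral (linepath (Complex a (- R)) (Complex a R)) F) {0..1}"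
    unfolding has_contour_integral_linepath line diff .
  have "((\<lambda>t. K * (2 * R / (1 + (y t)\<^sup>2))) has_integral K * (arctan (y 1) - arctan (y 0))) {0..1}"
  proof (intro has_integral_mult_right fundamental_theorem_of_calculus)
    fix t :: real
    show "((\<lambda>t. arctan (y t)) has_vector_derivative 2 * R / (1 + (y t)\<^sup>2)) (at t within {0..1})"
      unfolding y_def has_real_derivative_iff_has_vector_derivative[symmetric]
      by (auto intro!: derivative_eq_intros simp: divide_inverse)
  qed auto
  moreover have "norm (F (Complex a (y t)) * Complex 0 (2 * R)) \<le> K * (2 * R / (1 + (y t)\<^sup>2))"
    if "t \<in> {0..1}" for t
  proof -
    have "\<bar>2 * t - 1\<bar> \<le> 1" using that by auto
    then have "\<bar>y t\<bar> \<le> R" using R mult_left_mono[of "\<bar>2 * t - 1\<bar>" 1 R] by (simp add: y_def abs_mult)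
    then have "norm (F (Complex a (y t))) * (2 * R) \<le> K / (1 + (y t)\<^sup>2) * (2 * R)"
      using R by (intro mult_right_mono bound) auto
    moreover have "norm (Complex 0 (2 * R)) = 2 * R" using R by (simp add: cmod_def real_sqrt_mult)
    ultimately show ?thesis by (simp add: norm_mult)
  qed
  ultimately have "norm (contour_integral (linepath (Complex a (- R)) (Complex a R)) F)
      \<le> K * (arctan (y 1) - arctan (y 0))"
    using hi by (metis (no_types, lifting) has_integral_integrable integral_norm_bound_integral integral_unique)
  also have "\<dots> \<le> K * pi"
  proof (rule mult_left_mono)
    show "arctan (y 1) - arctan (y 0) \<le> pi"
      using arctan_bounded[of R] by (simp add: y_def arctan_minus)
    have "norm (F (Complex a 0)) \<le> K" using bound[of 0] R by simp
    then show "0 \<le> K" using norm_ge_zero order_trans by blast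
  qed
  finally show ?thesis .
qed

text \<open>The holomorphic function that interpolates the coefficients \<open>(\<delta>n + 1) / \<Gamma>(\<eta>n + 1)\<close>, where
  \<open>\<delta> = 1 + \<eta>\<close>.\<close>

definition coeff_fun :: "real \<Rightarrow> complex \<Rightarrow> complex" where
  "coeff_fun \<eta> s = (of_real (1 + \<eta>) * s + 1) * rGamma (1 + of_real \<eta> * s)"

lemma norm_coeff_fun_le:
  assumes "0 \<le> x" "0 < \<eta>" "\<eta> \<le> 1"
  shows "norm (coeff_fun \<eta> (Complex x y)) \<le>
     2 * (1 + x) * (1 + \<bar>y\<bar>) * rGamma (1 + \<eta> * x) * exp (pi / 2 * (\<eta> * \<bar>y\<bar>))"
proof -
  have "norm (of_real (1 + \<eta>) * Complex x y + 1) \<le> norm (of_real (1 + \<eta>) * Complex x y) + norm (1::complex)"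
    by (rule norm_triangle_ineq)
  also have "\<dots> = (1 + \<eta>) * norm (Complex x y) + 1"
    unfolding norm_mult norm_of_real using assms by simp
  also have "\<dots> \<le> 2 * (x + \<bar>y\<bar>) + 1"
    using assms cmod_le[of "Complex x y"] by (intro add_mono mult_mono) auto
  also have "\<dots> \<le> 2 * (1 + x) * (1 + \<bar>y\<bar>)" using assms by (simp add: algebra_simps)
  finally have 1: "norm (of_real (1 + \<eta>) * Complex x y + 1) \<le> 2 * (1 + x) * (1 + \<bar>y\<bar>)" .
  have "of_real \<eta> * Complex x y = Complex (\<eta> * x) (\<eta> * y)" by (simp add: complex_eq_iff)
  then have "norm (rGamma (1 + of_real \<eta> * Complex x y)) \<le> rGamma (1 + \<eta> * x) * norm (rGamma (1 + Complex 0 (\<eta> * y)))"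
    using norm_rGamma_le_real_part[of "\<eta> * x" "\<eta> * y"] assms by simp
  also have "\<dots> \<le> rGamma (1 + \<eta> * x) * exp (pi / 2 * \<bar>\<eta> * y\<bar>)"
    using assms by (intro mult_left_mono norm_rGamma_vertical) (auto simp: rGamma_inverse_Gamma add_pos_nonneg)
  finally have 2: "norm (rGamma (1 + of_real \<eta> * Complex x y)) \<le> rGamma (1 + \<eta> * x) * exp (pi / 2 * (\<eta> * \<bar>y\<bar>))"
    using assms by (simp add: abs_mult)
  show ?thesis
    unfolding coeff_fun_def norm_mult using mult_mono[OF 1 2] assms by (simp add: mult_ac)
qed

lemma exp_decay_le_inverse_square:
  fixes \<kappa> :: real
  assumes "0 < \<kappa>"
  shows "\<exists>K>0. \<forall>y. (1 + \<bar>y\<bar>) * exp (- \<kappa> * \<bar>y\<bar>) \<le> K / (1 + y\<^sup>2)"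
proof (intro exI conjI allI)
  define m where "m = min \<kappa> 3 / 3"
  have m: "0 < m" "m \<le> 1" "3 * m \<le> \<kappa>" using assms by (auto simp: m_def)
  show "1 / m ^ 3 > 0" using m by simp
  fix y :: real
  have "m * (1 + \<bar>y\<bar>) \<le> 1 + m * \<bar>y\<bar>" using m by (simp add: algebra_simps)
  also have "\<dots> \<le> exp (m * \<bar>y\<bar>)" by (rule exp_ge_add_one_self)
  finally have "(m * (1 + \<bar>y\<bar>)) ^ 3 \<le> exp (m * \<bar>y\<bar>) ^ 3" using m by (intro power_mono) auto
  also have "\<dots> = exp (3 * m * \<bar>y\<bar>)" by (simp flip: exp_of_nat_mult)
  also have "\<dots> \<le> exp (\<kappa> * \<bar>y\<bar>)" using m by (simp add: mult_right_mono)
  finally have "(1 + \<bar>y\<bar>) ^ 3 \<le> exp (\<kappa> * \<bar>y\<bar>) / m ^ 3"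
    using m by (simp add: pos_le_divide_eq mult.commute power_mult_distrib)
  moreover have "(1 + \<bar>y\<bar>) * (1 + y\<^sup>2) \<le> (1 + \<bar>y\<bar>) ^ 3"
  proof -
    have "1 + y\<^sup>2 \<le> (1 + \<bar>y\<bar>)\<^sup>2" by (simp add: power2_eq_square algebra_simps)
    then have "(1 + \<bar>y\<bar>) * (1 + y\<^sup>2) \<le> (1 + \<bar>y\<bar>) * (1 + \<bar>y\<bar>)\<^sup>2" by (intro mult_left_mono) auto
    then show ?thesis by (simp add: power3_eq_cube power2_eq_square)
  qed
  ultimately have "(1 + \<bar>y\<bar>) * (1 + y\<^sup>2) \<le> exp (\<kappa> * \<bar>y\<bar>) / m ^ 3" by linarith
  moreover have "1 + y\<^sup>2 > 0" by (simp add: add_pos_nonneg)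
  ultimately have "1 + \<bar>y\<bar> \<le> exp (\<kappa> * \<bar>y\<bar>) / m ^ 3 / (1 + y\<^sup>2)"
    by (simp only: pos_le_divide_eq)
  then have "(1 + \<bar>y\<bar>) * exp (- \<kappa> * \<bar>y\<bar>) \<le> exp (\<kappa> * \<bar>y\<bar>) / m ^ 3 / (1 + y\<^sup>2) * exp (- \<kappa> * \<bar>y\<bar>)"
    by (intro mult_right_mono) auto
  also have "\<dots> = 1 / m ^ 3 / (1 + y\<^sup>2)" by (simp add: exp_minus)
  finally show "(1 + \<bar>y\<bar>) * exp (- \<kappa> * \<bar>y\<bar>) \<le> 1 / m ^ 3 / (1 + y\<^sup>2)" .
qed

lemma rGamma_superexponential_decay:
  fixes \<eta> l :: real
  assumes "0 < \<eta>"
  shows "\<exists>H\<ge>0. \<forall>x\<ge>0. (1 + x) * rGamma (1 + \<eta> * x) * exp (x * l) \<le> H * exp (- x)"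
proof (intro exI conjI allI impI)
  \<comment> \<open>\<open>M\<close> is large enough that \<open>M powr (\<eta> x)\<close> dominates \<open>exp ((l + 2) x)\<close>; the surplus \<open>exp (2 x)\<close>
    absorbs \<open>1 + x\<close> and leaves \<open>exp (- x)\<close>\<close>
  define M where "M = max 1 (exp ((l + 2) / \<eta>))"
  show "0 \<le> exp (M + 1)" by simp
  fix x :: real assume x: "0 \<le> x"
  have "exp ((l + 2) * x) = exp ((l + 2) / \<eta>) powr (\<eta> * x)"
    using assms by (simp add: powr_def)
  also have "\<dots> \<le> M powr (\<eta> * x)" using x assms by (intro powr_mono2) (auto simp: M_def)
  finally have "exp ((l + 2) * x) * exp (- (M + 1)) \<le> M powr (\<eta> * x) * exp (- (M + 1))"
    by (intro mult_right_mono) auto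
  also have "\<dots> \<le> Gamma (\<eta> * x + 1)"
    using x assms by (intro power_le_Gamma) (auto simp: M_def)
  finally have le: "exp ((l + 2) * x) * exp (- (M + 1)) \<le> Gamma (\<eta> * x + 1)" .
  have pos: "Gamma (1 + \<eta> * x) > 0" using x assms by (intro Gamma_real_pos) (simp add: add_pos_nonneg)
  have "exp ((l + 2) * x) * rGamma (1 + \<eta> * x)
      = exp ((l + 2) * x) * exp (- (M + 1)) * exp (M + 1) / Gamma (1 + \<eta> * x)"
    by (simp add: rGamma_inverse_Gamma divide_inverse mult.assoc flip: exp_add)
  also have "\<dots> \<le> Gamma (1 + \<eta> * x) * exp (M + 1) / Gamma (1 + \<eta> * x)"
    using le pos by (intro divide_right_mono mult_right_mono) (auto simp: add.commute)
  also have "\<dots> = exp (M + 1)" using pos by simp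
  finally have main: "exp ((l + 2) * x) * rGamma (1 + \<eta> * x) \<le> exp (M + 1)" .
  have "(1 + x) * rGamma (1 + \<eta> * x) * exp (x * l)
      = (1 + x) * exp (- 2 * x) * (exp ((l + 2) * x) * rGamma (1 + \<eta> * x))"
  proof -
    have "exp (x * l) = exp (- 2 * x) * exp ((l + 2) * x)"
      unfolding exp_add[symmetric] by (simp add: algebra_simps)
    then show ?thesis by simp
  qed
  also have "\<dots> \<le> (1 + x) * exp (- 2 * x) * exp (M + 1)"
    using x main by (intro mult_left_mono) auto
  also have "\<dots> \<le> exp x * exp (- 2 * x) * exp (M + 1)" by (intro mult_right_mono) auto
  also have "\<dots> = exp (M + 1) * exp (- x)" by (simp flip: exp_add)
  finally show "(1 + x) * rGamma (1 + \<eta> * x) * exp (x * l) \<le> exp (M + 1) * exp (- x)" .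
qed

lemma coeff_fun_of_nat:
  "coeff_fun \<eta> (of_nat n) = of_real (((1 + \<eta>) * n + 1) / Gamma (1 + \<eta> * n))"
proof -
  have "1 + complex_of_real \<eta> * of_nat n = of_real (1 + \<eta> * real n)"
    "complex_of_real (1 + \<eta>) * of_nat n + 1 = of_real ((1 + \<eta>) * real n + 1)" by simp_all
  then show ?thesis
    unfolding coeff_fun_def
    by (simp only: rGamma_complex_of_real rGamma_inverse_Gamma[of "1 + \<eta> * real n"] divide_inverse of_real_mult)
qed

lemma coeff_fun_holomorphic [holomorphic_intros]:
  "coeff_fun \<eta> holomorphic_on S"
  unfolding coeff_fun_def by (intro holomorphic_intros)

lemma coeff_fun_nonzero:
  assumes "0 < \<eta>" shows "coeff_fun \<eta> (of_nat n) \<noteq> 0"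
proof -
  have "Gamma (1 + \<eta> * n) > 0" using assms by (intro Gamma_real_pos) (simp add: add_pos_nonneg)
  moreover have "(1 + \<eta>) * n + 1 > 0" using assms by (simp add: add_nonneg_pos)
  ultimately have "((1 + \<eta>) * n + 1) / Gamma (1 + \<eta> * n) \<noteq> 0" by simp
  then show ?thesis by (simp only: coeff_fun_of_nat of_real_eq_0_iff not_False_eq_True)
qed

text \<open>The residue at a positive integer \<open>n\<close> is \<open>coeff_fun \<eta> n * (- exp l) ^ n\<close>. On vertical lines the sine
  contributes the decay \<open>exp (- \<pi>|Im s|)\<close>, which beats the other factors as long as \<open>|Im l|\<close> stays
  below \<open>\<pi> - \<pi>\<eta>/2\<close>; so the integral makes sense for points \<open>- exp l\<close> of arbitrary modulus.\<close>

definition lindelof_integrand :: "real \<Rightarrow> complex \<Rightarrow> complex \<Rightarrow> complex" where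
  "lindelof_integrand \<eta> l s = coeff_fun \<eta> s * exp (s * l) * of_real pi / sin (of_real pi * s)"

lemma sin_pi_eq_0_strip:
  assumes "sin (of_real pi * s) = 0" "0 < Re s" "Re s < real N + 1"
  shows "s \<in> of_nat ` {1..N}"
proof -
  obtain k :: int where "of_real pi * s = of_real (of_int k * pi)"
    using assms(1) by (auto simp: sin_eq_0)
  then have s: "s = of_int k" by (simp add: mult.commute)
  have "0 < real_of_int k" "real_of_int k < real N + 1" using assms(2,3) unfolding s by simp_all
  then have k: "0 < k" "k < int N + 1" by linarith+
  have "s = of_nat (nat k)" using s k by simp
  then show ?thesis using k by (intro image_eqI[of _ _ "nat k"]) auto
qed

lemma contour_integral_lindelof:
  assumes \<eta>: "0 < \<eta>" and R: "0 < R" and N: "0 < N"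
  shows "contour_integral (rectpath (Complex (1/2) (- R)) (Complex (real N + 1/2) R)) (lindelof_integrand \<eta> l)
     = 2 * pi * \<i> * (\<Sum>n=1..N. coeff_fun \<eta> (of_nat n) * (- exp l) ^ n)"
proof -
  define a where "a = Complex (1/2) (- R)"
  define b where "b = Complex (real N + 1/2) R"
  define S where "S = {s. Re s > 0} \<inter> {s. Re s < real N + 1}"
  define P where "P = (of_nat ` {1..N} :: complex set)"
  have ab: "Re a \<le> Re b" "Im a \<le> Im b" using R by (auto simp: a_def b_def)
  have S: "open S" "convex S"
    by (auto simp: S_def intro!: open_Int open_halfspace_Re_gt open_halfspace_Re_lt convex_Int convex_halfspace_Re_gt convex_halfspace_Re_lt)
  have cboxS: "cbox a b \<subseteq> S" by (auto simp: S_def a_def b_def in_cbox_complex_iff)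
  have Pbox: "P \<subseteq> box a b" using R by (auto simp: P_def a_def b_def in_box_complex_iff)
  have img: "path_image (rectpath a b) \<subseteq> S - P"
    unfolding path_image_rectpath_cbox_minus_box[OF ab] using cboxS Pbox by auto
  have "contour_integral (rectpath a b) (lindelof_integrand \<eta> l) =
      2 * pi * \<i> * (\<Sum>p\<in>P. winding_number (rectpath a b) p * residue (lindelof_integrand \<eta> l) p)"
  proof (rule Residue_theorem)
    have "sin (of_real pi * s) \<noteq> 0" if "s \<in> S - P" for s
      using sin_pi_eq_0_strip[of s N] that by (auto simp: S_def P_def)
    then show "lindelof_integrand \<eta> l holomorphic_on S - P"
      unfolding lindelof_integrand_def by (intro holomorphic_intros) auto
    show "\<forall>z. z \<notin> S \<longrightarrow> winding_number (rectpath a b) z = 0"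
      using winding_number_rectpath_outside[OF ab] cboxS by blast
  qed (use S img in \<open>auto simp: P_def intro: convex_connected\<close>)
  also have "(\<Sum>p\<in>P. winding_number (rectpath a b) p * residue (lindelof_integrand \<eta> l) p)
     = (\<Sum>n=1..N. coeff_fun \<eta> (of_nat n) * (- exp l) ^ n)"
    unfolding P_def
  proof (subst sum.reindex)
    show "inj_on (of_nat :: nat \<Rightarrow> complex) {1..N}" by (simp add: inj_on_def)
    show "sum ((\<lambda>p. winding_number (rectpath a b) p * residue (lindelof_integrand \<eta> l) p) \<circ> of_nat) {1..N}
        = (\<Sum>n=1..N. coeff_fun \<eta> (of_nat n) * (- exp l) ^ n)"
    proof (rule sum.cong)
      fix n assume n: "n \<in> {1..N}"
      have cosn: "cos (complex_of_real pi * of_nat n) = (- 1) ^ n"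
      proof -
        have "cos (complex_of_real pi * of_nat n) = of_real (cos (pi * real n))"
          by (simp only: cos_of_real[symmetric] of_real_mult of_real_of_nat_eq)
        then show ?thesis by (simp add: cos_npi2)
      qed
      have sinn: "sin (complex_of_real pi * of_nat n) = 0"
      proof -
        have "sin (complex_of_real pi * of_nat n) = of_real (sin (pi * real n))"
          by (simp only: sin_of_real[symmetric] of_real_mult of_real_of_nat_eq)
        then show ?thesis by (simp add: sin_npi2)
      qed
      have "residue (lindelof_integrand \<eta> l) (of_nat n)
         = coeff_fun \<eta> (of_nat n) * exp (of_nat n * l) * of_real pi / (of_real pi * (- 1) ^ n)"
        unfolding lindelof_integrand_def
      proof (rule residue_simple_pole_deriv[of _ UNIV])
        show "((\<lambda>s. sin (of_real pi * s)) has_field_derivative of_real pi * (- 1) ^ n) (at (of_nat n :: complex))"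
          by (auto intro!: derivative_eq_intros simp: cosn)
      qed (auto intro!: holomorphic_intros simp: coeff_fun_nonzero[OF \<eta>] sinn)
      also have "\<dots> = coeff_fun \<eta> (of_nat n) * (- exp l) ^ n"
      proof -
        have "(- exp l) ^ n = (- 1) ^ n * exp (of_nat n * l)"
          by (subst exp_of_nat_mult) (metis power_minus)
        moreover have "(1 :: complex) / (- 1) ^ n = (- 1) ^ n" by (simp add: divide_eq_eq flip: power_mult_distrib)
        ultimately show ?thesis by (simp add: field_simps)
      qed
      finally have "residue (lindelof_integrand \<eta> l) (of_nat n) = coeff_fun \<eta> (of_nat n) * (- exp l) ^ n" .
      then show "((\<lambda>p. winding_number (rectpath a b) p * residue (lindelof_integrand \<eta> l) p) \<circ> of_nat) n
          = coeff_fun \<eta> (of_nat n) * (- exp l) ^ n"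
      proof -
        have "of_nat n \<in> box a b" using Pbox n unfolding P_def by blast
        then have "winding_number (rectpath a b) (of_nat n) = 1" by (rule winding_number_rectpath)
        then show ?thesis using \<open>residue _ _ = coeff_fun \<eta> (of_nat n) * (- exp l) ^ n\<close> by simp
      qed
    qed simp
  qed
  finally show ?thesis by (simp add: a_def b_def)
qed

text \<open>Half of \<open>\<epsilon>\<close> pays for the growth of the reciprocal Gamma function, the other half makes
  the integrand decay.\<close>

lemma norm_lindelof_integrand_le:
  assumes \<eta>: "0 < \<eta>" "\<eta> \<le> 1" "pi * \<eta> \<le> \<epsilon>" and l: "\<bar>Im l\<bar> \<le> pi - \<epsilon>"
    and x: "0 \<le> x" and xy: "cos (2 * pi * x) = -1 \<or> 1 \<le> \<bar>y\<bar>"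
    and K: "\<And>y. (1 + \<bar>y\<bar>) * exp (- (\<epsilon> / 2) * \<bar>y\<bar>) \<le> K / (1 + y\<^sup>2)"
  shows "norm (lindelof_integrand \<eta> l (Complex x y))
    \<le> 8 * pi * K * ((1 + x) * rGamma (1 + \<eta> * x) * exp (x * Re l)) / (1 + y\<^sup>2)"
proof -
  define h where "h = (1 + x) * rGamma (1 + \<eta> * x) * exp (x * Re l)"
  have rG: "rGamma (1 + \<eta> * x) \<ge> 0" using \<eta> x by (simp add: rGamma_inverse_Gamma add_pos_nonneg)
  have h: "h \<ge> 0" using rG x by (simp add: h_def)
  have e: "norm (exp (Complex x y * l)) \<le> exp (x * Re l) * exp ((pi - \<epsilon>) * \<bar>y\<bar>)"
  proof -
    have "- (y * Im l) \<le> \<bar>y\<bar> * \<bar>Im l\<bar>" by (metis abs_ge_minus_self abs_mult)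
    also have "\<dots> \<le> (pi - \<epsilon>) * \<bar>y\<bar>" using mult_right_mono[OF l, of "\<bar>y\<bar>"] by (simp add: mult.commute)
    finally have "exp (- (y * Im l)) \<le> exp ((pi - \<epsilon>) * \<bar>y\<bar>)" by simp
    then show ?thesis by (simp add: norm_exp_eq_Re exp_diff exp_minus divide_inverse)
  qed
  have "norm (lindelof_integrand \<eta> l (Complex x y)) =
      norm (coeff_fun \<eta> (Complex x y)) * norm (exp (Complex x y * l)) * pi / norm (sin (of_real pi * Complex x y))"
    by (simp add: lindelof_integrand_def norm_mult norm_divide)
  also have "\<dots> \<le> (2 * (1 + x) * (1 + \<bar>y\<bar>) * rGamma (1 + \<eta> * x) * exp (pi / 2 * (\<eta> * \<bar>y\<bar>))) *
      (exp (x * Re l) * exp ((pi - \<epsilon>) * \<bar>y\<bar>)) * pi / (exp (pi * \<bar>y\<bar>) / 4)"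
    by (intro frac_le mult_mono norm_coeff_fun_le e norm_sin_pi_ge xy x \<eta> mult_nonneg_nonneg rG) (use x in auto)
  also have "\<dots> = 8 * pi * h * ((1 + \<bar>y\<bar>) * exp (pi / 2 * (\<eta> * \<bar>y\<bar>) + (pi - \<epsilon>) * \<bar>y\<bar> - pi * \<bar>y\<bar>))"
    by (simp add: h_def exp_add exp_diff)
  also have "\<dots> \<le> 8 * pi * h * ((1 + \<bar>y\<bar>) * exp (- (\<epsilon> / 2) * \<bar>y\<bar>))"
  proof -
    have "pi / 2 * (\<eta> * \<bar>y\<bar>) \<le> \<epsilon> / 2 * \<bar>y\<bar>" using mult_right_mono[OF \<eta>(3), of "\<bar>y\<bar> / 2"] by simp
    then have "pi / 2 * (\<eta> * \<bar>y\<bar>) + (pi - \<epsilon>) * \<bar>y\<bar> - pi * \<bar>y\<bar> \<le> - (\<epsilon> / 2) * \<bar>y\<bar>" by (simp add: algebra_simps)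
    then show ?thesis using h by (intro mult_left_mono) auto
  qed
  also have "\<dots> \<le> 8 * pi * h * (K / (1 + y\<^sup>2))" using K h by (intro mult_left_mono) auto
  finally show ?thesis by (simp add: h_def mult_ac)
qed

lemma contour_integral_rectpath_split:
  assumes "continuous_on (path_image (rectpath a b)) F"
  defines "c \<equiv> Complex (Re b) (Im a)" and "d \<equiv> Complex (Re a) (Im b)"
  shows "contour_integral (rectpath a b) F = contour_integral (linepath a c) F + contour_integral (linepath c b) F
      + contour_integral (linepath b d) F + contour_integral (linepath d a) F"
    and "closed_segment a c \<subseteq> path_image (rectpath a b)" "closed_segment c b \<subseteq> path_image (rectpath a b)"
      "closed_segment b d \<subseteq> path_image (rectpath a b)" "closed_segment d a \<subseteq> path_image (rectpath a b)"
proof -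
  have img: "path_image (rectpath a b) = closed_segment a c \<union> closed_segment c b \<union> closed_segment b d \<union> closed_segment d a"
    by (simp add: rectpath_def Let_def path_image_join Un_assoc c_def d_def)
  then show *: "closed_segment a c \<subseteq> path_image (rectpath a b)" "closed_segment c b \<subseteq> path_image (rectpath a b)"
      "closed_segment b d \<subseteq> path_image (rectpath a b)" "closed_segment d a \<subseteq> path_image (rectpath a b)"
    by auto
  have "F contour_integrable_on linepath a c" "F contour_integrable_on linepath c b"
    "F contour_integrable_on linepath b d" "F contour_integrable_on linepath d a"
    using * by (auto intro!: contour_integrable_continuous_linepath continuous_on_subset[OF assms(1)])
  then show "contour_integral (rectpath a b) F = contour_integral (linepath a c) F + contour_integral (linepath c b) F
      + contour_integral (linepath b d) F + contour_integral (linepath d a) F"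
    by (simp add: rectpath_def Let_def contour_integrable_join add.assoc flip: c_def d_def)
qed

lemma norm_contour_integral_linepath_le:
  assumes "continuous_on (closed_segment a b) F" "0 \<le> B" "\<And>x. x \<in> closed_segment a b \<Longrightarrow> norm (F x) \<le> B"
  shows "norm (contour_integral (linepath a b) F) \<le> B * norm (b - a)"
  using assms by (intro contour_integral_bound_linepath contour_integrable_continuous_linepath)

lemma summable_coeff_fun:
  assumes "0 < \<eta>" "\<eta> \<le> 1"
  shows "summable (\<lambda>n. norm (coeff_fun \<eta> (of_nat n)) * r ^ n)"
proof -
  define l where "l = ln (\<bar>r\<bar> + 1)"
  obtain H where H: "H \<ge> 0" "\<And>x. x \<ge> 0 \<Longrightarrow> (1 + x) * rGamma (1 + \<eta> * x) * exp (x * l) \<le> H * exp (- x)"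
    using rGamma_superexponential_decay[OF assms(1)] by metis
  show ?thesis
  proof (rule summable_comparison_test')
    show "summable (\<lambda>n. 2 * H * exp (- 1) ^ n)"
      by (intro summable_mult summable_geometric) simp
    fix n :: nat
    have "norm (coeff_fun \<eta> (of_nat n)) \<le> 2 * (1 + real n) * rGamma (1 + \<eta> * n)"
      using norm_coeff_fun_le[of "real n" \<eta> 0] assms by (simp add: complex_of_real_def[symmetric])
    moreover have "\<bar>r\<bar> ^ n \<le> exp (real n * l)"
      unfolding l_def exp_of_nat_mult by (intro power_mono) (auto simp: exp_ln_iff)
    ultimately have "norm (coeff_fun \<eta> (of_nat n)) * \<bar>r\<bar> ^ n \<le> 2 * (1 + real n) * rGamma (1 + \<eta> * n) * exp (real n * l)"
      using assms by (intro mult_mono) (auto simp: rGamma_inverse_Gamma add_pos_nonneg)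
    also have "\<dots> = 2 * ((1 + real n) * rGamma (1 + \<eta> * n) * exp (real n * l))" by (simp only: mult.assoc)
    also have "\<dots> \<le> 2 * (H * exp (- real n))" by (intro mult_left_mono H) auto
    also have "exp (- real n) = exp (- 1) ^ n" by (simp flip: exp_of_nat_mult)
    finally show "norm (norm (coeff_fun \<eta> (of_nat n)) * r ^ n) \<le> 2 * H * exp (- 1) ^ n"
      by (simp add: abs_mult power_abs)
  qed
qed

lemma sin_pi_nonzero:
  assumes "cos (2 * pi * Re s) = -1 \<or> 1 \<le> \<bar>Im s\<bar>"
  shows "sin (of_real pi * s) \<noteq> 0"
  using norm_sin_pi_ge[OF assms] by (metis complex_surj exp_gt_zero divide_pos_pos less_le_not_le norm_zero zero_less_numeral)

text \<open>Integrate over rectangles with left side on \<open>Re s = 1/2\<close> and let the other three sides tend to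
  infinity. Their contribution vanishes by the superexponential decay of \<open>1/\<Gamma>\<close> to the right and
  by the decay in vertical direction, so only the left side contributes, and its bound does not
  depend on \<open>\<eta>\<close>. The summand 1 is the term \<open>n = 0\<close>, whose pole lies outside the rectangles.\<close>

lemma lindelof_sector_bound:
  assumes \<epsilon>: "0 < \<epsilon>"
  shows "\<exists>B. \<forall>\<eta> l. 0 < \<eta> \<and> \<eta> \<le> 1 \<and> pi * \<eta> \<le> \<epsilon> \<and> \<bar>Im l\<bar> \<le> pi - \<epsilon> \<longrightarrow>
     norm (\<Sum>n. coeff_fun \<eta> (of_nat n) * (- exp l) ^ n) \<le> 1 + B * exp (Re l / 2)"
proof -
  obtain K where K: "K > 0" "\<And>y. (1 + \<bar>y\<bar>) * exp (- (\<epsilon> / 2) * \<bar>y\<bar>) \<le> K / (1 + y\<^sup>2)"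
    using exp_decay_le_inverse_square[of "\<epsilon> / 2"] \<epsilon> by auto
  define Q where "Q = 8 * pi * K"
  have Q: "Q > 0" using K by (simp add: Q_def)
  have "norm (\<Sum>n. coeff_fun \<eta> (of_nat n) * (- exp l) ^ n) \<le> 1 + (Q * (3 / 2 * exp 2)) * exp (Re l / 2)"
    if \<eta>: "0 < \<eta>" "\<eta> \<le> 1" "pi * \<eta> \<le> \<epsilon>" and l: "\<bar>Im l\<bar> \<le> pi - \<epsilon>" for \<eta> l
  proof -
    define h where "h x = (1 + x) * rGamma (1 + \<eta> * x) * exp (x * Re l)" for x
    define F where "F = lindelof_integrand \<eta> l"
    obtain H where H: "H \<ge> 0" "\<And>x. x \<ge> 0 \<Longrightarrow> h x \<le> H * exp (- x)"
      using rGamma_superexponential_decay[OF \<eta>(1), of "Re l"] unfolding h_def by metis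
    have HH: "h x \<le> H" if "x \<ge> 0" for x
      using H(2)[OF that] mult_left_mono[of "exp (- x)" 1 H] H(1) that by simp
    have h0: "h x \<ge> 0" if "x \<ge> 0" for x
    proof -
      have "Gamma (1 + \<eta> * x) > 0" using that \<eta> by (intro Gamma_real_pos) (simp add: add_pos_nonneg)
      then show ?thesis using that by (simp add: h_def rGamma_inverse_Gamma)
    qed
    have Fb: "norm (F (Complex x y)) \<le> Q * h x / (1 + y\<^sup>2)"
      if "0 \<le> x" "cos (2 * pi * x) = -1 \<or> 1 \<le> \<bar>y\<bar>" for x y
      using norm_lindelof_integrand_le[OF \<eta> l that K(2)] by (simp add: F_def h_def Q_def)
    have cosN: "cos (2 * pi * (real N + 1 / 2)) = -1" for N :: nat
    proof -
      have "cos (2 * pi * (real N + 1 / 2)) = cos (pi * real (2 * N + 1))" by (simp add: algebra_simps)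
      then show ?thesis by (simp only: cos_npi2) simp
    qed
    define S where "S N = (\<Sum>n=1..N. coeff_fun \<eta> (of_nat n) * (- exp l) ^ n)" for N
    define e where "e N = Q * (H * exp (- (real N + 1 / 2))) / 2 + Q * H * (real N / (1 + (real N + 1)\<^sup>2)) / pi"
      for N :: nat
    have SN: "norm (S N) \<le> Q * h (1 / 2) / 2 + e N" if N: "0 < N" for N
    proof -
      define R where "R = real N + 1"
      have R: "R > 0" "R \<ge> 1" by (auto simp: R_def)
      define a b c d where "a = Complex (1 / 2) (- R)" and "b = Complex (real N + 1 / 2) R"
        and "c = Complex (real N + 1 / 2) (- R)" and "d = Complex (1 / 2) R"
      have ab: "Re a \<le> Re b" "Im a \<le> Im b" using R by (auto simp: a_def b_def)
      have cont: "continuous_on (path_image (rectpath a b)) F"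
        unfolding F_def lindelof_integrand_def
      proof (intro holomorphic_on_imp_continuous_on holomorphic_intros ballI sin_pi_nonzero)
        fix s assume "s \<in> path_image (rectpath a b)"
        then have "Re s = real 0 + 1 / 2 \<or> Re s = real N + 1 / 2 \<or> \<bar>Im s\<bar> = R"
          unfolding path_image_rectpath[OF ab] using R by (auto simp: a_def b_def)
        then show "cos (2 * pi * Re s) = -1 \<or> 1 \<le> \<bar>Im s\<bar>"
          using cosN R by metis
      qed
      have cd: "Complex (Re b) (Im a) = c" "Complex (Re a) (Im b) = d" by (simp_all add: a_def b_def c_def d_def)
      note split = contour_integral_rectpath_split[OF cont, unfolded cd]
      have hor: "norm (F s) \<le> Q * H / (1 + R\<^sup>2)" if "0 \<le> Re s" "\<bar>Im s\<bar> = R" for s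
      proof -
        have "norm (F s) \<le> Q * h (Re s) / (1 + (Im s)\<^sup>2)" using Fb[of "Re s" "Im s"] that R by simp
        also have "\<dots> \<le> Q * H / (1 + (Im s)\<^sup>2)"
          using Q that by (intro divide_right_mono mult_left_mono HH) auto
        also have "(Im s)\<^sup>2 = R\<^sup>2" using that(2) by (metis power2_abs)
        finally show ?thesis .
      qed
      have segs: "closed_segment a c \<subseteq> {s. 0 \<le> Re s \<and> \<bar>Im s\<bar> = R}" "closed_segment b d \<subseteq> {s. 0 \<le> Re s \<and> \<bar>Im s\<bar> = R}"
        using R by (auto simp: closed_segment_same_Im a_def b_def c_def d_def closed_segment_eq_real_ivl split: if_splits)
      have B0: "0 \<le> Q * H / (1 + R\<^sup>2)" using Q H by simp
      have len: "norm (c - a) = N" "norm (d - b) = N"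
        by (simp_all add: a_def b_def c_def d_def cmod_def)
      have I1: "norm (contour_integral (linepath a c) F) \<le> Q * H / (1 + R\<^sup>2) * real N"
        using norm_contour_integral_linepath_le[OF continuous_on_subset[OF cont split(2)] B0] hor segs(1) len by fastforce
      have I3: "norm (contour_integral (linepath b d) F) \<le> Q * H / (1 + R\<^sup>2) * real N"
        using norm_contour_integral_linepath_le[OF continuous_on_subset[OF cont split(4)] B0] hor segs(2) len by fastforce
      have I2: "norm (contour_integral (linepath c b) F) \<le> Q * h (real N + 1 / 2) * pi"
        unfolding b_def c_def
      proof (rule norm_vertical_integral_le)
        show "continuous_on (closed_segment (Complex (real N + 1 / 2) (- R)) (Complex (real N + 1 / 2) R)) F"
          using continuous_on_subset[OF cont split(3)] by (simp add: b_def c_def)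
      qed (use R Fb cosN in auto)
      also have "\<dots> \<le> Q * (H * exp (- (real N + 1 / 2))) * pi"
        using Q H(2)[of "real N + 1 / 2"] by (intro mult_right_mono mult_left_mono) auto
      finally have I2: "norm (contour_integral (linepath c b) F) \<le> Q * (H * exp (- (real N + 1 / 2))) * pi" .
      have "norm (contour_integral (linepath d a) F) = norm (contour_integral (linepath a d) F)"
        using contour_integral_reverse_linepath[OF continuous_on_subset[OF cont split(5)]] by simp
      also have "\<dots> \<le> Q * h (1 / 2) * pi"
        unfolding a_def d_def
      proof (rule norm_vertical_integral_le)
        show "continuous_on (closed_segment (Complex (1 / 2) (- R)) (Complex (1 / 2) R)) F"
          using continuous_on_subset[OF cont split(5)] by (simp add: a_def d_def closed_segment_commute)
      qed (use R Fb[of "1/2"] cosN[of 0] in auto)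
      finally have I4: "norm (contour_integral (linepath d a) F) \<le> Q * h (1 / 2) * pi" .
      have "2 * pi * norm (S N) = norm (contour_integral (rectpath a b) F)"
        using contour_integral_lindelof[OF \<eta>(1) R(1) N, of l] by (simp add: S_def F_def a_def b_def norm_mult)
      also have "\<dots> \<le> norm (contour_integral (linepath a c) F) + norm (contour_integral (linepath c b) F)
          + norm (contour_integral (linepath b d) F) + norm (contour_integral (linepath d a) F)"
        unfolding split(1) by (intro norm_triangle_le order_refl add_mono)
      also have "\<dots> \<le> Q * H * (real N / (1 + R\<^sup>2)) + Q * (H * exp (- (real N + 1 / 2))) * pi
          + Q * H * (real N / (1 + R\<^sup>2)) + Q * h (1 / 2) * pi"
        using I1 I3 by (intro add_mono I2 I4) simp_all
      also have "\<dots> = 2 * pi * (Q * h (1 / 2) / 2 + e N)"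
      proof -
        have "w + y * pi + w + x * pi = 2 * pi * (x / 2 + (y / 2 + w / pi))" for w x y :: real
          by (simp add: field_simps)
        then show ?thesis unfolding e_def R_def .
      qed
      finally show ?thesis by (rule mult_left_le_imp_le) simp
    qed
    have summ: "summable (\<lambda>n. coeff_fun \<eta> (of_nat n) * (- exp l) ^ n)"
      using summable_coeff_fun[OF \<eta>(1,2), of "norm (exp l)"]
      by - (rule summable_norm_cancel, simp add: norm_mult norm_power)
    have "(\<lambda>N. norm (\<Sum>n\<le>N. coeff_fun \<eta> (of_nat n) * (- exp l) ^ n)) \<longlonglongrightarrow> norm (\<Sum>n. coeff_fun \<eta> (of_nat n) * (- exp l) ^ n)"
      by (intro tendsto_norm summable_LIMSEQ' summ)
    moreover have "(\<lambda>N. 1 + (Q * h (1 / 2) / 2 + e N)) \<longlonglongrightarrow> 1 + (Q * h (1 / 2) / 2 + (Q * (H * 0) / 2 + Q * H * 0 / pi))"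
    proof -
      have "(\<lambda>N. exp (- (real N + 1 / 2))) \<longlonglongrightarrow> 0" "(\<lambda>N. real N / (1 + (real N + 1)\<^sup>2)) \<longlonglongrightarrow> 0"
        by real_asymp+
      then show ?thesis unfolding e_def by (intro tendsto_intros) auto
    qed
    moreover have "norm (\<Sum>n\<le>N. coeff_fun \<eta> (of_nat n) * (- exp l) ^ n) \<le> 1 + (Q * h (1 / 2) / 2 + e N)"
      if "N \<ge> 1" for N
    proof -
      have "(\<Sum>n\<le>N. coeff_fun \<eta> (of_nat n) * (- exp l) ^ n) = 1 + S N"
        unfolding S_def atMost_atLeast0 by (subst sum.atLeast_Suc_atMost) (auto simp: coeff_fun_def)
      then show ?thesis using norm_triangle_ineq[of 1 "S N"] SN[of N] that by simp
    qed
    ultimately have "norm (\<Sum>n. coeff_fun \<eta> (of_nat n) * (- exp l) ^ n) \<le> 1 + (Q * h (1 / 2) / 2 + (Q * (H * 0) / 2 + Q * H * 0 / pi))"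
      by (intro LIMSEQ_le) blast+
    also have "\<dots> \<le> 1 + Q * h (1 / 2)" using Q h0[of "1/2"] by simp
    also have "h (1 / 2) \<le> 3 / 2 * exp 2 * exp (Re l / 2)"
    proof -
      have "exp (- 2) \<le> Gamma (\<eta> / 2 + 1)" using power_le_Gamma[of "\<eta> / 2" 1] \<eta> by simp
      then have "rGamma (1 + \<eta> / 2) \<le> inverse (exp (- 2))"
        unfolding rGamma_inverse_Gamma by (intro le_imp_inverse_le) (auto simp: add.commute)
      then have "rGamma (1 + \<eta> / 2) * exp (Re l / 2) \<le> exp 2 * exp (Re l / 2)"
        by (intro mult_right_mono) (auto simp: exp_minus)
      then show ?thesis by (simp add: h_def)
    qed
    finally show ?thesis using Q by (simp add: mult_ac)
  qed
  then show ?thesis by blast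
qed

section \<open>The summation kernel\<close>

definition kernel_coeff :: "real \<Rightarrow> nat \<Rightarrow> real" where
  "kernel_coeff \<delta> n = fact n / Gamma (\<delta> * real n + 1)"

definition approx_kernel :: "real \<Rightarrow> complex \<Rightarrow> complex" where
  "approx_kernel \<delta> = eval_fps (Abs_fps (\<lambda>n. of_real (kernel_coeff \<delta> n)))"

definition beta_weight :: "real \<Rightarrow> real \<Rightarrow> real" where
  "beta_weight \<eta> x = x * (1 - x) powr \<eta>"

lemma beta_weight_bounds:
  assumes "x \<in> {0..1}" "0 < \<eta>"
  shows "0 \<le> beta_weight \<eta> x" "beta_weight \<eta> x \<le> 1"
  using assms mult_mono[of x 1 "(1 - x) powr \<eta>" 1] powr_le1[of \<eta> "1 - x"] by (auto simp: beta_weight_def)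

text \<open>Euler's Beta integral for \<open>B(n + 1, \<eta>n + 1)\<close>. It trades the quotient of two Gamma values that grow
  at almost the same rate for \<open>1/\<Gamma>(\<eta>n + 1)\<close> and a linear factor, at the price of an average over the points
  \<open>beta_weight \<eta> x\<close> of \<open>[0, 1]\<close>.\<close>

lemma kernel_coeff_integral:
  assumes \<eta>: "0 < \<eta>"
  shows "((\<lambda>x. coeff_fun \<eta> (of_nat n) * of_real (beta_weight \<eta> x ^ n)) has_integral
     of_real (kernel_coeff (1 + \<eta>) n)) {0..1}"
proof -
  have pos: "\<eta> * real n + 1 > 0" "(1 + \<eta>) * real n + 1 > 0" using \<eta> by (simp_all add: add_nonneg_pos)
  have "((\<lambda>x. beta_weight \<eta> x ^ n) has_integral Beta (real n + 1) (\<eta> * real n + 1)) {0..1}"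
  proof (rule has_integral_spike[of "{0, 1}"])
    show "((\<lambda>t. t powr (real n + 1 - 1) * (1 - t) powr (\<eta> * real n + 1 - 1)) has_integral
        Beta (real n + 1) (\<eta> * real n + 1)) {0..1}"
      using pos by (intro has_integral_Beta_real) auto
  qed (auto simp: beta_weight_def power_mult_distrib powr_realpow powr_powr[symmetric] intro!: negligible_finite)
  then have "((\<lambda>x. coeff_fun \<eta> (of_nat n) * of_real (beta_weight \<eta> x ^ n)) has_integral
     coeff_fun \<eta> (of_nat n) * of_real (Beta (real n + 1) (\<eta> * real n + 1))) {0..1}"
    by (intro has_integral_mult_right has_integral_of_real)
  also have "coeff_fun \<eta> (of_nat n) * of_real (Beta (real n + 1) (\<eta> * real n + 1)) = of_real (kernel_coeff (1 + \<eta>) n)"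
  proof -
    have "Gamma ((1 + \<eta>) * real n + 1 + 1) = ((1 + \<eta>) * real n + 1) * Gamma ((1 + \<eta>) * real n + 1)"
      using pos(2) by (intro Gamma_plus1) (auto elim!: nonpos_Ints_cases)
    moreover have "real n + 1 + (\<eta> * real n + 1) = (1 + \<eta>) * real n + 1 + 1" by (simp add: algebra_simps)
    moreover have "Gamma (real n + 1) = fact n" using Gamma_fact[of n, where ?'a = real] by (simp add: add.commute)
    moreover have "Gamma (1 + \<eta> * real n) \<noteq> 0" using Gamma_real_pos[OF pos(1)] by (simp add: add.commute)
    ultimately have "((1 + \<eta>) * real n + 1) / Gamma (1 + \<eta> * real n) * Beta (real n + 1) (\<eta> * real n + 1)
       = kernel_coeff (1 + \<eta>) n"
      using pos by (simp add: Beta_def kernel_coeff_def add.commute)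
    then show ?thesis unfolding coeff_fun_of_nat of_real_mult[symmetric] by simp
  qed
  finally show ?thesis .
qed

lemma kernel_coeff_nonneg: "0 < \<delta> \<Longrightarrow> 0 \<le> kernel_coeff \<delta> n"
  by (simp add: kernel_coeff_def add_nonneg_pos)

lemma kernel_partial_sum_bound:
  assumes \<eta>: "0 < \<eta>"
    and B: "\<And>x. x \<in> {0..1} \<Longrightarrow> norm (\<Sum>n\<in>I. coeff_fun \<eta> (of_nat n) * (z * of_real (beta_weight \<eta> x)) ^ n) \<le> B"
  shows "norm (\<Sum>n\<in>I. of_real (kernel_coeff (1 + \<eta>) n) * z ^ n) \<le> B"
proof (cases "finite I")
  case True
  have hi: "((\<lambda>x. \<Sum>n\<in>I. coeff_fun \<eta> (of_nat n) * of_real (beta_weight \<eta> x ^ n) * z ^ n) has_integral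
      (\<Sum>n\<in>I. of_real (kernel_coeff (1 + \<eta>) n) * z ^ n)) {0..1}"
    by (intro has_integral_sum True has_integral_mult_left kernel_coeff_integral \<eta>)
  have "norm (\<Sum>n\<in>I. of_real (kernel_coeff (1 + \<eta>) n) * z ^ n) \<le> B * measure lborel {0..1::real}"
  proof (rule has_integral_bound_real[OF _ _ hi])
    show "0 \<le> B" using B[of 0] norm_ge_zero order_trans by (metis atLeastAtMost_iff order_refl zero_le_one)
    show "norm (\<Sum>n\<in>I. coeff_fun \<eta> (of_nat n) * of_real (beta_weight \<eta> x ^ n) * z ^ n) \<le> B"
      if "x \<in> {0..1} - {}" for x
      using B[of x] that by (simp add: power_mult_distrib mult_ac)
  qed auto
  then show ?thesis by simp
next
  case False
  then show ?thesis using B[of 0] by simp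
qed

lemma kernel_coeff_le:
  assumes \<eta>: "0 < \<eta>" 
  shows "kernel_coeff (1 + \<eta>) n \<le> norm (coeff_fun \<eta> (of_nat n))"
proof -
  have "norm (\<Sum>k\<in>{n}. of_real (kernel_coeff (1 + \<eta>) k) * (1::complex) ^ k) \<le> norm (coeff_fun \<eta> (of_nat n))"
  proof (rule kernel_partial_sum_bound[OF \<eta>])
    fix x :: real assume x: "x \<in> {0..1}"
    have "norm (coeff_fun \<eta> (of_nat n)) * beta_weight \<eta> x ^ n \<le> norm (coeff_fun \<eta> (of_nat n)) * 1"
      using beta_weight_bounds[OF x \<eta>] by (intro mult_left_mono power_le_one) auto
    then show "norm (\<Sum>k\<in>{n}. coeff_fun \<eta> (of_nat k) * (1 * of_real (beta_weight \<eta> x)) ^ k) \<le> norm (coeff_fun \<eta> (of_nat n))"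
      using beta_weight_bounds[OF x \<eta>] by (simp add: norm_mult norm_power)
  qed
  then show ?thesis using \<eta> by (simp add: kernel_coeff_nonneg)
qed

lemma summable_kernel:
  fixes r :: real
  assumes "1 < \<delta>" "\<delta> \<le> 2"
  shows "summable (\<lambda>n. kernel_coeff \<delta> n * \<bar>r\<bar> ^ n)"
proof (rule summable_comparison_test')
  show "summable (\<lambda>n. norm (coeff_fun (\<delta> - 1) (of_nat n)) * \<bar>r\<bar> ^ n)"
    using assms by (intro summable_coeff_fun) auto
  show "norm (kernel_coeff \<delta> n * \<bar>r\<bar> ^ n) \<le> norm (coeff_fun (\<delta> - 1) (of_nat n)) * \<bar>r\<bar> ^ n" for n
    using kernel_coeff_le[of "\<delta> - 1" n] assms by (simp add: kernel_coeff_nonneg mult_right_mono)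
qed

lemma summable_kernel_complex:
  assumes "1 < \<delta>" "\<delta> \<le> 2"
  shows "summable (\<lambda>n. of_real (kernel_coeff \<delta> n) * (z::complex) ^ n)"
  using summable_kernel[OF assms, of "norm z"] assms
  by - (rule summable_norm_cancel, simp add: norm_mult norm_power kernel_coeff_nonneg)

lemma kernel_conv_radius:
  assumes "1 < \<delta>" "\<delta> \<le> 2"
  shows "fps_conv_radius (Abs_fps (\<lambda>n. complex_of_real (kernel_coeff \<delta> n))) = \<infinity>"
  unfolding fps_conv_radius_def using summable_kernel_complex[OF assms] by (intro conv_radius_inftyI'') simp

lemma kernel_sums:
  assumes "1 < \<delta>" "\<delta> \<le> 2"
  shows "(\<lambda>n. of_real (kernel_coeff \<delta> n) * z ^ n) sums approx_kernel \<delta> z"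
  using summable_sums[OF summable_kernel_complex[OF assms]] by (simp add: approx_kernel_def eval_fps_def)

lemma kernel_holomorphic:
  assumes "1 < \<delta>" "\<delta> \<le> 2"
  shows "approx_kernel \<delta> holomorphic_on S"
  unfolding approx_kernel_def using kernel_conv_radius[OF assms] by (intro holomorphic_on_eval_fps) auto

lemma kernel_higher_deriv:
  assumes "1 < \<delta>" "\<delta> \<le> 2"
  shows "(deriv ^^ n) (approx_kernel \<delta>) 0 / fact n = of_real (kernel_coeff \<delta> n)"
  using fps_nth_fps_expansion[OF eval_fps_has_fps_expansion, of "Abs_fps (\<lambda>n. of_real (kernel_coeff \<delta> n))" n]
    kernel_conv_radius[OF assms] by (simp add: approx_kernel_def)

text \<open>Multiplication by a weight \<open>t \<in> [0, 1]\<close> keeps a point in its sector and does not increase its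
  modulus, so the bound of \<open>lindelof_sector_bound\<close> passes to the averages.\<close>

lemma kernel_bound_sector:
  assumes "0 < \<epsilon>"
  shows "\<exists>B. \<forall>\<eta> l. 0 < \<eta> \<and> \<eta> \<le> 1 \<and> pi * \<eta> \<le> \<epsilon> \<and> \<bar>Im l\<bar> \<le> pi - \<epsilon> \<longrightarrow>
     norm (approx_kernel (1 + \<eta>) (- exp l)) \<le> 1 + B * exp (Re l / 2)"
proof -
  obtain B where B: "\<And>\<eta> l. 0 < \<eta> \<Longrightarrow> \<eta> \<le> 1 \<Longrightarrow> pi * \<eta> \<le> \<epsilon> \<Longrightarrow> \<bar>Im l\<bar> \<le> pi - \<epsilon> \<Longrightarrow>
     norm (\<Sum>n. coeff_fun \<eta> (of_nat n) * (- exp l) ^ n) \<le> 1 + B * exp (Re l / 2)"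
    using lindelof_sector_bound[OF assms] by blast
  have "norm (approx_kernel (1 + \<eta>) (- exp l)) \<le> 1 + \<bar>B\<bar> * exp (Re l / 2)"
    if \<eta>: "0 < \<eta>" "\<eta> \<le> 1" "pi * \<eta> \<le> \<epsilon>" and l: "\<bar>Im l\<bar> \<le> pi - \<epsilon>" for \<eta> l
  proof -
    define c where "c n = norm (coeff_fun \<eta> (of_nat n)) * norm (exp l) ^ n" for n
    have sumc: "summable c" unfolding c_def by (intro summable_coeff_fun \<eta>)
    have D: "norm (\<Sum>n. coeff_fun \<eta> (of_nat n) * (- exp l * of_real t) ^ n) \<le> 1 + \<bar>B\<bar> * exp (Re l / 2)"
      if t: "0 \<le> t" "t \<le> 1" for t :: real
    proof (cases "t = 0")
      case True
      then have "(\<Sum>n. coeff_fun \<eta> (of_nat n) * (- exp l * of_real t) ^ n) = 1"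
        by (simp add: powser_zero coeff_fun_def)
      then show ?thesis by simp
    next
      case False
      have e: "- exp l * of_real t = - exp (l + of_real (ln t))"
        using t False by (simp add: exp_add exp_of_real)
      have "norm (\<Sum>n. coeff_fun \<eta> (of_nat n) * (- exp l * of_real t) ^ n) \<le> 1 + B * exp (Re (l + of_real (ln t)) / 2)"
        unfolding e by (rule B) (use \<eta> l in auto)
      also have "\<dots> \<le> 1 + \<bar>B\<bar> * exp (Re l / 2)"
        using t False by (intro add_left_mono mult_mono) auto
      finally show ?thesis .
    qed
    have "norm (\<Sum>n<M. of_real (kernel_coeff (1 + \<eta>) n) * (- exp l) ^ n) \<le> 1 + \<bar>B\<bar> * exp (Re l / 2) + (\<Sum>n. c (n + M))" for M
    proof (rule kernel_partial_sum_bound[OF \<eta>(1)])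
      fix x :: real assume x: "x \<in> {0..1}"
      define t where "t = beta_weight \<eta> x"
      have t: "0 \<le> t" "t \<le> 1" using beta_weight_bounds[OF x \<eta>(1)] by (auto simp: t_def)
      define f where "f n = coeff_fun \<eta> (of_nat n) * (- exp l * of_real t) ^ n" for n
      have fc: "norm (f n) \<le> c n" for n
        using t mult_left_mono[of "t ^ n" 1 "c n"] by (simp add: f_def c_def norm_mult norm_power power_mult_distrib power_le_one mult_ac)
      have sumf: "summable f" using fc by (intro summable_comparison_test'[OF sumc]) auto
      have "(\<Sum>n<M. f n) = suminf f - (\<Sum>n. f (n + M))"
        using suminf_minus_initial_segment[OF sumf, of M] by simp
      then have "norm (\<Sum>n<M. f n) \<le> norm (suminf f) + norm (\<Sum>n. f (n + M))" by (simp add: norm_triangle_ineq4)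
      also have "norm (\<Sum>n. f (n + M)) \<le> (\<Sum>n. c (n + M))"
        using fc sumc by (intro norm_suminf_le) (auto simp: summable_iff_shift)
      also have "norm (suminf f) \<le> 1 + \<bar>B\<bar> * exp (Re l / 2)" using D[OF t] by (simp only: f_def[abs_def])
      finally show "norm (\<Sum>n<M. coeff_fun \<eta> (of_nat n) * (- exp l * of_real (beta_weight \<eta> x)) ^ n) \<le> 1 + \<bar>B\<bar> * exp (Re l / 2) + (\<Sum>n. c (n + M))"
        by (simp add: f_def t_def)
    qed
    moreover have "(\<lambda>M. norm (\<Sum>n<M. of_real (kernel_coeff (1 + \<eta>) n) * (- exp l) ^ n)) \<longlonglongrightarrow> norm (approx_kernel (1 + \<eta>) (- exp l))"
      using kernel_sums[of "1 + \<eta>"] \<eta> by (intro tendsto_norm) (auto simp: sums_def)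
    moreover have "(\<lambda>M. 1 + \<bar>B\<bar> * exp (Re l / 2) + (\<Sum>n. c (n + M))) \<longlonglongrightarrow> 1 + \<bar>B\<bar> * exp (Re l / 2) + 0"
      by (intro tendsto_add tendsto_const suminf_exist_split2 sumc)
    ultimately show ?thesis by (metis (no_types, lifting) LIMSEQ_le add.right_neutral)
  qed
  then show ?thesis by blast
qed

text \<open>No sector of \<open>kernel_bound_sector\<close> contains the segment \<open>(0, 1)\<close>, but near it the power series itself is bounded.\<close>

lemma kernel_bound_disc:
  assumes \<rho>: "0 \<le> \<rho>" "\<rho> < 1"
  shows "\<exists>B. \<forall>\<eta> z. 0 < \<eta> \<and> \<eta> \<le> 1 \<and> norm z \<le> \<rho> \<longrightarrow> norm (approx_kernel (1 + \<eta>) z) \<le> B"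
proof -
  define c where "c n = 2 * exp 2 * (real (Suc n) * \<rho> ^ n)" for n
  have "summable (\<lambda>n. of_nat (Suc n) * \<rho> ^ n)"
    using geometric_deriv_sums[of \<rho>] \<rho> by (intro sums_summable) auto
  then have sumc: "summable c" unfolding c_def[abs_def] by (rule summable_mult)
  have "norm (approx_kernel (1 + \<eta>) z) \<le> suminf c" if \<eta>: "0 < \<eta>" "\<eta> \<le> 1" and z: "norm z \<le> \<rho>" for \<eta> z
  proof -
    have "norm (of_real (kernel_coeff (1 + \<eta>) n) * z ^ n) \<le> c n" for n
    proof -
      have pos: "1 + \<eta> * real n > 0" using \<eta> by (simp add: add_pos_nonneg)
      have "exp (- 2) \<le> Gamma (\<eta> * real n + 1)" using power_le_Gamma[of "\<eta> * real n" 1] \<eta> by simp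
      then have "inverse (Gamma (1 + \<eta> * real n)) \<le> inverse (exp (- 2))"
        by (intro le_imp_inverse_le) (auto simp: add.commute)
      then have "((1 + \<eta>) * real n + 1) * inverse (Gamma (1 + \<eta> * real n)) \<le> (2 * real n + 1) * exp 2"
        using \<eta> pos by (intro mult_mono add_mono) (auto simp: exp_minus)
      then have "norm (coeff_fun \<eta> (of_nat n)) \<le> exp 2 * (2 * real n + 1)"
        unfolding coeff_fun_of_nat norm_of_real using \<eta> Gamma_real_pos[OF pos] by (simp add: divide_inverse mult_ac)
      also have "\<dots> \<le> 2 * exp 2 * real (Suc n)" by (simp add: algebra_simps)
      finally have "kernel_coeff (1 + \<eta>) n \<le> 2 * exp 2 * real (Suc n)" using kernel_coeff_le[OF \<eta>(1), of n] by linarith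
      then show ?thesis
        using z \<eta> mult_mono[of "kernel_coeff (1 + \<eta>) n" "2 * exp 2 * real (Suc n)" "norm z ^ n" "\<rho> ^ n"]
        by (simp add: c_def norm_mult norm_power kernel_coeff_nonneg power_mono algebra_simps)
    qed
    then have "norm (\<Sum>n. of_real (kernel_coeff (1 + \<eta>) n) * z ^ n) \<le> suminf c"
      by (intro norm_suminf_le sumc)
    then show ?thesis using kernel_sums[of "1 + \<eta>" z] \<eta> by (simp add: sums_iff)
  qed
  then show ?thesis by blast
qed

section \<open>Convergence of the kernel to the geometric series\<close>

text \<open>The Mittag-Leffler star of \<open>1 / (1 - z)\<close>.\<close>

definition slit :: "complex set" where
  "slit = - (complex_of_real ` {1..})"

lemma open_slit: "open slit"
proof -
  have "closed (complex_of_real ` {1..})"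
    by (intro closed_injective_linear_image) (auto intro: linear_of_real injI)
  then show ?thesis by (simp add: slit_def open_Compl)
qed

lemma connected_slit: "connected slit"
proof (rule starlike_imp_connected)
  have "closed_segment 0 z \<subseteq> slit" if z: "z \<in> slit" for z
  proof
    fix w assume "w \<in> closed_segment 0 z"
    then obtain t where t: "0 \<le> t" "t \<le> 1" "w = of_real t * z"
      by (auto simp: closed_segment_def scaleR_conv_of_real)
    show "w \<in> slit"
    proof (rule ccontr)
      assume "w \<notin> slit"
      then obtain x where x: "x \<ge> 1" "of_real t * z = of_real x" using t(3) by (auto simp: slit_def)
      then have "t \<noteq> 0" using t by auto
      then have zeq: "z = of_real (x / t)" using x by (simp add: field_simps)
      have "1 \<le> x / t" using x t \<open>t \<noteq> 0\<close> by (simp add: field_simps)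
      then have "z \<in> complex_of_real ` {1..}" unfolding zeq by (intro imageI) (simp only: atLeast_iff)
      then show False using z unfolding slit_def by blast
    qed
  qed
  moreover have "0 \<in> slit" by (auto simp: slit_def)
  ultimately show "starlike slit" by (auto simp: starlike_def)
qed

lemma kernel_bound_local:
  assumes z0: "z0 \<in> slit"
  shows "\<exists>U. open U \<and> z0 \<in> U \<and> (\<exists>B \<eta>0. 0 < \<eta>0 \<and> (\<forall>\<eta> z. 0 < \<eta> \<and> \<eta> < \<eta>0 \<and> z \<in> U \<longrightarrow> norm (approx_kernel (1 + \<eta>) z) \<le> B))"
proof (cases "norm z0 < 1")
  case True
  define \<rho> where "\<rho> = (norm z0 + 1) / 2"
  have \<rho>: "0 \<le> \<rho>" "\<rho> < 1" "norm z0 < \<rho>" using True by (auto simp: \<rho>_def)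
  obtain B where "\<forall>\<eta> z. 0 < \<eta> \<and> \<eta> \<le> 1 \<and> norm z \<le> \<rho> \<longrightarrow> norm (approx_kernel (1 + \<eta>) z) \<le> B"
    using kernel_bound_disc[OF \<rho>(1,2)] by blast
  then show ?thesis using \<rho> by (intro exI[of _ "ball 0 \<rho>"] conjI exI[of _ B] exI[of _ 1]) auto
next
  case False
  have nz: "- z0 \<notin> \<real>\<^sub>\<le>\<^sub>0"
  proof
    assume "- z0 \<in> \<real>\<^sub>\<le>\<^sub>0"
    then have im: "Im z0 = 0" and re: "Re z0 \<ge> 0" by (auto simp: complex_nonpos_Reals_iff)
    have z: "z0 = of_real (Re z0)" using im by (simp add: complex_eq_iff)
    then have "norm z0 = Re z0" using re by (metis abs_of_nonneg norm_of_real)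
    then show False using z z0 False by (auto simp: slit_def)
  qed
  then have z00: "z0 \<noteq> 0" by auto
  \<comment> \<open>the logarithm is taken of \<open>- z\<close>, so that the slit becomes the branch cut of \<open>Ln\<close>\<close>
  define \<epsilon> where "\<epsilon> = (pi - \<bar>Im (Ln (- z0))\<bar>) / 2"
  have "\<bar>Im (Ln (- z0))\<bar> < pi"
    using Im_Ln_less_pi[of "- z0"] mpi_less_Im_Ln[of "- z0"] nz z00 by (auto simp: abs_less_iff)
  moreover have "0 < (pi - v) / 2 \<and> v < pi - (pi - v) / 2" if "v < pi" for v
    using that by (simp add: field_simps)
  ultimately have \<epsilon>: "0 < \<epsilon>" "\<bar>Im (Ln (- z0))\<bar> < pi - \<epsilon>" unfolding \<epsilon>_def by blast+
  obtain B where B: "\<And>\<eta> l. 0 < \<eta> \<Longrightarrow> \<eta> \<le> 1 \<Longrightarrow> pi * \<eta> \<le> \<epsilon> \<Longrightarrow> \<bar>Im l\<bar> \<le> pi - \<epsilon> \<Longrightarrow>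
     norm (approx_kernel (1 + \<eta>) (- exp l)) \<le> 1 + B * exp (Re l / 2)"
    using kernel_bound_sector[OF \<epsilon>(1)] by blast
  have "isCont (\<lambda>z. \<bar>Im (Ln (- z))\<bar>) z0" using nz by (intro continuous_intros) auto
  then have "((\<lambda>z. \<bar>Im (Ln (- z))\<bar>) \<longlongrightarrow> \<bar>Im (Ln (- z0))\<bar>) (nhds z0)"
    unfolding isCont_def by (rule tendsto_at_iff_tendsto_nhds[THEN iffD1])
  then have "\<forall>\<^sub>F z in nhds z0. \<bar>Im (Ln (- z))\<bar> < pi - \<epsilon>"
    using \<epsilon>(2) by (rule order_tendstoD(2))
  moreover have "\<forall>\<^sub>F z in nhds z0. norm z < norm z0 + 1"
    by (intro order_tendstoD(2)[of _ "norm z0"] tendsto_intros filterlim_ident) auto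
  moreover have "\<forall>\<^sub>F z in nhds z0. z \<noteq> 0" using z00 by (rule t1_space_nhds)
  ultimately have "\<forall>\<^sub>F z in nhds z0. \<bar>Im (Ln (- z))\<bar> < pi - \<epsilon> \<and> norm z < norm z0 + 1 \<and> z \<noteq> 0"
    by eventually_elim auto
  then obtain U where U: "open U" "z0 \<in> U" "\<And>z. z \<in> U \<Longrightarrow> \<bar>Im (Ln (- z))\<bar> < pi - \<epsilon> \<and> norm z < norm z0 + 1 \<and> z \<noteq> 0"
    unfolding eventually_nhds by blast
  have "norm (approx_kernel (1 + \<eta>) z) \<le> 1 + \<bar>B\<bar> * (norm z0 + 2)"
    if \<eta>: "0 < \<eta>" "\<eta> < min 1 (\<epsilon> / pi)" and z: "z \<in> U" for \<eta> z
  proof -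
    define l where "l = Ln (- z)"
    have l: "- exp l = z" using U(3)[OF z] by (simp add: l_def)
    have "pi * \<eta> \<le> \<epsilon>" using \<eta>(2) by (simp add: field_simps)
    then have "norm (approx_kernel (1 + \<eta>) z) \<le> 1 + B * exp (Re l / 2)"
      using B[of \<eta> l] \<eta> U(3)[OF z] unfolding l by (simp add: l_def)
    also have "\<dots> \<le> 1 + \<bar>B\<bar> * (norm z0 + 2)"
    proof -
      have "exp (Re l) = norm z" unfolding l[symmetric] norm_minus_cancel by simp
      then have "(exp (Re l / 2))\<^sup>2 = norm z" by (simp add: power2_eq_square flip: exp_add)
      moreover have "2 * exp (Re l / 2) \<le> 1 + (exp (Re l / 2))\<^sup>2"
        using sum_squares_bound[of 1 "exp (Re l / 2)"] by simp
      moreover have "exp (Re l / 2) > 0" by simp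
      ultimately have "exp (Re l / 2) \<le> norm z0 + 2" using U(3)[OF z] by linarith
      then show ?thesis by (intro add_left_mono mult_mono) auto
    qed
    finally show ?thesis .
  qed
  then show ?thesis
    using U(1,2) \<epsilon>(1) by (intro exI[of _ U] conjI exI[of _ "1 + \<bar>B\<bar> * (norm z0 + 2)"] exI[of _ "min 1 (\<epsilon> / pi)"]) auto
qed

lemma kernel_bound_compact:
  assumes Q: "compact Q" "Q \<subseteq> slit"
  shows "\<exists>B. \<forall>\<^sub>F \<delta> in at_right 1. \<forall>z\<in>Q. norm (approx_kernel \<delta> z) \<le> B"
proof -
  have "\<forall>z0\<in>Q. \<exists>U. open U \<and> z0 \<in> U \<and> (\<exists>B. \<forall>\<^sub>F \<delta> in at_right 1. \<forall>z\<in>U. norm (approx_kernel \<delta> z) \<le> B)"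
  proof
    fix z0 assume "z0 \<in> Q"
    then obtain U B \<eta>0 where U: "open U" "z0 \<in> U" "0 < \<eta>0"
      "\<And>\<eta> z. 0 < \<eta> \<Longrightarrow> \<eta> < \<eta>0 \<Longrightarrow> z \<in> U \<Longrightarrow> norm (approx_kernel (1 + \<eta>) z) \<le> B"
      using kernel_bound_local[of z0] Q by blast
    have "\<forall>\<^sub>F \<delta> in at_right 1. \<forall>z\<in>U. norm (approx_kernel \<delta> z) \<le> B"
      unfolding eventually_at_right_field
      using U(3) U(4)[of "\<delta> - 1" for \<delta>] by (intro exI[of _ "1 + \<eta>0"]) auto
    then show "\<exists>U. open U \<and> z0 \<in> U \<and> (\<exists>B. \<forall>\<^sub>F \<delta> in at_right 1. \<forall>z\<in>U. norm (approx_kernel \<delta> z) \<le> B)"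
      using U(1,2) by blast
  qed
  from bchoice[OF this] obtain U where U: "\<forall>z0\<in>Q. open (U z0) \<and> z0 \<in> U z0 \<and> (\<exists>B. \<forall>\<^sub>F \<delta> in at_right 1. \<forall>z\<in>U z0. norm (approx_kernel \<delta> z) \<le> B)"
    by (elim exE)
  then have "\<forall>z0\<in>Q. \<exists>B. \<forall>\<^sub>F \<delta> in at_right 1. \<forall>z\<in>U z0. norm (approx_kernel \<delta> z) \<le> B" by blast
  from bchoice[OF this] obtain B where
    B: "\<And>z0. z0 \<in> Q \<Longrightarrow> \<forall>\<^sub>F \<delta> in at_right 1. \<forall>z\<in>U z0. norm (approx_kernel \<delta> z) \<le> B z0"
    by blast
  obtain I where I: "I \<subseteq> Q" "finite I" "Q \<subseteq> (\<Union>z0\<in>I. U z0)"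
    using compactE_image[OF Q(1), of Q U] U by blast
  have "\<forall>\<^sub>F \<delta> in at_right 1. \<forall>z0\<in>I. \<forall>z\<in>U z0. norm (approx_kernel \<delta> z) \<le> B z0"
    using I B by (intro eventually_ball_finite) auto
  then have "\<forall>\<^sub>F \<delta> in at_right 1. \<forall>z\<in>Q. norm (approx_kernel \<delta> z) \<le> Max (B ` I)"
  proof eventually_elim
    case (elim \<delta>)
    show ?case
    proof
      fix z assume "z \<in> Q"
      then obtain z0 where z0: "z0 \<in> I" "z \<in> U z0" using I(3) by blast
      then have "norm (approx_kernel \<delta> z) \<le> B z0" using elim by blast
      also have "\<dots> \<le> Max (B ` I)" using z0(1) I(2) by (intro Max_ge) auto
      finally show "norm (approx_kernel \<delta> z) \<le> Max (B ` I)" .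
    qed
  qed
  then show ?thesis by blast
qed

lemma kernel_coeff_tendsto: "((\<lambda>\<delta>. kernel_coeff \<delta> n) \<longlongrightarrow> 1) (at_right 1)"
proof -
  have G: "Gamma (1 * real n + 1) = fact n" using Gamma_fact[of n, where ?'a = real] by (simp add: add.commute)
  have "((\<lambda>\<delta>. fact n / Gamma (\<delta> * real n + 1)) \<longlongrightarrow> fact n / Gamma (1 * real n + 1)) (at_right 1)"
    using G by (intro tendsto_intros) (auto elim!: nonpos_Ints_cases simp: Gamma_eq_zero_iff[symmetric])
  then show ?thesis unfolding G kernel_coeff_def by simp
qed

text \<open>If uniform convergence failed along a sequence \<open>\<delta>\<^sub>n \<rightarrow> 1+\<close>, Montel's theorem would give a
  subsequence converging locally uniformly. The limit has all Taylor coefficients at 0 equal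
  to 1, hence it is \<open>1 / (1 - z)\<close>, which contradicts the failure.\<close>

theorem kernel_tendsto_geometric:
  assumes Q: "compact Q" "Q \<subseteq> slit" and e: "0 < e"
  shows "\<forall>\<^sub>F \<delta> in at_right 1. \<forall>z\<in>Q. norm (approx_kernel \<delta> z - 1 / (1 - z)) < e"
proof (rule ccontr)
  assume neg: "\<not> ?thesis"
  have "\<exists>\<delta>. \<delta> > 1 \<and> \<delta> < 1 + inverse (real (Suc n)) \<and> (\<exists>z\<in>Q. e \<le> norm (approx_kernel \<delta> z - 1 / (1 - z)))" for n
  proof (rule ccontr)
    assume "\<not> ?thesis"
    then have "\<forall>\<delta>>1. \<delta> < 1 + inverse (real (Suc n)) \<longrightarrow> (\<forall>z\<in>Q. norm (approx_kernel \<delta> z - 1 / (1 - z)) < e)"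
      by (meson not_le)
    moreover have "1 + inverse (real (Suc n)) > 1" by simp
    ultimately show False using neg unfolding eventually_at_right_field by blast
  qed
  then obtain \<delta> where \<delta>: "\<And>n. \<delta> n > 1" "\<And>n. \<delta> n < 1 + inverse (real (Suc n))"
    "\<And>n. \<exists>z\<in>Q. e \<le> norm (approx_kernel (\<delta> n) z - 1 / (1 - z))" by metis
  have "(\<lambda>n. 1 + inverse (real (Suc n))) \<longlonglongrightarrow> 1 + 0" by (intro tendsto_intros LIMSEQ_inverse_real_of_nat)
  then have "\<delta> \<longlonglongrightarrow> 1"
    using \<delta>(1,2) by (intro tendsto_sandwich[of "\<lambda>_. 1" \<delta> sequentially]) (auto intro: always_eventually less_imp_le)
  then have lim: "filterlim \<delta> (at_right 1) sequentially"
    using \<delta>(1) by (auto simp: filterlim_at intro!: always_eventually less_imp_le) (use less_irrefl in metis)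
  have d2: "\<delta> n \<le> 2" for n
  proof -
    have "inverse (real (Suc n)) \<le> 1" by (simp add: inverse_eq_divide)
    then show ?thesis using \<delta>(2)[of n] by linarith
  qed
  have hol: "approx_kernel (\<delta> n) holomorphic_on A" for n A by (rule kernel_holomorphic[OF \<delta>(1) d2])
  obtain g r where g: "g holomorphic_on slit" "strict_mono (r :: nat \<Rightarrow> nat)"
    "\<And>K. compact K \<Longrightarrow> K \<subseteq> slit \<Longrightarrow> uniform_limit K ((\<lambda>n. approx_kernel (\<delta> n)) \<circ> r) g sequentially"
  proof (rule Montel[OF open_slit, of "range (\<lambda>n. approx_kernel (\<delta> n))" "\<lambda>n. approx_kernel (\<delta> n)"])
    fix K assume K: "compact K" "K \<subseteq> slit"
    obtain B where "\<forall>\<^sub>F \<delta> in at_right 1. \<forall>z\<in>K. norm (approx_kernel \<delta> z) \<le> B" using kernel_bound_compact[OF K] by blast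
    then have "\<forall>\<^sub>F n in sequentially. \<forall>z\<in>K. norm (approx_kernel (\<delta> n) z) \<le> B"
      using lim by (rule eventually_compose_filterlim)
    then obtain M where M: "\<And>n z. M \<le> n \<Longrightarrow> z \<in> K \<Longrightarrow> norm (approx_kernel (\<delta> n) z) \<le> B"
      by (auto simp: eventually_sequentially)
    have "compact (approx_kernel (\<delta> n) ` K)" for n
      using K(1) hol by (intro compact_continuous_image holomorphic_on_imp_continuous_on)
    then have "bounded (\<Union>n<M. approx_kernel (\<delta> n) ` K)" by (intro bounded_UN) (auto intro: compact_imp_bounded)
    then obtain B' where B': "\<And>n z. n < M \<Longrightarrow> z \<in> K \<Longrightarrow> norm (approx_kernel (\<delta> n) z) \<le> B'" unfolding bounded_iff by blast
    have "norm (approx_kernel (\<delta> n) z) \<le> max B B'" if "z \<in> K" for n z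
      using M[of n z] B'[of n z] that by (cases "n < M") auto
    then show "\<exists>B. \<forall>h\<in>range (\<lambda>n. approx_kernel (\<delta> n)). \<forall>z\<in>K. norm (h z) \<le> B" by blast
  qed (use hol in auto)
  have ball_slit: "cball 0 (1/2) \<subseteq> slit" by (auto simp: slit_def)
  have lim_r: "filterlim (\<lambda>n. \<delta> (r n)) (at_right 1) sequentially"
    using filterlim_compose[OF lim filterlim_subseq[OF g(2)]] .
  have coeff: "(deriv ^^ m) g 0 = fact m" for m
  proof -
    have "(\<lambda>n. (deriv ^^ m) (((\<lambda>n. approx_kernel (\<delta> n)) \<circ> r) n) 0) \<longlonglongrightarrow> (deriv ^^ m) g 0"
    proof (rule higher_deriv_complex_uniform_limit)
      show "uniform_limit (ball 0 (1/2)) ((\<lambda>n. approx_kernel (\<delta> n)) \<circ> r) g sequentially"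
        using g(3)[OF compact_cball ball_slit] by (rule uniform_limit_on_subset) auto
    qed (auto intro!: always_eventually hol)
    moreover have "(deriv ^^ m) (((\<lambda>n. approx_kernel (\<delta> n)) \<circ> r) n) 0 = fact m * of_real (kernel_coeff (\<delta> (r n)) m)" for n
      using kernel_higher_deriv[of "\<delta> (r n)" m, OF \<delta>(1) d2] by (simp add: field_simps)
    moreover have "(\<lambda>n. fact m * complex_of_real (kernel_coeff (\<delta> (r n)) m)) \<longlonglongrightarrow> fact m * of_real 1"
      by (intro tendsto_intros filterlim_compose[OF kernel_coeff_tendsto lim_r])
    ultimately show ?thesis using LIMSEQ_unique by fastforce
  qed
  have near0: "g z = 1 / (1 - z)" if z: "z \<in> ball 0 (1/2)" for z
  proof -
    have "g holomorphic_on ball 0 (1/2)" by (rule holomorphic_on_subset[OF g(1) subset_trans[OF ball_subset_cball ball_slit]])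
    then have "(\<lambda>n. (deriv ^^ n) g 0 / fact n * (z - 0) ^ n) sums g z" by (rule holomorphic_power_series[OF _ z])
    then have "(\<lambda>n. z ^ n) sums g z" by (simp add: coeff)
    moreover have "(\<lambda>n. z ^ n) sums (1 / (1 - z))" using z by (intro geometric_sums) auto
    ultimately show ?thesis by (rule sums_unique2)
  qed
  have gz: "g z = 1 / (1 - z)" if "z \<in> slit" for z
  proof (rule analytic_continuation_open[of "ball 0 (1/2)" slit g "\<lambda>z. 1 / (1 - z)" z])
    have "1 \<notin> slit" unfolding slit_def using of_real_1 by force
    then show "(\<lambda>z. 1 / (1 - z)) holomorphic_on slit" by (intro holomorphic_intros) auto
  qed (use that near0 g(1) open_slit connected_slit ball_slit in auto)
  have "uniform_limit Q ((\<lambda>n. approx_kernel (\<delta> n)) \<circ> r) g sequentially" by (rule g(3)[OF Q])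
  then have "\<forall>\<^sub>F n in sequentially. \<forall>z\<in>Q. dist (approx_kernel (\<delta> (r n)) z) (g z) < e"
    using e by (auto simp: uniform_limit_iff)
  then obtain n where "\<forall>z\<in>Q. dist (approx_kernel (\<delta> (r n)) z) (g z) < e" by (auto simp: eventually_sequentially)
  then show False using \<delta>(3)[of "r n"] gz Q(2) by (force simp: dist_norm)
qed

section \<open>Cauchy's formula on a rectangle\<close>

lemma kernel_tail_bound:
  assumes \<delta>: "1 < \<delta>" "\<delta> \<le> 2" and z: "norm z \<le> \<rho>"
  shows "norm ((\<Sum>n<M. of_real (kernel_coeff \<delta> n) * z ^ n) - approx_kernel \<delta> z)
     \<le> (\<Sum>n. kernel_coeff \<delta> (n + M) * \<rho> ^ (n + M))"
proof -
  define f where "f n = of_real (kernel_coeff \<delta> n) * z ^ n" for n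
  have \<rho>: "\<rho> \<ge> 0" using z norm_ge_zero order_trans by blast
  have fs: "f sums approx_kernel \<delta> z" unfolding f_def[abs_def] by (rule kernel_sums[OF \<delta>])
  have "(\<Sum>n<M. f n) - approx_kernel \<delta> z = - (\<Sum>n. f (n + M))"
    using suminf_minus_initial_segment[OF sums_summable[OF fs], of M] fs by (simp add: sums_iff)
  moreover have "norm (\<Sum>n. f (n + M)) \<le> (\<Sum>n. kernel_coeff \<delta> (n + M) * \<rho> ^ (n + M))"
  proof (rule norm_suminf_le)
    show "norm (f (n + M)) \<le> kernel_coeff \<delta> (n + M) * \<rho> ^ (n + M)" for n
      using \<delta> z \<rho> by (simp add: f_def norm_mult norm_power kernel_coeff_nonneg mult_left_mono power_mono)
    have "summable (\<lambda>n. kernel_coeff \<delta> n * \<rho> ^ n)" using summable_kernel[OF \<delta>, of \<rho>] \<rho> by simp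
    then show "summable (\<lambda>n. kernel_coeff \<delta> (n + M) * \<rho> ^ (n + M))"
      using summable_iff_shift[of "\<lambda>n. kernel_coeff \<delta> n * \<rho> ^ n" M] by simp
  qed
  ultimately show ?thesis by (simp add: f_def)
qed

lemma norm_contour_integral_rectpath_le:
  assumes ab: "Re a \<le> Re b" "Im a \<le> Im b"
    and cont: "continuous_on (path_image (rectpath a b)) F" and B: "0 \<le> B"
    and bound: "\<And>x. x \<in> path_image (rectpath a b) \<Longrightarrow> norm (F x) \<le> B"
  shows "norm (contour_integral (rectpath a b) F) \<le> B * (2 * (Re b - Re a) + 2 * (Im b - Im a))"
proof -
  define c d where "c = Complex (Re b) (Im a)" and "d = Complex (Re a) (Im b)"
  note split = contour_integral_rectpath_split[OF cont, folded c_def d_def]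
  have len: "norm (c - a) = Re b - Re a" "norm (b - c) = Im b - Im a" "norm (d - b) = Re b - Re a" "norm (a - d) = Im b - Im a"
    using ab by (simp_all add: c_def d_def cmod_def)
  have "norm (contour_integral (linepath p q) F) \<le> B * norm (q - p)" if "closed_segment p q \<subseteq> path_image (rectpath a b)" for p q
    using that bound by (intro norm_contour_integral_linepath_le continuous_on_subset[OF cont] B) auto
  note side = this[OF split(2)] this[OF split(3)] this[OF split(4)] this[OF split(5)]
  have "norm (contour_integral (rectpath a b) F) \<le> norm (contour_integral (linepath a c) F) + norm (contour_integral (linepath c b) F)
      + norm (contour_integral (linepath b d) F) + norm (contour_integral (linepath d a) F)"
    unfolding split(1) by (intro norm_triangle_le order_refl add_mono)
  also have "\<dots> \<le> B * norm (c - a) + B * norm (b - c) + B * norm (d - b) + B * norm (a - d)"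
    by (intro add_mono side)
  also have "\<dots> = B * (2 * (Re b - Re a) + 2 * (Im b - Im a))" unfolding len by (simp add: algebra_simps)
  finally show ?thesis .
qed

text \<open>The sum and the value \<open>g t\<close> are integrals over the boundary of the rectangle, with the kernels
  \<open>approx_kernel \<delta> (t / \<zeta>) / \<zeta>\<close> and \<open>1 / (\<zeta> - t) = 1 / (1 - t / \<zeta>) / \<zeta>\<close>. Working with partial sums
  of the kernel makes each integral a finite combination of Cauchy's formulas. Only the
  bound \<open>M\<close> of \<open>g\<close> on the boundary enters the estimate.\<close>

lemma kernel_summation_error:
  fixes g :: "complex \<Rightarrow> complex"
  assumes W: "open W" "convex W" "cbox a b \<subseteq> W" and g: "g holomorphic_on W"
    and in_box: "0 \<in> box a b" "t \<in> box a b"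
    and \<delta>: "1 < \<delta>" "\<delta> \<le> 2"
    and M: "\<And>\<zeta>. \<zeta> \<in> path_image (rectpath a b) \<Longrightarrow> norm (g \<zeta>) \<le> M"
    and e: "\<And>\<zeta>. \<zeta> \<in> path_image (rectpath a b) \<Longrightarrow> norm (approx_kernel \<delta> (t / \<zeta>) - 1 / (1 - t / \<zeta>)) \<le> e"
    and r: "0 < r" "\<And>\<zeta>. \<zeta> \<in> path_image (rectpath a b) \<Longrightarrow> r \<le> norm \<zeta>"
    and s: "(\<lambda>n. of_real (kernel_coeff \<delta> n) * ((deriv ^^ n) g 0 / fact n) * t ^ n) sums s"
  shows "norm (s - g t) \<le> M / r * e * ((Re b - Re a) + (Im b - Im a))"
proof -
  define \<gamma> where "\<gamma> = rectpath a b"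
  have ab: "Re a \<le> Re b" "Im a \<le> Im b" using in_box by (auto simp: in_box_complex_iff)
  have img: "path_image \<gamma> = cbox a b - box a b" unfolding \<gamma>_def by (rule path_image_rectpath_cbox_minus_box[OF ab])
  have imgW: "path_image \<gamma> \<subseteq> W - {z}" if "z \<in> box a b" for z using W(3) that by (auto simp: img)
  have \<gamma>: "valid_path \<gamma>" "pathfinish \<gamma> = pathstart \<gamma>" by (simp_all add: \<gamma>_def)
  have boxW: "box a b \<subseteq> W" using W(3) box_subset_cbox by blast
  have wind: "winding_number \<gamma> z = 1" if "z \<in> box a b" for z
    using winding_number_rectpath[OF that] by (simp add: \<gamma>_def)
  have cauchy: "((\<lambda>\<zeta>. g \<zeta> / (\<zeta> - t)) has_contour_integral (2 * pi * \<i> * g t)) \<gamma>"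
    using Cauchy_integral_formula_convex_simple[OF W(2) g, of t \<gamma>] in_box(2) boxW \<gamma> imgW[OF in_box(2)] wind[OF in_box(2)]
      interior_open[OF W(1)] by auto
  have taylor: "((\<lambda>\<zeta>. g \<zeta> / \<zeta> ^ Suc n) has_contour_integral (2 * pi * \<i> * ((deriv ^^ n) g 0 / fact n))) \<gamma>" for n
  proof -
    have hol: "(\<lambda>\<zeta>. g \<zeta> / \<zeta> ^ Suc n) holomorphic_on W - {0}"
      by (intro holomorphic_intros holomorphic_on_subset[OF g]) auto
    have "contour_integral \<gamma> (\<lambda>\<zeta>. g \<zeta> / \<zeta> ^ Suc n) =
        2 * pi * \<i> * (\<Sum>p\<in>{0}. winding_number \<gamma> p * residue (\<lambda>\<zeta>. g \<zeta> / \<zeta> ^ Suc n) p)"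
    proof (rule Residue_theorem[OF W(1) convex_connected[OF W(2)] _ hol \<gamma>])
      show "\<forall>z. z \<notin> W \<longrightarrow> winding_number \<gamma> z = 0"
        using winding_number_rectpath_outside[OF ab] W(3) unfolding \<gamma>_def by blast
    qed (use imgW[OF in_box(1)] in auto)
    also have "\<dots> = 2 * pi * \<i> * ((deriv ^^ n) g 0 / fact n)"
      using residue_holomorphic_over_power'[OF W(1) _ g, of n] boxW in_box(1) wind[OF in_box(1)] by auto
    moreover have "(\<lambda>\<zeta>. g \<zeta> / \<zeta> ^ Suc n) contour_integrable_on \<gamma>"
      using hol W(1) by (intro contour_integrable_holomorphic_simple[OF _ _ \<gamma>(1) imgW[OF in_box(1)]]) auto
    ultimately show ?thesis using has_contour_integral_integral by metis
  qed
  define \<rho> where "\<rho> = norm t / r"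
  define tail where "tail K = (\<Sum>n. kernel_coeff \<delta> (n + K) * \<rho> ^ (n + K))" for K
  define P where "P K = (\<Sum>n<K. of_real (kernel_coeff \<delta> n) * ((deriv ^^ n) g 0 / fact n) * t ^ n)" for K
  have \<rho>: "\<rho> \<ge> 0" using r by (simp add: \<rho>_def)
  have a_img: "a \<in> path_image \<gamma>" by (metis \<gamma>_def pathstart_in_path_image pathstart_rectpath)
  have M0: "M \<ge> 0" using M[of a] a_img norm_ge_zero order_trans unfolding \<gamma>_def by blast
  have bound: "norm (P K - g t) \<le> M / r * (e + tail K) * ((Re b - Re a) + (Im b - Im a))" for K
  proof -
    define F where "F \<zeta> = (\<Sum>n<K. of_real (kernel_coeff \<delta> n) * t ^ n * (g \<zeta> / \<zeta> ^ Suc n)) - g \<zeta> / (\<zeta> - t)" for \<zeta>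
    have "(F has_contour_integral ((\<Sum>n<K. of_real (kernel_coeff \<delta> n) * t ^ n * (2 * pi * \<i> * ((deriv ^^ n) g 0 / fact n))) - 2 * pi * \<i> * g t)) \<gamma>"
      unfolding F_def[abs_def]
      by (intro has_contour_integral_diff has_contour_integral_sum has_contour_integral_lmul taylor cauchy finite_lessThan)
    also have "(\<Sum>n<K. of_real (kernel_coeff \<delta> n) * t ^ n * (2 * pi * \<i> * ((deriv ^^ n) g 0 / fact n))) - 2 * pi * \<i> * g t
        = 2 * pi * \<i> * (P K - g t)"
      by (simp add: P_def right_diff_distrib sum_distrib_left mult_ac)
    finally have int: "contour_integral \<gamma> F = 2 * pi * \<i> * (P K - g t)" by (rule contour_integral_unique)
    have Fb: "norm (F \<zeta>) \<le> M / r * (e + tail K)" if \<zeta>: "\<zeta> \<in> path_image \<gamma>" for \<zeta>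
    proof -
      have nz: "\<zeta> \<noteq> 0" "\<zeta> \<noteq> t" using imgW[OF in_box(1)] imgW[OF in_box(2)] \<zeta> by auto
      have r\<zeta>: "r \<le> norm \<zeta>" using r(2) \<zeta> by (simp add: \<gamma>_def)
      have "F \<zeta> = g \<zeta> / \<zeta> * ((\<Sum>n<K. of_real (kernel_coeff \<delta> n) * (t / \<zeta>) ^ n) - 1 / (1 - t / \<zeta>))"
        using nz by (simp add: F_def sum_distrib_left right_diff_distrib power_divide field_simps)
      also have "\<dots> = g \<zeta> / \<zeta> * (((\<Sum>n<K. of_real (kernel_coeff \<delta> n) * (t / \<zeta>) ^ n) - approx_kernel \<delta> (t / \<zeta>))
          + (approx_kernel \<delta> (t / \<zeta>) - 1 / (1 - t / \<zeta>)))" by simp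
      also have "norm \<dots> \<le> M / r * (tail K + e)"
        unfolding norm_mult
      proof (rule mult_mono)
        show "norm (g \<zeta> / \<zeta>) \<le> M / r"
          unfolding norm_divide using M[of \<zeta>] M0 \<zeta> r r\<zeta> by (intro frac_le) (auto simp: \<gamma>_def)
        have "norm (t / \<zeta>) \<le> \<rho>" using r\<zeta> r(1) nz by (simp add: norm_divide \<rho>_def frac_le)
        then show "norm ((\<Sum>n<K. of_real (kernel_coeff \<delta> n) * (t / \<zeta>) ^ n) - approx_kernel \<delta> (t / \<zeta>)
          + (approx_kernel \<delta> (t / \<zeta>) - 1 / (1 - t / \<zeta>))) \<le> tail K + e"
          unfolding tail_def using e[of \<zeta>] \<zeta>
          by (intro norm_triangle_le add_mono kernel_tail_bound \<delta>) (auto simp: \<gamma>_def)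
      qed (use M0 r in auto)
      finally show ?thesis by (simp add: add.commute)
    qed
    have "continuous_on (path_image \<gamma>) F"
      unfolding F_def using imgW[OF in_box(1)] imgW[OF in_box(2)]
      by (intro continuous_intros holomorphic_on_imp_continuous_on[OF holomorphic_on_subset[OF g]]) auto
    moreover have "0 \<le> M / r * (e + tail K)" using Fb[OF a_img] norm_ge_zero order_trans by blast
    ultimately have "norm (contour_integral \<gamma> F) \<le> M / r * (e + tail K) * (2 * (Re b - Re a) + 2 * (Im b - Im a))"
      unfolding \<gamma>_def using Fb by (intro norm_contour_integral_rectpath_le ab) (auto simp: \<gamma>_def)
    moreover have "norm (contour_integral \<gamma> F) = 2 * pi * norm (P K - g t)" unfolding int by (simp add: norm_mult)
    moreover have "X * (2 * p + 2 * q) = 2 * (X * (p + q))" for X p q :: real by (simp add: algebra_simps)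
    ultimately have *: "2 * pi * norm (P K - g t) \<le> 2 * (M / r * (e + tail K) * ((Re b - Re a) + (Im b - Im a)))"
      by metis
    have "2 * norm (P K - g t) \<le> 2 * pi * norm (P K - g t)"
      using pi_gt3 by (intro mult_right_mono) auto
    then show ?thesis using * by linarith
  qed
  have "(\<lambda>K. norm (P K - g t)) \<longlonglongrightarrow> norm (s - g t)"
    using s unfolding sums_def P_def by (intro tendsto_intros)
  moreover have "tail \<longlonglongrightarrow> 0"
    unfolding tail_def using summable_kernel[OF \<delta>, of \<rho>] \<rho> by (intro suminf_exist_split2) simp
  then have "(\<lambda>K. M / r * (e + tail K) * ((Re b - Re a) + (Im b - Im a))) \<longlonglongrightarrow> M / r * (e + 0) * ((Re b - Re a) + (Im b - Im a))"
    by (intro tendsto_intros)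
  ultimately have "norm (s - g t) \<le> M / r * (e + 0) * ((Re b - Re a) + (Im b - Im a))"
    using bound by (intro LIMSEQ_le) blast+
  then show ?thesis by simp
qed

section \<open>Summation of vector-valued power series\<close>

context complex_normed_subspace begin

lemma norm_sum_le:
  "(\<And>i. i \<in> I \<Longrightarrow> a i \<in> S) \<Longrightarrow> N (sum a I) \<le> (\<Sum>i\<in>I. N (a i))"
proof (induction I rule: infinite_finite_induct)
  case (insert i I)
  then have "N (a i + sum a I) \<le> N (a i) + N (sum a I)"
    by (intro norm_triangle subspace_sum[OF subspace_carrier]) auto
  then show ?case using insert by simp
qed (use norm_eq_zero[OF zero_in] in auto)

lemma norm_diff_le: "x \<in> S \<Longrightarrow> y \<in> S \<Longrightarrow> N (x - y) \<le> N x + N y"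
  using norm_triangle[of x "- y"] norm_minus neg_in by simp

lemma norm_sums_unique:
  assumes "norm_sums S N a s" "norm_sums S N a s'"
  shows "s = s'"
  using assms unfolding norm_sums_def norm_topology_def by (rule limitin_metric_unique) simp

lemma contraction_norm_sums:
  assumes f: "contraction f" and a: "\<And>n. a n \<in> S" and s: "norm_sums S N a s"
  shows "(\<lambda>n. f (a n)) sums f s"
  using contraction_limitin[OF f s[unfolded norm_sums_def]] contraction_sum[OF f, of _ a] a
  by (simp add: sums_def)

lemma norm_sums_terms_bounded:
  assumes a: "\<And>n. a n \<in> S" and s: "norm_sums S N a s"
  shows "\<exists>M. \<forall>n. N (a n) \<le> M"
proof -
  define p where "p n = (\<Sum>k<n. a k)" for n
  have p: "p n \<in> S" for n unfolding p_def using a by (intro subspace_sum[OF subspace_carrier])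
  have "s \<in> S" "\<forall>\<^sub>F n in sequentially. p n \<in> S \<and> N (p n - s) < 1"
    using s by (auto simp: norm_sums_def limitin_norm_topology p_def)
  then obtain n0 where sS: "s \<in> S" and n0: "\<And>n. n \<ge> n0 \<Longrightarrow> N (p n - s) < 1" by (auto simp: eventually_sequentially)
  have late: "N (a n) \<le> 2" if "n \<ge> n0" for n
  proof -
    have "a n = (p (Suc n) - s) - (p n - s)" by (simp add: p_def)
    then have "N (a n) \<le> N (p (Suc n) - s) + N (p n - s)" using p sS diff_in norm_diff_le by metis
    then show ?thesis using n0[of n] n0[of "Suc n"] that by simp
  qed
  have "N (a n) \<le> max 2 (Max ((\<lambda>n. N (a n)) ` {..n0}))" for n
  proof (cases "n \<ge> n0")
    case False
    then have "N (a n) \<le> Max ((\<lambda>n. N (a n)) ` {..n0})" by (intro Max_ge) auto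
    then show ?thesis by simp
  qed (use late in fastforce)
  then show ?thesis by blast
qed

text \<open>The difference quotient at \<open>z\<close> converges, so it is bounded near \<open>z\<close>.\<close>

lemma vholomorphic_locally_bounded:
  assumes u: "vholomorphic_on scaleC S N u G" and G: "open G" and z: "z \<in> G"
  shows "\<exists>U B. open U \<and> z \<in> U \<and> (\<forall>w\<in>U. w \<in> G \<and> N (u w) \<le> B)"
proof -
  obtain D where D: "limitin (norm_topology S N) (\<lambda>w. scaleC (inverse (w - z)) (u w - u z)) D (at z within G)"
    using u z by (auto simp: vholomorphic_on_def)
  have uS: "u w \<in> S" if "w \<in> G" for w using u that by (auto simp: vholomorphic_on_def)
  have "limitin (norm_topology S N) (\<lambda>w. scaleC (inverse (w - z)) (u w - u z)) D (at z)"
    using D at_within_open[OF z G] by simp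
  then have DS: "D \<in> S" and "\<forall>\<^sub>F w in at z. scaleC (inverse (w - z)) (u w - u z) \<in> S \<and> N (scaleC (inverse (w - z)) (u w - u z) - D) < 1"
    unfolding limitin_norm_topology using zero_less_one by blast+
  note ev = this(2)
  have "\<forall>\<^sub>F w in at z. w \<in> G" by (rule eventually_at_in_open'[OF G z])
  moreover have "\<forall>\<^sub>F w in at z. norm (w - z) < 1"
    unfolding eventually_at by (intro exI[of _ 1]) (auto simp: dist_norm)
  moreover have "\<forall>\<^sub>F w in at z. w \<noteq> z" by (simp add: eventually_at_filter)
  ultimately have "\<forall>\<^sub>F w in at z. w \<in> G \<and> N (u w) \<le> N (u z) + (1 + N D)"
    using ev
  proof eventually_elim
    case (elim w)
    define q where "q = scaleC (inverse (w - z)) (u w - u z)"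
    have qS: "q \<in> S" unfolding q_def using uS[OF elim(1)] uS[OF z] by (intro scale_in diff_in)
    have "N q \<le> N (q - D) + N D" using norm_triangle[of "q - D" D] qS DS diff_in by simp
    then have q: "N q \<le> 1 + N D" using elim(4) by (simp add: q_def)
    have "u w = u z + scaleC (w - z) q" using elim(3) by (simp add: q_def)
    then have "N (u w) \<le> N (u z) + norm (w - z) * N q"
      using norm_triangle[of "u z" "scaleC (w - z) q"] uS[OF z] qS scale_in norm_scale by simp
    also have "\<dots> \<le> N (u z) + 1 * N q"
      using elim(2) qS norm_nonneg by (intro add_left_mono mult_right_mono) auto
    finally show ?case using q elim(1) by simp
  qed
  then have "\<forall>\<^sub>F w in nhds z. w \<in> G \<and> N (u w) \<le> N (u z) + (1 + N D)"
    unfolding eventually_at_filter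
    using z norm_nonneg[OF DS] by (auto elim!: eventually_mono)
  then show ?thesis unfolding eventually_nhds by blast
qed

lemma vholomorphic_bounded_on_compact:
  assumes u: "vholomorphic_on scaleC S N u G" and G: "open G" and K: "compact K" "K \<subseteq> G"
  shows "\<exists>M. \<forall>z\<in>K. N (u z) \<le> M"
proof -
  have "\<forall>z\<in>K. \<exists>U. open U \<and> z \<in> U \<and> (\<exists>B. \<forall>w\<in>U. N (u w) \<le> B)"
  proof
    fix z assume "z \<in> K"
    then have "z \<in> G" using K(2) by auto
    from vholomorphic_locally_bounded[OF u G this]
    obtain U B where U: "open U" "z \<in> U" "\<forall>w\<in>U. w \<in> G \<and> N (u w) \<le> B" by (elim exE conjE)
    show "\<exists>U. open U \<and> z \<in> U \<and> (\<exists>B. \<forall>w\<in>U. N (u w) \<le> B)"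
      using U by (intro exI[of _ U] conjI exI[of _ B]) auto
  qed
  from bchoice[OF this] obtain U where U: "\<forall>z\<in>K. open (U z) \<and> z \<in> U z \<and> (\<exists>B. \<forall>w\<in>U z. N (u w) \<le> B)"
    by (elim exE)
  have "\<forall>z\<in>K. \<exists>B. \<forall>w\<in>U z. N (u w) \<le> B" using U by (intro ballI) simp
  from bchoice[OF this] obtain B where B: "\<forall>z\<in>K. \<forall>w\<in>U z. N (u w) \<le> B z" by (elim exE)
  obtain I where I: "I \<subseteq> K" "finite I" "K \<subseteq> (\<Union>z\<in>I. U z)"
    using compactE_image[OF K(1), of K U] U by blast
  have "N (u w) \<le> Max (B ` I)" if w: "w \<in> K" for w
  proof -
    obtain z where z: "z \<in> I" "w \<in> U z" using I(3) w by blast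
    then have "N (u w) \<le> B z" using B I(1) by blast
    also have "\<dots> \<le> Max (B ` I)" using z I(2) by (intro Max_ge) auto
    finally show ?thesis .
  qed
  then show ?thesis by blast
qed

end

context complex_banach_subspace begin

lemma norm_summable_imp_norm_sums:
  assumes a: "\<And>n. a n \<in> S" and summ: "summable (\<lambda>n. N (a n))"
  shows "\<exists>s. norm_sums S N a s"
proof -
  define p where "p n = (\<Sum>k<n. a k)" for n
  have p: "p n \<in> S" for n unfolding p_def using a by (intro subspace_sum[OF subspace_carrier])
  have "MCauchy p"
    unfolding MCauchy_def
  proof (intro conjI allI impI)
    show "range p \<subseteq> S" using p by auto
    fix e :: real assume e: "e > 0"
    obtain n0 where n0: "\<And>m n. m \<ge> n0 \<Longrightarrow> norm (sum (\<lambda>n. N (a n)) {m..<n}) < e"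
      using summ e unfolding summable_Cauchy by blast
    have main: "N (p n - p m) < e" if "n0 \<le> m" "m \<le> n" for m n
    proof -
      have "p n - p m = sum a {m..<n}"
        using that(2) by (simp add: p_def sum_diff_nat_ivl flip: atLeast0LessThan)
      then have "N (p n - p m) \<le> (\<Sum>k=m..<n. N (a k))" using norm_sum_le[of "{m..<n}" a] a by simp
      also have "\<dots> < e" using n0[OF that(1), of n] by (simp add: abs_less_iff)
      finally show ?thesis .
    qed
    have "norm_dist S N (p m) (p n) < e" if "n0 \<le> m" "n0 \<le> n" for m n
    proof (cases "m \<le> n")
      case True
      then show ?thesis using main[OF that(1)] commute[of "p m" "p n"] p by (simp add: norm_dist_def)
    next
      case False
      then show ?thesis using main[OF that(2), of m] p by (simp add: norm_dist_def)
    qed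
    then show "\<exists>n0. \<forall>n n'. n0 \<le> n \<longrightarrow> n0 \<le> n' \<longrightarrow> norm_dist S N (p n) (p n') < e" by blast
  qed
  then obtain s where "limitin mtopology p s sequentially" using complete unfolding mcomplete_def by blast
  then show ?thesis unfolding norm_sums_def norm_topology_def p_def[abs_def] by (rule exI)
qed

text \<open>Convergence of the local series at \<open>T / 2\<close> bounds \<open>N (a n)\<close> by \<open>M * fact n / (T / 2) ^ n\<close>, and
  \<open>kernel_coeff\<close> decays superexponentially.\<close>

lemma norm_sums_fractional:
  assumes a: "\<And>n. a n \<in> S" and T: "0 < T"
    and u: "\<And>t. cmod t < T \<Longrightarrow> norm_sums S N (\<lambda>n. scaleC (t ^ n / fact n) (a n)) (u t)"
    and \<delta>: "1 < \<delta>" "\<delta> \<le> 2"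
  shows "norm_sums S N (\<lambda>n. scaleC (t ^ n / of_real (Gamma (\<delta> * real n + 1))) (a n))
     (norm_suminf S N (\<lambda>n. scaleC (t ^ n / of_real (Gamma (\<delta> * real n + 1))) (a n)))"
proof -
  define R where "R = T / 2"
  have R: "0 < R" "cmod (of_real R) < T" using T by (auto simp: R_def)
  obtain M where M: "\<And>n. N (scaleC (of_real R ^ n / fact n) (a n)) \<le> M"
    using norm_sums_terms_bounded[OF _ u[OF R(2)]] a scale_in by blast
  define b where "b n = scaleC (t ^ n / of_real (Gamma (\<delta> * real n + 1))) (a n)" for n
  have pos: "Gamma (\<delta> * real n + 1) > 0" for n
    using \<delta> by (intro Gamma_real_pos) (simp add: add_nonneg_pos)
  have bound: "N (b n) \<le> M * (kernel_coeff \<delta> n * \<bar>cmod t / R\<bar> ^ n)" for n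
  proof -
    have "N (b n) = kernel_coeff \<delta> n * \<bar>cmod t / R\<bar> ^ n * N (scaleC (of_real R ^ n / fact n) (a n))"
      using pos[of n] R a
      by (simp add: b_def norm_scale norm_divide norm_power kernel_coeff_def power_divide)
    also have "\<dots> \<le> kernel_coeff \<delta> n * \<bar>cmod t / R\<bar> ^ n * M"
      using M \<delta> by (intro mult_left_mono) (auto simp: kernel_coeff_nonneg)
    finally show ?thesis by (simp add: mult_ac)
  qed
  have bS: "b n \<in> S" for n unfolding b_def using a by (rule scale_in)
  have "summable (\<lambda>n. M * (kernel_coeff \<delta> n * \<bar>cmod t / R\<bar> ^ n))"
    by (intro summable_mult summable_kernel \<delta>)
  then have "summable (\<lambda>n. N (b n))"
    by (rule summable_comparison_test') (use bound norm_nonneg[OF bS] in simp)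
  from norm_summable_imp_norm_sums[OF bS this] obtain s where s: "norm_sums S N b s" by blast
  then have "norm_suminf S N b = s"
    unfolding norm_suminf_def by (rule the_equality) (rule norm_sums_unique[OF _ s])
  then show ?thesis using s by (simp add: b_def[abs_def])
qed

text \<open>After a rotation \<open>w\<close> that makes \<open>t0\<close> a nonnegative real number \<open>r0\<close>, the segment \<open>[0, r0]\<close> is enclosed by
  a rectangle inside the rotated star. For \<open>s\<close> near \<open>r0\<close> and \<open>\<zeta>\<close> on its boundary, \<open>s / \<zeta>\<close> avoids
  \<open>[1, \<infinity>)\<close>: otherwise \<open>\<zeta>\<close> would lie on \<open>[0, s]\<close>, in the interior. The kernel error is therefore uniformly
  small, and the scalar estimate is applied to \<open>f \<circ> u\<close> for a functional \<open>f\<close> that norms the error at \<open>t\<close>.\<close>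

lemma fractional_sum_local_convergence:
  assumes a: "\<And>n. a n \<in> S" and T: "0 < T"
    and u: "\<And>t. cmod t < T \<Longrightarrow> norm_sums S N (\<lambda>n. scaleC (t ^ n / fact n) (a n)) (u t)"
    and hol: "vholomorphic_on scaleC S N u (mittag_leffler_star scaleC S N u)"
    and t0: "t0 \<in> mittag_leffler_star scaleC S N u"
  defines "V \<equiv> \<lambda>\<delta> t. norm_suminf S N (\<lambda>n. scaleC (t ^ n / of_real (Gamma (\<delta> * real n + 1))) (a n))"
  shows "\<exists>U. open U \<and> t0 \<in> U \<and> (\<forall>\<epsilon>>0. \<forall>\<^sub>F \<delta> in at_right 1. \<forall>t\<in>U. V \<delta> t \<in> S \<and> N (V \<delta> t - u t) < \<epsilon>)"
proof -
  define G where "G = mittag_leffler_star scaleC S N u"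
  have G: "open G" unfolding G_def by (rule open_star)
  define r0 where "r0 = cmod t0"
  define w where "w = (if t0 = 0 then 1 else sgn t0)"
  have w: "cmod w = 1" "t0 = w * of_real r0"
    by (simp_all add: w_def r0_def norm_sgn) (simp add: sgn_eq)
  then have w0: "w \<noteq> 0" by auto
  have r0: "r0 \<ge> 0" by (simp add: r0_def)
  define G' where "G' = (*) w -` G"
  have "open G'" unfolding G'_def by (intro open_vimage G continuous_intros)
  moreover have "closed_segment 0 (complex_of_real r0) \<subseteq> G'"
  proof
    fix p assume "p \<in> closed_segment 0 (complex_of_real r0)"
    then obtain q where q: "0 \<le> q" "q \<le> 1" "p = of_real q * of_real r0"
      by (auto simp: closed_segment_def scaleR_conv_of_real)
    have "w * p = of_real q * t0" using q(3) w(2) by (simp add: mult_ac)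
    then show "p \<in> G'" using star_radial[OF t0 q(1,2)] by (simp add: G'_def G_def)
  qed
  ultimately obtain e where e: "e > 0" "(\<Union>x\<in>closed_segment 0 (complex_of_real r0). ball x e) \<subseteq> G'"
    using compact_subset_open_imp_ball_epsilon_subset[OF compact_segment] by metis
  define h where "h = e / 4"
  have h: "h > 0" using e by (simp add: h_def)
  define W where "W = box (Complex (- 2 * h) (- 2 * h)) (Complex (r0 + 2 * h) (2 * h))"
  have W: "open W" "convex W" by (simp_all add: W_def open_box convex_box)
  have WG': "W \<subseteq> G'"
  proof
    fix z assume "z \<in> W"
    then have z: "- 2 * h < Re z" "Re z < r0 + 2 * h" "\<bar>Im z\<bar> < 2 * h" by (auto simp: W_def in_box_complex_iff)
    define x where "x = max 0 (min r0 (Re z))"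
    have x: "0 \<le> x" "x \<le> r0" "\<bar>Re z - x\<bar> < 2 * h" using z r0 h by (auto simp: x_def)
    have "complex_of_real x \<in> closed_segment 0 (of_real r0)"
      using x r0 closed_segment_of_real[of 0 r0] by (auto simp: closed_segment_eq_real_ivl)
    moreover have "dist (complex_of_real x) z < e"
    proof -
      have "cmod (z - of_real x) \<le> \<bar>Re z - x\<bar> + \<bar>Im z\<bar>" using cmod_le[of "z - of_real x"] by simp
      then show ?thesis using x z by (simp add: dist_norm norm_minus_commute h_def)
    qed
    ultimately have "z \<in> (\<Union>x\<in>closed_segment 0 (complex_of_real r0). ball x e)"
      by (intro UN_I[of "complex_of_real x"]) (simp_all only: mem_ball)
    then show "z \<in> G'" using e(2) by (rule rev_subsetD)
  qed
  define p q where "p = Complex (- h) (- h)" and "q = Complex (r0 + h) h"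
  define \<Gamma> where "\<Gamma> = path_image (rectpath p q)"
  have pq: "Re p \<le> Re q" "Im p \<le> Im q" using h r0 by (auto simp: p_def q_def)
  have \<Gamma>: "\<Gamma> = cbox p q - box p q" unfolding \<Gamma>_def by (rule path_image_rectpath_cbox_minus_box[OF pq])
  have pqW: "cbox p q \<subseteq> W" using h by (auto simp: W_def p_def q_def in_cbox_complex_iff in_box_complex_iff)
  have zero_in_box: "0 \<in> box p q" using h r0 by (auto simp: p_def q_def in_box_complex_iff)
  have far: "h \<le> cmod \<zeta>" if "\<zeta> \<in> \<Gamma>" for \<zeta>
  proof -
    have "h \<le> \<bar>Re \<zeta>\<bar> \<or> h \<le> \<bar>Im \<zeta>\<bar>"
      using that h r0 unfolding \<Gamma>_def path_image_rectpath[OF pq] by (auto simp: p_def q_def)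
    then show ?thesis using abs_Re_le_cmod[of \<zeta>] abs_Im_le_cmod[of \<zeta>] by linarith
  qed
  define K0 where "K0 = cball (complex_of_real r0) (h / 2)"
  have K0_box: "K0 \<subseteq> box p q"
  proof
    fix z assume "z \<in> K0"
    then have z: "cmod (z - of_real r0) \<le> h / 2" by (simp add: K0_def dist_norm norm_minus_commute)
    then have "\<bar>Re z - r0\<bar> \<le> h / 2" "\<bar>Im z\<bar> \<le> h / 2"
      using abs_Re_le_cmod[of "z - of_real r0"] abs_Im_le_cmod[of "z - of_real r0"] by simp_all
    then have "- h < Re z" "Re z < r0 + h" "- h < Im z" "Im z < h" using h r0 by linarith+
    then show "z \<in> box p q" by (simp add: p_def q_def in_box_complex_iff)
  qed
  define Q where "Q = (\<lambda>(s, \<zeta>). s / \<zeta>) ` (K0 \<times> \<Gamma>)"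
  have comp\<Gamma>: "compact \<Gamma>" unfolding \<Gamma>_def by (intro compact_path_image path_rectpath)
  have "compact Q"
    unfolding Q_def
  proof (rule compact_continuous_image)
    show "continuous_on (K0 \<times> \<Gamma>) (\<lambda>(s, \<zeta>). s / \<zeta>)"
      using far[of 0] h by (auto simp: case_prod_unfold intro!: continuous_intros)
    show "compact (K0 \<times> \<Gamma>)" using comp\<Gamma> by (intro compact_Times) (simp_all add: K0_def)
  qed
  have "Q \<subseteq> slit"
  proof
    fix z assume "z \<in> Q"
    then obtain s \<zeta> where s\<zeta>: "s \<in> K0" "\<zeta> \<in> \<Gamma>" "z = s / \<zeta>" by (auto simp: Q_def)
    show "z \<in> slit"
    proof (rule ccontr)
      assume "z \<notin> slit"
      then obtain x where x: "1 \<le> x" "s / \<zeta> = of_real x" using s\<zeta>(3) by (auto simp: slit_def)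
      have \<zeta>0: "\<zeta> \<noteq> 0" using far[OF s\<zeta>(2)] h by auto
      have "\<zeta> = (1 - 1 / x) *\<^sub>R 0 + (1 / x) *\<^sub>R s"
        using x \<zeta>0 by (simp add: scaleR_conv_of_real field_simps)
      moreover have "(1 - 1 / x) *\<^sub>R 0 + (1 / x) *\<^sub>R s \<in> box p q"
        using x zero_in_box K0_box s\<zeta>(1) by (intro convexD[OF convex_box(2)]) auto
      ultimately show False using s\<zeta>(2) by (simp add: \<Gamma>)
    qed
  qed
  have sub: "(*) w ` \<Gamma> \<subseteq> G" using pqW WG' by (auto simp: \<Gamma> G'_def)
  have comp: "compact ((*) w ` \<Gamma>)" by (intro compact_continuous_image comp\<Gamma> continuous_intros)
  from vholomorphic_bounded_on_compact[OF hol[folded G_def] G comp sub]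
  obtain M where "\<forall>z\<in>(*) w ` \<Gamma>. N (u z) \<le> M" by (elim exE)
  then have M: "\<And>\<zeta>. \<zeta> \<in> \<Gamma> \<Longrightarrow> N (u (w * \<zeta>)) \<le> M" by simp
  define L where "L = (Re q - Re p) + (Im q - Im p)"
  have L: "L \<ge> 0" using pq by (simp add: L_def)
  have uS: "u z \<in> S" if "z \<in> G" for z using hol that by (auto simp: vholomorphic_on_def G_def)
  define U where "U = ball t0 (h / 2)"
  have "\<forall>\<^sub>F \<delta> in at_right 1. \<forall>t\<in>U. V \<delta> t \<in> S \<and> N (V \<delta> t - u t) < \<epsilon>" if \<epsilon>: "\<epsilon> > 0" for \<epsilon>
  proof -
    \<comment> \<open>chosen so that the bound \<open>\<bar>M\<bar> / h * \<kappa> * L\<close> of \<open>kernel_summation_error\<close> is below \<open>\<epsilon>\<close>\<close>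
    define \<kappa> where "\<kappa> = \<epsilon> * h / ((\<bar>M\<bar> + 1) * (L + 1))"
    have \<kappa>: "\<kappa> > 0" using \<epsilon> h L by (simp add: \<kappa>_def add_nonneg_pos)
    have small: "\<bar>M\<bar> / h * \<kappa> * L < \<epsilon>"
    proof -
      have "\<bar>M\<bar> * L < (\<bar>M\<bar> + 1) * (L + 1)" using L by (simp add: algebra_simps add_nonneg_pos)
      then have "\<epsilon> * (\<bar>M\<bar> * L) < \<epsilon> * ((\<bar>M\<bar> + 1) * (L + 1))" using \<epsilon> by simp
      moreover have "\<bar>M\<bar> / h * \<kappa> * L = \<epsilon> * (\<bar>M\<bar> * L) / ((\<bar>M\<bar> + 1) * (L + 1))"
        using h by (simp add: \<kappa>_def)
      moreover have "(\<bar>M\<bar> + 1) * (L + 1) > 0" using L by (intro mult_pos_pos) auto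
      ultimately show ?thesis by (simp add: pos_divide_less_eq)
    qed
    have "\<forall>\<^sub>F \<delta> in at_right 1. \<forall>z\<in>Q. norm (approx_kernel \<delta> z - 1 / (1 - z)) < \<kappa>"
      by (rule kernel_tendsto_geometric) fact+
    moreover have "\<forall>\<^sub>F \<delta> in at_right 1. (1::real) < \<delta> \<and> \<delta> \<le> 2"
      unfolding eventually_at_right_field by (intro exI[of _ 2]) auto
    ultimately show ?thesis
    proof eventually_elim
      case (elim \<delta>)
      then have \<delta>: "1 < \<delta>" "\<delta> \<le> 2" by auto
      show ?case
      proof (intro ballI conjI)
        fix t assume t: "t \<in> U"
        define s where "s = t / w"
        have ts: "t = w * s" using w0 by (simp add: s_def)
        have "cmod (t - t0) = cmod (w * (s - of_real r0))" using ts w(2) by (simp add: right_diff_distrib)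
        then have "cmod (s - of_real r0) = cmod (t - t0)" by (simp add: norm_mult w(1))
        then have sK0: "s \<in> K0" using t by (simp add: K0_def U_def dist_norm norm_minus_commute)
        then have s_box: "s \<in> box p q" using K0_box by blast
        then have "s \<in> W" using pqW box_subset_cbox by blast
        then have tG: "t \<in> G" using WG' ts by (auto simp: G'_def)
        have Vs: "norm_sums S N (\<lambda>n. scaleC (t ^ n / of_real (Gamma (\<delta> * real n + 1))) (a n)) (V \<delta> t)"
          unfolding V_def by (rule norm_sums_fractional[OF a T u \<delta>])
        then show VS: "V \<delta> t \<in> S" by (auto simp: norm_sums_def limitin_norm_topology)
        have xS: "V \<delta> t - u t \<in> S" using VS uS[OF tG] diff_in by blast
        obtain f where f: "contraction f" "f (V \<delta> t - u t) = of_real (N (V \<delta> t - u t))"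
          using hahn_banach_norming[OF xS] by blast
        define g where "g z = f (u (w * z))" for z
        have "((\<lambda>z. f (u z)) \<circ> (*) w) holomorphic_on W"
          using WG' by (intro holomorphic_on_compose_gen[OF _ contraction_holomorphic[OF f(1) hol[folded G_def]]])
            (auto simp: G'_def intro!: holomorphic_intros)
        then have g: "g holomorphic_on W" by (simp add: g_def[abs_def] o_def)
        have gsum: "(\<lambda>n. (w ^ n * f (a n) / fact n) * z ^ n) sums g z" if "cmod z < T" for z
        proof -
          have "cmod (w * z) < T" using that by (simp add: norm_mult w(1))
          from contraction_norm_sums[OF f(1) _ u[OF this]] 
          have "(\<lambda>n. f (scaleC ((w * z) ^ n / fact n) (a n))) sums f (u (w * z))" using a scale_in by blast
          then show ?thesis using a by (simp add: g_def contraction_scale[OF f(1)] power_mult_distrib mult_ac)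
        qed
        have taylor: "(deriv ^^ n) g 0 / fact n = w ^ n * f (a n) / fact n" for n
        proof -
          define c where "c n = w ^ n * f (a n) / fact n" for n
          have half: "cmod (complex_of_real (T / 2)) = T / 2" "cmod (of_real (T / 2)) < T" using T by auto
          have "summable (\<lambda>n. c n * of_real (T / 2) ^ n)"
            unfolding c_def by (rule sums_summable[OF gsum[OF half(2)]])
          then have le: "ereal (cmod (complex_of_real (T / 2))) \<le> conv_radius c" by (rule conv_radius_geI)
          have "0 < ereal (T / 2)" using T by simp
          also have "\<dots> \<le> conv_radius c" using le unfolding half(1) .
          finally have "0 < conv_radius c" .
          moreover have "\<forall>\<^sub>F z in nhds 0. eval_fps (Abs_fps c) z = g z"
          proof -
            have "\<forall>\<^sub>F z in nhds 0. z \<in> ball (0::complex) T" using T by (intro eventually_nhds_in_open) auto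
            then show ?thesis
            proof eventually_elim
              case (elim z)
              then show ?case using gsum[of z] by (simp add: eval_fps_def c_def sums_iff)
            qed
          qed
          ultimately have "g has_fps_expansion Abs_fps c" by (simp add: has_fps_expansion_def fps_conv_radius_def)
          from fps_nth_fps_expansion[OF this, of n] show ?thesis by (simp add: c_def)
        qed
        have "(\<lambda>n. f (scaleC (t ^ n / of_real (Gamma (\<delta> * real n + 1))) (a n))) sums f (V \<delta> t)"
          by (rule contraction_norm_sums[OF f(1) _ Vs]) (use a scale_in in blast)
        moreover have "f (scaleC (t ^ n / of_real (Gamma (\<delta> * real n + 1))) (a n))
            = of_real (kernel_coeff \<delta> n) * ((deriv ^^ n) g 0 / fact n) * s ^ n" for n
          unfolding taylor using a by (simp add: contraction_scale[OF f(1)] kernel_coeff_def ts power_mult_distrib)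
        ultimately have fsum: "(\<lambda>n. of_real (kernel_coeff \<delta> n) * ((deriv ^^ n) g 0 / fact n) * s ^ n) sums f (V \<delta> t)"
          by simp
        have "norm (f (V \<delta> t) - g s) \<le> \<bar>M\<bar> / h * \<kappa> * ((Re q - Re p) + (Im q - Im p))"
        proof (rule kernel_summation_error[OF W pqW g zero_in_box s_box \<delta> _ _ h _ fsum])
          fix \<zeta> assume "\<zeta> \<in> path_image (rectpath p q)"
          then have \<zeta>: "\<zeta> \<in> \<Gamma>" by (simp add: \<Gamma>_def)
          show "h \<le> cmod \<zeta>" by (rule far[OF \<zeta>])
          have "s / \<zeta> \<in> Q" using sK0 \<zeta> by (force simp: Q_def)
          then show "norm (approx_kernel \<delta> (s / \<zeta>) - 1 / (1 - s / \<zeta>)) \<le> \<kappa>" using elim by (simp add: less_imp_le)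
          have "u (w * \<zeta>) \<in> S" using \<zeta> pqW WG' uS by (auto simp: \<Gamma> G'_def)
          then show "norm (g \<zeta>) \<le> \<bar>M\<bar>"
            using contraction_norm[OF f(1), of "u (w * \<zeta>)"] M[OF \<zeta>] by (simp add: g_def)
        qed
        also have "\<dots> < \<epsilon>" using small by (simp add: L_def)
        also have "f (V \<delta> t) - g s = of_real (N (V \<delta> t - u t))"
          using f contraction_diff[OF f(1) VS uS[OF tG]] ts by (simp add: g_def)
        finally show "N (V \<delta> t - u t) < \<epsilon>" by simp
      qed
    qed
  qed
  moreover have "open U" "t0 \<in> U" using h by (auto simp: U_def)
  ultimately show ?thesis by blast
qed

end

text \<open>Applying \<open>A\<close> costs an arbitrarily small part of the interval \<open>(a, b)\<close>, so all iterates fit into it.\<close>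

lemma (in banach_scale_operator) iterate_in_scale:
  assumes "0 \<le> a" "a < b" "b < 1" "x \<in> X a"
  shows "(A ^^ n) x \<in> X b"
  using assms(2,3)
proof (induction n arbitrary: b)
  case 0
  then show ?case using inclusion[OF assms(1) 0] assms(4) by auto
next
  case (Suc n)
  define m where "m = (a + b) / 2"
  have m: "a < m" "m < b" "0 \<le> m" using Suc.prems assms(1) by (auto simp: m_def)
  have "(A ^^ n) x \<in> X m" using Suc.IH[OF m(1)] m Suc.prems by simp
  then show ?case using A_maps[OF m(3,2) Suc.prems(2)] by auto
qed

section \<open>Convergence on the star\<close>

theorem mainTheorem1:
  fixes scaleC :: "complex \<Rightarrow> 'e::ab_group_add \<Rightarrow> 'e"
    and X :: "real \<Rightarrow> 'e set" and N :: "real \<Rightarrow> 'e \<Rightarrow> real"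
    and A :: "'e \<Rightarrow> 'e" and C :: real
    and \<omega>' \<omega>'' T :: real and u0 :: 'e and u :: "complex \<Rightarrow> 'e"
  assumes "banach_scale_operator scaleC X N A C"
    and "0 \<le> \<omega>'" and "\<omega>' < \<omega>''" and "\<omega>'' < 1"
    and "u0 \<in> X \<omega>'" and "A u0 \<in> X \<omega>'"
    and "0 < T"
    and "\<And>t. cmod t < T \<Longrightarrow>
      norm_sums (X \<omega>'') (N \<omega>'') (\<lambda>n. scaleC (t ^ n / fact n) ((A ^^ n) u0)) (u t)"
    and "vholomorphic_on scaleC (X \<omega>'') (N \<omega>'') u
      (mittag_leffler_star scaleC (X \<omega>'') (N \<omega>'') u)"
  shows "(\<forall>t \<in> mittag_leffler_star scaleC (X \<omega>'') (N \<omega>'') u.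
      limitin (norm_topology (X \<omega>'') (N \<omega>''))
        (\<lambda>\<delta>. u_frac_entire scaleC (X \<omega>'') (N \<omega>'') A u0 \<delta> t) (u t) (at_right 1)) \<and>
    (\<forall>K. closed K \<and> bounded K \<and> K \<subseteq> mittag_leffler_star scaleC (X \<omega>'') (N \<omega>'') u \<longrightarrow>
      (\<forall>\<epsilon>>0. \<forall>\<^sub>F \<delta> in at_right 1. \<forall>t\<in>K.
        u_frac_entire scaleC (X \<omega>'') (N \<omega>'') A u0 \<delta> t \<in> X \<omega>'' \<and>
        N \<omega>'' (u_frac_entire scaleC (X \<omega>'') (N \<omega>'') A u0 \<delta> t - u t) < \<epsilon>))"
proof -
  interpret scale: banach_scale_operator scaleC X N A C by fact
  interpret complex_banach_subspace scaleC "X \<omega>''" "N \<omega>''"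
    using assms(2-4) by (intro scale.banach) auto
  define V where "V = u_frac_entire scaleC (X \<omega>'') (N \<omega>'') A u0"
  define G where "G = mittag_leffler_star scaleC (X \<omega>'') (N \<omega>'') u"
  have iter: "(A ^^ n) u0 \<in> X \<omega>''" for n
    using assms(2-5) by (intro scale.iterate_in_scale)
  have "\<exists>U. open U \<and> t0 \<in> U \<and> (\<forall>\<epsilon>>0. \<forall>\<^sub>F \<delta> in at_right 1. \<forall>t\<in>U. V \<delta> t \<in> X \<omega>'' \<and> N \<omega>'' (V \<delta> t - u t) < \<epsilon>)"
    if "t0 \<in> G" for t0
    using fractional_sum_local_convergence[OF iter assms(7-9) that[unfolded G_def]]
    by (simp add: V_def u_frac_entire_def)
  then have "\<forall>t0\<in>G. \<exists>U. open U \<and> t0 \<in> U \<and>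
      (\<forall>\<epsilon>>0. \<forall>\<^sub>F \<delta> in at_right 1. \<forall>t\<in>U. V \<delta> t \<in> X \<omega>'' \<and> N \<omega>'' (V \<delta> t - u t) < \<epsilon>)" by (rule ballI)
  from bchoice[OF this] obtain U where U: "\<forall>t0\<in>G. open (U t0) \<and> t0 \<in> U t0 \<and>
      (\<forall>\<epsilon>>0. \<forall>\<^sub>F \<delta> in at_right 1. \<forall>t\<in>U t0. V \<delta> t \<in> X \<omega>'' \<and> N \<omega>'' (V \<delta> t - u t) < \<epsilon>)"
    by (elim exE)
  have uniform: "\<forall>\<^sub>F \<delta> in at_right 1. \<forall>t\<in>K. V \<delta> t \<in> X \<omega>'' \<and> N \<omega>'' (V \<delta> t - u t) < \<epsilon>"
    if K: "closed K" "bounded K" "K \<subseteq> G" and \<epsilon>: "\<epsilon> > 0" for K \<epsilon>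
  proof -
    have "compact K" using K(1,2) by (simp add: compact_eq_bounded_closed)
    then obtain I where I: "I \<subseteq> K" "finite I" "K \<subseteq> (\<Union>t0\<in>I. U t0)"
      using compactE_image[of K K U] U K(3) by blast
    have "\<forall>\<^sub>F \<delta> in at_right 1. \<forall>t0\<in>I. \<forall>t\<in>U t0. V \<delta> t \<in> X \<omega>'' \<and> N \<omega>'' (V \<delta> t - u t) < \<epsilon>"
      using I(1,2) U K(3) \<epsilon> by (intro eventually_ball_finite) auto
    then show ?thesis by eventually_elim (use I(3) in blast)
  qed
  have "limitin (norm_topology (X \<omega>'') (N \<omega>'')) (\<lambda>\<delta>. V \<delta> t) (u t) (at_right 1)" if t: "t \<in> G" for t
    unfolding limitin_norm_topology
  proof (intro conjI allI impI)
    show "u t \<in> X \<omega>''" using assms(9) t by (simp add: vholomorphic_on_def G_def)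
    fix \<epsilon> :: real assume "\<epsilon> > 0"
    then show "\<forall>\<^sub>F \<delta> in at_right 1. V \<delta> t \<in> X \<omega>'' \<and> N \<omega>'' (V \<delta> t - u t) < \<epsilon>"
      using uniform[of "{t}" \<epsilon>] t by simp
  qed
  then show ?thesis using uniform unfolding V_def G_def by blast
qed

end
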